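(* Let $s\ge0$ and $f\in\mathcal V^{\mathrm{spec}}_s(M)$. For $K\ge1$ (an integer), define $$\sigma_K^{\mathrm{block}}(f;H^s):=\inf_{\substack{S\subset\mathbb N_0\\|S|\le K}}\Big\|f-\sum_{j\in S}P_jf\Big\|_{H^s(M)}.$$ Then $$\sigma_K^{\mathrm{block}}(f;H^s)\le\frac{\|f\|_{\mathcal V^{\mathrm{spec}}_s(M)}}{\sqrt{K+1}}.$$ In particular, $$\inf_{\substack{S\subset\mathbb N_0\\|S|\le K}}\Big\|f-\sum_{j\in S}P_jf\Big\|_{L^2(M)}\le\frac{\|f\|_{\mathcal V^{\mathrm{spec}}_s(M)}}{\sqrt{K+1}}.$$
   Context: $(M,g)$ is a compact connected smooth Riemannian manifold without boundary, $\nu$ is Riemannian volume normalized so that $\nu(M)=1$, $L^2(M)=L^2(M,\nu)$ (real-valued). $L=-\Delta_M$ is the nonnegative Laplace–Beltrami operator with distinct eigenvalues $0=\mu_0<\mu_1<\cdots$; $E_j=\ker(L-\mu_jI)$ and $P_j:L^2(M)\to E_j$ is the orthogonal projector. For $s\ge0$, $\|f\|_{\mathcal V^{\mathrm{spec}}_s(M)}=\sum_{j\ge0}(1+\mu_j)^{s/2}\|P_jf\|_{L^2(M)}$ and $\mathcal V^{\mathrm{spec}}_s(M)=\{f\in L^2(M):\|f\|_{\mathcal V^{\mathrm{spec}}_s(M)}<\infty\}$. The spectral Sobolev norm is $\|f\|_{H^s(M)}^2=\sum_{j\ge0}(1+\mu_j)^s\|P_jf\|_{L^2(M)}^2$. 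*)

theory Defs
  imports "HOL-Analysis.Analysis"
begin

section \<open>Smooth functions on open subsets of a Euclidean space\<close>

primrec times_cont_diff_on ::
  "nat \<Rightarrow> 'a::euclidean_space set \<Rightarrow> ('a \<Rightarrow> 'b::real_normed_vector) \<Rightarrow> bool" where
  "times_cont_diff_on 0 S f \<longleftrightarrow> continuous_on S f"
| "times_cont_diff_on (Suc k) S f \<longleftrightarrow>
     (\<forall>x\<in>S. f differentiable (at x)) \<and>
     (\<forall>v. times_cont_diff_on k S (\<lambda>x. frechet_derivative f (at x) v))"

text \<open>Only used for open \<open>S\<close>: the derivatives are unrestricted Frechet derivatives.\<close>

definition smooth_on :: "'a::euclidean_space set \<Rightarrow> ('a \<Rightarrow> 'b::real_normed_vector) \<Rightarrow> bool" where
  "smooth_on S f \<longleftrightarrow> (\<forall>k. times_cont_diff_on k S f)"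


section \<open>Compact Riemannian manifolds without boundary\<close>

text \<open>
  A manifold is a subset \<open>M\<close> of a Hausdorff space, with the subspace topology, together with an
  atlas of charts with open images in \<open>real ^ 'n\<close> (hence no boundary).  Second countability is
  automatic, because \<open>M\<close> is compact.  The atlas need not be maximal.
\<close>

record ('m, 'n::finite) chart =
  chart_dom :: "'m set"
  chart_map :: "'m \<Rightarrow> real ^ 'n"

definition chart_img :: "('m, 'n::finite) chart \<Rightarrow> (real ^ 'n) set" where
  "chart_img c = chart_map c ` chart_dom c"

definition chart_inv :: "('m, 'n::finite) chart \<Rightarrow> real ^ 'n \<Rightarrow> 'm" where
  "chart_inv c = inv_into (chart_dom c) (chart_map c)"

definition transition :: "('m, 'n::finite) chart \<Rightarrow> ('m, 'n) chart \<Rightarrow> real ^ 'n \<Rightarrow> real ^ 'n" where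
  "transition c d = chart_map d \<circ> chart_inv c"

definition smooth_atlas :: "'m::topological_space set \<Rightarrow> ('m, 'n::finite) chart set \<Rightarrow> bool" where
  "smooth_atlas M A \<longleftrightarrow>
     (\<forall>c\<in>A. openin (top_of_set M) (chart_dom c) \<and> open (chart_img c) \<and>
        homeomorphism (chart_dom c) (chart_img c) (chart_map c) (chart_inv c)) \<and>
     M = (\<Union>c\<in>A. chart_dom c) \<and>
     (\<forall>c\<in>A. \<forall>d\<in>A. smooth_on (chart_map c ` (chart_dom c \<inter> chart_dom d)) (transition c d))"

text \<open>
  \<open>g c p\<close> is the Gram matrix of the metric at \<open>p\<close> in the coordinate frame of the chart \<open>c\<close>.  The last
  condition is the transformation law of a covariant 2-tensor, so that the matrices in different
  charts describe one inner product on the tangent space at \<open>p\<close>.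
\<close>

definition riemannian_metric ::
  "('m, 'n::finite) chart set \<Rightarrow> (('m, 'n) chart \<Rightarrow> 'm \<Rightarrow> real ^ 'n ^ 'n) \<Rightarrow> bool" where
  "riemannian_metric A g \<longleftrightarrow>
     (\<forall>c\<in>A. smooth_on (chart_img c) (g c \<circ> chart_inv c)) \<and>
     (\<forall>c\<in>A. \<forall>p\<in>chart_dom c. transpose (g c p) = g c p \<and> (\<forall>v. v \<noteq> 0 \<longrightarrow> v \<bullet> (g c p *v v) > 0)) \<and>
     (\<forall>c\<in>A. \<forall>d\<in>A. \<forall>p\<in>chart_dom c \<inter> chart_dom d.
        let J = jacobian (transition c d) (at (chart_map c p))
        in g c p = transpose J ** g d p ** J)"

definition compact_connected_riemannian_manifold ::
  "'m::t2_space set \<Rightarrow> ('m, 'n::finite) chart set \<Rightarrow> (('m, 'n) chart \<Rightarrow> 'm \<Rightarrow> real ^ 'n ^ 'n) \<Rightarrow> bool"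
  where
  "compact_connected_riemannian_manifold M A g \<longleftrightarrow>
     M \<noteq> {} \<and> compact M \<and> connected M \<and> smooth_atlas M A \<and> riemannian_metric A g"

definition smooth_functions :: "('m, 'n::finite) chart set \<Rightarrow> ('m \<Rightarrow> real) set" where
  "smooth_functions A = {f. \<forall>c\<in>A. smooth_on (chart_img c) (f \<circ> chart_inv c)}"

text \<open>The Riemannian volume: the Borel measure on \<open>M\<close> that is \<open>sqrt (det g) dx\<close> in every chart.\<close>

definition riemannian_volume ::
  "'m::topological_space set \<Rightarrow> ('m, 'n::finite) chart set \<Rightarrow>
     (('m, 'n) chart \<Rightarrow> 'm \<Rightarrow> real ^ 'n ^ 'n) \<Rightarrow> 'm measure \<Rightarrow> bool" where
  "riemannian_volume M A g vol \<longleftrightarrow>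
     sets vol = sets (restrict_space borel M) \<and>
     (\<forall>c\<in>A. \<forall>B\<in>sets vol. B \<subseteq> chart_dom c \<longrightarrow>
        emeasure vol B =
          (\<integral>\<^sup>+x\<in>chart_map c ` B. ennreal (sqrt (det (g c (chart_inv c x)))) \<partial>lborel))"


section \<open>Real square-integrable functions\<close>

text \<open>
  Elements of \<open>L\<^sup>2\<close> are represented by functions; two functions that agree almost everywhere
  represent the same element, and \<open>l2_norm \<nu> f = 0\<close> means that \<open>f\<close> represents zero.
\<close>

definition L2 :: "'m measure \<Rightarrow> ('m \<Rightarrow> real) set" where
  "L2 \<nu> = {f \<in> borel_measurable \<nu>. integrable \<nu> (\<lambda>x. (f x)\<^sup>2)}"

definition l2_inner :: "'m measure \<Rightarrow> ('m \<Rightarrow> real) \<Rightarrow> ('m \<Rightarrow> real) \<Rightarrow> real" where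
  "l2_inner \<nu> f h = (LINT x|\<nu>. f x * h x)"

definition l2_norm :: "'m measure \<Rightarrow> ('m \<Rightarrow> real) \<Rightarrow> real" where
  "l2_norm \<nu> f = sqrt (l2_inner \<nu> f f)"


section \<open>The Laplace--Beltrami operator\<close>

definition coord_partials :: "('m, 'n::finite) chart \<Rightarrow> ('m \<Rightarrow> real) \<Rightarrow> 'm \<Rightarrow> real ^ 'n" where
  "coord_partials c f p =
     (\<chi> i. frechet_derivative (f \<circ> chart_inv c) (at (chart_map c p)) (axis i 1))"

definition grad ::
  "(('m, 'n::finite) chart \<Rightarrow> 'm \<Rightarrow> real ^ 'n ^ 'n) \<Rightarrow> ('m, 'n) chart \<Rightarrow> ('m \<Rightarrow> real) \<Rightarrow> 'm \<Rightarrow> real ^ 'n"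
  where
  "grad g c f p = matrix_inv (g c p) *v coord_partials c f p"

text \<open>
  The inner product of the gradients at \<open>p\<close>, evaluated in some chart around \<open>p\<close>; by the
  transformation law of \<open>g\<close> it does not depend on the chart.
\<close>

definition grad_inner ::
  "('m, 'n::finite) chart set \<Rightarrow> (('m, 'n) chart \<Rightarrow> 'm \<Rightarrow> real ^ 'n ^ 'n) \<Rightarrow>
     ('m \<Rightarrow> real) \<Rightarrow> ('m \<Rightarrow> real) \<Rightarrow> 'm \<Rightarrow> real" where
  "grad_inner A g f h p =
     (let c = (SOME c. c \<in> A \<and> p \<in> chart_dom c)
      in grad g c f p \<bullet> (g c p *v grad g c h p))"

definition dirichlet_form ::
  "('m, 'n::finite) chart set \<Rightarrow> (('m, 'n) chart \<Rightarrow> 'm \<Rightarrow> real ^ 'n ^ 'n) \<Rightarrow> 'm measure \<Rightarrow>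
     ('m \<Rightarrow> real) \<Rightarrow> ('m \<Rightarrow> real) \<Rightarrow> real" where
  "dirichlet_form A g \<nu> f h = (LINT p|\<nu>. grad_inner A g f h p)"

text \<open>
  \<open>laplace_beltrami A g \<nu> u h\<close> is the graph of the nonnegative self-adjoint operator
  \<open>L = - div grad\<close> on \<open>L\<^sup>2\<close>.  Its first part says that \<open>u\<close> lies in the closure of the smooth functions
  in the norm of \<open>L\<^sup>2\<close> functions with \<open>L\<^sup>2\<close> gradient: smooth \<open>\<phi> k\<close> converge to \<open>u\<close> and their gradients
  are Cauchy, the limit being the gradient of \<open>u\<close>.  Its second part says that \<open>h\<close> is minus the
  divergence of that gradient, where the divergence is minus the adjoint of the gradient:
  the integral of \<open>\<langle>grad u, grad \<psi>\<rangle>\<close> is the integral of \<open>h \<psi>\<close> for all smooth \<open>\<psi>\<close>.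
\<close>

definition laplace_beltrami ::
  "('m, 'n::finite) chart set \<Rightarrow> (('m, 'n) chart \<Rightarrow> 'm \<Rightarrow> real ^ 'n ^ 'n) \<Rightarrow> 'm measure \<Rightarrow>
     ('m \<Rightarrow> real) \<Rightarrow> ('m \<Rightarrow> real) \<Rightarrow> bool" where
  "laplace_beltrami A g \<nu> u h \<longleftrightarrow>
     u \<in> L2 \<nu> \<and> h \<in> L2 \<nu> \<and>
     (\<exists>\<phi> :: nat \<Rightarrow> 'm \<Rightarrow> real.
        (\<forall>k. \<phi> k \<in> smooth_functions A) \<and>
        (\<lambda>k. l2_norm \<nu> (\<lambda>x. \<phi> k x - u x)) \<longlonglongrightarrow> 0 \<and>
        (\<forall>\<epsilon>>0. \<exists>N. \<forall>k\<ge>N. \<forall>l\<ge>N.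
           dirichlet_form A g \<nu> (\<lambda>x. \<phi> k x - \<phi> l x) (\<lambda>x. \<phi> k x - \<phi> l x) < \<epsilon>) \<and>
        (\<forall>\<psi>\<in>smooth_functions A. (\<lambda>k. dirichlet_form A g \<nu> (\<phi> k) \<psi>) \<longlonglongrightarrow> l2_inner \<nu> h \<psi>))"

text \<open>The kernel of \<open>L - \<kappa> I\<close>.\<close>

definition eigenspace ::
  "('m, 'n::finite) chart set \<Rightarrow> (('m, 'n) chart \<Rightarrow> 'm \<Rightarrow> real ^ 'n ^ 'n) \<Rightarrow> 'm measure \<Rightarrow>
     real \<Rightarrow> ('m \<Rightarrow> real) set" where
  "eigenspace A g \<nu> \<kappa> = {u. laplace_beltrami A g \<nu> u (\<lambda>x. \<kappa> * u x)}"

definition eigenvalues ::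
  "('m, 'n::finite) chart set \<Rightarrow> (('m, 'n) chart \<Rightarrow> 'm \<Rightarrow> real ^ 'n ^ 'n) \<Rightarrow> 'm measure \<Rightarrow> real set"
  where
  "eigenvalues A g \<nu> = {\<kappa>. \<exists>u\<in>eigenspace A g \<nu> \<kappa>. l2_norm \<nu> u \<noteq> 0}"


section \<open>Spectral norms\<close>

text \<open>The orthogonal projection of \<open>f\<close> to the subspace \<open>E\<close>, determined up to null sets.\<close>

definition l2_proj :: "'m measure \<Rightarrow> ('m \<Rightarrow> real) set \<Rightarrow> ('m \<Rightarrow> real) \<Rightarrow> 'm \<Rightarrow> real" where
  "l2_proj \<nu> E f = (SOME u. u \<in> E \<and> (\<forall>h\<in>E. l2_inner \<nu> (\<lambda>x. f x - u x) h = 0))"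

text \<open>
  In the following definitions, \<open>\<mu>\<close> is the sequence of the distinct eigenvalues and \<open>P j\<close> is the
  orthogonal projector to the eigenspace of \<open>\<mu> j\<close>.  The norms are infinite if the series diverge.
\<close>

definition spec_variation_norm ::
  "'m measure \<Rightarrow> (nat \<Rightarrow> real) \<Rightarrow> (nat \<Rightarrow> ('m \<Rightarrow> real) \<Rightarrow> 'm \<Rightarrow> real) \<Rightarrow> real \<Rightarrow> ('m \<Rightarrow> real) \<Rightarrow> ereal"
  where
  "spec_variation_norm \<nu> \<mu> P s f =
     (let a = (\<lambda>j. (1 + \<mu> j) powr (s / 2) * l2_norm \<nu> (P j f))
      in if summable a then ereal (suminf a) else \<infinity>)"

definition spec_variation_space ::
  "'m measure \<Rightarrow> (nat \<Rightarrow> real) \<Rightarrow> (nat \<Rightarrow> ('m \<Rightarrow> real) \<Rightarrow> 'm \<Rightarrow> real) \<Rightarrow> real \<Rightarrow> ('m \<Rightarrow> real) set"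
  where
  "spec_variation_space \<nu> \<mu> P s = {f \<in> L2 \<nu>. spec_variation_norm \<nu> \<mu> P s f < \<infinity>}"

definition spec_sobolev_norm ::
  "'m measure \<Rightarrow> (nat \<Rightarrow> real) \<Rightarrow> (nat \<Rightarrow> ('m \<Rightarrow> real) \<Rightarrow> 'm \<Rightarrow> real) \<Rightarrow> real \<Rightarrow> ('m \<Rightarrow> real) \<Rightarrow> ereal"
  where
  "spec_sobolev_norm \<nu> \<mu> P s f =
     (let a = (\<lambda>j. (1 + \<mu> j) powr s * (l2_norm \<nu> (P j f))\<^sup>2)
      in if summable a then ereal (sqrt (suminf a)) else \<infinity>)"

definition block_residual ::
  "(nat \<Rightarrow> ('m \<Rightarrow> real) \<Rightarrow> 'm \<Rightarrow> real) \<Rightarrow> ('m \<Rightarrow> real) \<Rightarrow> nat set \<Rightarrow> 'm \<Rightarrow> real" where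
  "block_residual P f S x = f x - (\<Sum>j\<in>S. P j f x)"

text \<open>The error of the best approximation by at most \<open>K\<close> eigenspace blocks in a given norm.\<close>

definition sigma_block ::
  "(nat \<Rightarrow> ('m \<Rightarrow> real) \<Rightarrow> 'm \<Rightarrow> real) \<Rightarrow> nat \<Rightarrow> ('m \<Rightarrow> real) \<Rightarrow> (('m \<Rightarrow> real) \<Rightarrow> ereal) \<Rightarrow> ereal"
  where
  "sigma_block P K f nrm = (INF S\<in>{S. finite S \<and> card S \<le> K}. nrm (block_residual P f S))"

end

theory Submission
  imports Defs "HOL-Library.Function_Algebras" "HOL-Library.Diagonal_Subsequence"
begin

text \<open>
  Put \<open>a j = (1 + \<mu> j) powr (s / 2) * \<parallel>P j f\<parallel>\<close> and let \<open>A\<close> be the sum of the \<open>a j\<close>.  The residual of a set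
  \<open>S\<close> has the same projections as \<open>f\<close> outside \<open>S\<close> and no others, so the square of its Sobolev norm is
  the sum of the \<open>(a j)\<^sup>2\<close> over \<open>j \<notin> S\<close>; the square of its \<open>L\<^sup>2\<close> norm is the sum of the \<open>\<parallel>P j f\<parallel>\<^sup>2\<close> over
  the same \<open>j\<close>, which is at most as large because \<open>s \<ge> 0\<close>.  Choose for \<open>S\<close> the indices of the \<open>K\<close> largest
  \<open>a j\<close> and let \<open>t\<close> be the smallest of these.  Then the tail of the squares is at most
  \<open>t * (A - K * t) \<le> A\<^sup>2 / (4 * K) \<le> A\<^sup>2 / (K + 1)\<close>; this is \<open>l2_tail_of_summable\<close>.

  The Sobolev norm only sees projections, and for it orthogonality of the eigenspaces and existence of
  the projections suffice.  The statement on the \<open>L\<^sup>2\<close> norm is Parseval's identity \<open>parseval\<close>.  It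
  contains the completeness of the eigenfunctions (take \<open>f\<close> orthogonal to all of them), so the spectral
  theorem for the Laplace--Beltrami operator has to be proved.

  Its functional-analytic half is the locale \<open>form_operator\<close>.  The Riesz representation theorem for the
  energy form gives the resolvent \<open>T\<close>, a symmetric positive operator.  A form domain that is precompact
  in the Hilbert space makes \<open>T\<close> compact, so on the orthogonal complement of all eigenvectors the
  quadratic form of \<open>T\<close> would attain its supremum if this were positive; but a maximiser is an
  eigenvector.  Hence the form vanishes there, and because the form domain is dense, the complement
  is zero (\<open>eigenvectors_complete\<close>).

  Its geometric half consists of the completeness of \<open>L\<^sup>2\<close> (\<open>L2_complete\<close>), the density of the smooth
  functions (\<open>smooth_dense\<close>) and the precompactness of the form domain (\<open>form_domain_precompact\<close>).
  Precompactness is stated as a family of inequalities: for every \<open>e\<close>, up to finitely many bounded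
  functionals the square of the \<open>L\<^sup>2\<close> norm is at most \<open>e\<close> times the energy.  In this form it is local.
  It follows from the Poincare inequality on the small convex cells of finitely many coordinate balls
  that cover the manifold, the functionals being the integrals over the cells.  Overlaps of the balls
  do no harm, because both sides are added up over the balls.
\<close>

section \<open>Semi-inner products on a subspace\<close>

text \<open>
  The Cauchy--Schwarz inequality and the Euler--Lagrange equation of a minimisation problem are both
  instances.
\<close>

lemma nonneg_quadratic_discriminant:
  fixes a b c :: real
  assumes "\<And>t. c + 2 * t * b + t\<^sup>2 * a \<ge> 0"
  shows "b\<^sup>2 \<le> a * c"
proof (cases "a = 0")
  case True
  have "b = 0"
  proof (rule ccontr)
    assume b: "b \<noteq> 0"
    have "c + 2 * (- (c + 1) / (2 * b)) * b + (- (c + 1) / (2 * b))\<^sup>2 * a \<ge> 0"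
      by (rule assms)
    moreover have "2 * (- (c + 1) / (2 * b)) * b = - (c + 1)" using b by (simp add: field_simps)
    ultimately show False using True by simp
  qed
  then show ?thesis using True by simp
next
  case False
  have "a > 0"
  proof (rule ccontr)
    assume "\<not> a > 0"
    with False have a: "a < 0" by simp
    \<comment> \<open>a point \<open>t \<ge> 1\<close> at which the negative quadratic term beats the other two\<close>
    define t where "t = 1 + (\<bar>c\<bar> + 2 * \<bar>b\<bar>) / (- a)"
    have t1: "t \<ge> 1" using a divide_nonneg_pos[of "\<bar>c\<bar> + 2 * \<bar>b\<bar>" "- a"] by (simp add: t_def)
    have "- a * t = - a + (\<bar>c\<bar> + 2 * \<bar>b\<bar>)" using a by (simp add: t_def field_simps)
    then have "- a * t > \<bar>c\<bar> + 2 * \<bar>b\<bar>" using a by linarith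
    then have "(- a * t) * t > (\<bar>c\<bar> + 2 * \<bar>b\<bar>) * t" using t1 by (intro mult_strict_right_mono) auto
    moreover have "\<bar>c\<bar> * t \<ge> \<bar>c\<bar> * 1" by (intro mult_left_mono t1) auto
    moreover have "t * b \<le> t * \<bar>b\<bar>" using t1 by (intro mult_left_mono) auto
    ultimately have "c + 2 * t * b + t\<^sup>2 * a < 0"
      by (simp add: power2_eq_square algebra_simps)
    with assms[of t] show False by simp
  qed
  have "c + 2 * (- b / a) * b + (- b / a)\<^sup>2 * a \<ge> 0" by (rule assms)
  moreover have "c + 2 * (- b / a) * b + (- b / a)\<^sup>2 * a = c - b\<^sup>2 / a"
    using \<open>a > 0\<close> by (simp add: field_simps power2_eq_square)
  ultimately have "b\<^sup>2 / a \<le> c" by linarith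
  then show ?thesis using \<open>a > 0\<close> by (simp add: pos_divide_le_eq mult.commute)
qed

lemma abs_less_of_power2_less:
  fixes a e :: real
  assumes "a\<^sup>2 < e\<^sup>2" "e \<ge> 0"
  shows "\<bar>a\<bar> < e"
  by (rule power2_less_imp_less) (use assms in simp_all)

text \<open>
  Elements of \<open>L\<^sup>2\<close> are represented by functions, so vectors of norm zero need not vanish, and the forms
  are only meaningful on a subspace of the ambient type.  Equality of vectors is replaced by
  \<open>B (x - y) (x - y) = 0\<close> throughout.
\<close>

locale semi_inner =
  fixes V :: "'v::real_vector set" and B :: "'v \<Rightarrow> 'v \<Rightarrow> real"
  assumes V: "subspace V"
    and sym: "x \<in> V \<Longrightarrow> y \<in> V \<Longrightarrow> B x y = B y x"
    and add_left: "x \<in> V \<Longrightarrow> y \<in> V \<Longrightarrow> z \<in> V \<Longrightarrow> B (x + y) z = B x z + B y z"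
    and scale_left: "x \<in> V \<Longrightarrow> y \<in> V \<Longrightarrow> B (c *\<^sub>R x) y = c * B x y"
    and nonneg: "x \<in> V \<Longrightarrow> B x x \<ge> 0"
begin

lemma mem [simp, intro]:
  "0 \<in> V" "x \<in> V \<Longrightarrow> y \<in> V \<Longrightarrow> x + y \<in> V" "x \<in> V \<Longrightarrow> y \<in> V \<Longrightarrow> x - y \<in> V"
  "x \<in> V \<Longrightarrow> c *\<^sub>R x \<in> V"
  using V by (auto simp: subspace_def subspace_diff)

lemma diff_left: "x \<in> V \<Longrightarrow> y \<in> V \<Longrightarrow> z \<in> V \<Longrightarrow> B (x - y) z = B x z - B y z"
  using add_left[of x "(-1) *\<^sub>R y" z] scale_left[of y z "-1"] mem(4)[of y "-1"] by simp

lemma add_right: "x \<in> V \<Longrightarrow> y \<in> V \<Longrightarrow> z \<in> V \<Longrightarrow> B z (x + y) = B z x + B z y"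
  by (metis add_left mem(2) sym)

lemma diff_right: "x \<in> V \<Longrightarrow> y \<in> V \<Longrightarrow> z \<in> V \<Longrightarrow> B z (x - y) = B z x - B z y"
  by (metis diff_left mem(3) sym)

lemma scale_right: "x \<in> V \<Longrightarrow> y \<in> V \<Longrightarrow> B y (c *\<^sub>R x) = c * B y x"
  by (metis scale_left mem(4) sym)

lemmas bilin = add_left add_right diff_left diff_right scale_left scale_right

lemma zero_left [simp]: "x \<in> V \<Longrightarrow> B 0 x = 0"
  using scale_left[of 0 x 0] by simp

lemma zero_right [simp]: "x \<in> V \<Longrightarrow> B x 0 = 0"
  using zero_left sym by auto

lemma Cauchy_Schwarz: "x \<in> V \<Longrightarrow> y \<in> V \<Longrightarrow> (B x y)\<^sup>2 \<le> B x x * B y y"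
proof -
  assume x: "x \<in> V" and y: "y \<in> V"
  have "B y y + 2 * t * B x y + t\<^sup>2 * B x x \<ge> 0" for t
    using nonneg[of "t *\<^sub>R x + y"] x y sym[OF x y]
    by (simp add: bilin algebra_simps power2_eq_square)
  from nonneg_quadratic_discriminant[OF this] show ?thesis by simp
qed

lemma null: "x \<in> V \<Longrightarrow> y \<in> V \<Longrightarrow> B x x = 0 \<Longrightarrow> B x y = 0"
  using Cauchy_Schwarz[of x y] by simp

lemma null_right: "x \<in> V \<Longrightarrow> y \<in> V \<Longrightarrow> B y y = 0 \<Longrightarrow> B x y = 0"
  using null[of y x] sym by simp

lemma quasi_triangle: "x \<in> V \<Longrightarrow> y \<in> V \<Longrightarrow> B (x + y) (x + y) \<le> 2 * B x x + 2 * B y y"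
  using nonneg[of "x - y"] sym[of x y] by (simp add: bilin)

lemma quasi_triangle_diff: "x \<in> V \<Longrightarrow> y \<in> V \<Longrightarrow> B (x - y) (x - y) \<le> 2 * B x x + 2 * B y y"
  using nonneg[of "x + y"] sym[of x y] by (simp add: bilin)

definition converges :: "(nat \<Rightarrow> 'v) \<Rightarrow> 'v \<Rightarrow> bool" where
  "converges x u \<longleftrightarrow> (\<lambda>k. B (x k - u) (x k - u)) \<longlonglongrightarrow> 0"

definition cauchy :: "(nat \<Rightarrow> 'v) \<Rightarrow> bool" where
  "cauchy x \<longleftrightarrow> (\<forall>e>0. \<exists>N. \<forall>k\<ge>N. \<forall>l\<ge>N. B (x k - x l) (x k - x l) < e)"

lemma sym_diff: "x \<in> V \<Longrightarrow> y \<in> V \<Longrightarrow> B (x - y) (x - y) = B (y - x) (y - x)"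
  using sym[of x y] by (simp add: bilin)

lemma converges_inner:
  assumes x: "\<And>k. x k \<in> V" and u: "u \<in> V" and y: "y \<in> V" and c: "converges x u"
  shows "(\<lambda>k. B (x k) y) \<longlonglongrightarrow> B u y"
proof -
  have "(\<lambda>k. sqrt (B (x k - u) (x k - u) * B y y)) \<longlonglongrightarrow> sqrt (0 * B y y)"
    using c unfolding converges_def by (intro tendsto_intros)
  then have l: "(\<lambda>k. sqrt (B (x k - u) (x k - u) * B y y)) \<longlonglongrightarrow> 0" by simp
  have "\<bar>B (x k) y - B u y\<bar> \<le> sqrt (B (x k - u) (x k - u) * B y y)" for k
    using Cauchy_Schwarz[of "x k - u" y] x u y
    by (intro real_le_rsqrt) (simp add: diff_left)
  then have "(\<lambda>k. B (x k) y - B u y) \<longlonglongrightarrow> 0"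
    by (intro Lim_null_comparison[OF _ l]) auto
  then show ?thesis by (simp add: LIM_zero_iff)
qed

lemma cauchy_bounded:
  assumes x: "\<And>k. x k \<in> V" and c: "cauchy x"
  obtains C where "C > 0" "\<And>k. B (x k) (x k) \<le> C"
proof -
  obtain N where N: "\<And>k l. k \<ge> N \<Longrightarrow> l \<ge> N \<Longrightarrow> B (x k - x l) (x k - x l) < 1"
    using c unfolding cauchy_def by (meson zero_less_one)
  define C where "C = 2 + 2 * B (x N) (x N) + (\<Sum>k<N. B (x k) (x k))"
  have nn: "(\<Sum>k<N. B (x k) (x k)) \<ge> 0" by (intro sum_nonneg nonneg x)
  have "B (x k) (x k) \<le> C" for k
  proof (cases "k < N")
    case True
    then have "B (x k) (x k) \<le> (\<Sum>k<N. B (x k) (x k))"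
      by (intro member_le_sum) (auto intro: nonneg x)
    then show ?thesis using nonneg[OF x[of N]] by (simp add: C_def)
  next
    case False
    then have "B (x k - x N) (x k - x N) < 1" by (intro N) auto
    moreover have "B ((x k - x N) + x N) ((x k - x N) + x N)
        \<le> 2 * B (x k - x N) (x k - x N) + 2 * B (x N) (x N)"
      using x by (intro quasi_triangle) auto
    ultimately show ?thesis using nn by (simp add: C_def)
  qed
  moreover have "C > 0" using nn nonneg[OF x[of N]] by (simp add: C_def)
  ultimately show ?thesis using that by blast
qed

text \<open>
  The two indices are independent in the second conclusion; this is what allows the two iterated limits
  to be exchanged when the form is only known on approximating sequences.
\<close>

lemma cauchy_inner_uniform:
  assumes x: "\<And>k. x k \<in> V" and cx: "cauchy x" and y: "\<And>k. y k \<in> V" and cy: "cauchy y"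
  obtains L where
    "(\<lambda>k. B (x k) (y k)) \<longlonglongrightarrow> L"
    "\<And>e. e > 0 \<Longrightarrow> \<exists>N. \<forall>k\<ge>N. \<forall>l\<ge>N. \<bar>B (x k) (y l) - L\<bar> < e"
proof -
  obtain C1 where C1: "C1 > 0" "\<And>k. B (x k) (x k) \<le> C1" using cauchy_bounded[OF x cx] by blast
  obtain C2 where C2: "C2 > 0" "\<And>k. B (y k) (y k) \<le> C2" using cauchy_bounded[OF y cy] by blast
  have key: "\<exists>N. \<forall>k\<ge>N. \<forall>l\<ge>N. \<forall>k'\<ge>N. \<forall>l'\<ge>N. \<bar>B (x k) (y l) - B (x k') (y l')\<bar> < e"
    if e: "e > 0" for e
  proof -
    define d where "d = (e / 2)\<^sup>2 / (C1 + C2)"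
    have d: "d > 0" using e C1(1) C2(1) by (simp add: d_def)
    obtain N1 where N1: "\<And>k l. k \<ge> N1 \<Longrightarrow> l \<ge> N1 \<Longrightarrow> B (x k - x l) (x k - x l) < d"
      using cx d unfolding cauchy_def by blast
    obtain N2 where N2: "\<And>k l. k \<ge> N2 \<Longrightarrow> l \<ge> N2 \<Longrightarrow> B (y k - y l) (y k - y l) < d"
      using cy d unfolding cauchy_def by blast
    have dC: "d * (C1 + C2) = (e / 2)\<^sup>2" using C1(1) C2(1) by (simp add: d_def)
    have "\<bar>B (x k) (y l) - B (x k') (y l')\<bar> < e"
      if k: "k \<ge> max N1 N2" and l: "l \<ge> max N1 N2" and k': "k' \<ge> max N1 N2" and l': "l' \<ge> max N1 N2"
      for k l k' l'
    proof -
      have "(B (x k - x k') (y l))\<^sup>2 \<le> B (x k - x k') (x k - x k') * B (y l) (y l)"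
        using x y by (intro Cauchy_Schwarz) auto
      also have "\<dots> \<le> B (x k - x k') (x k - x k') * C2"
        using x C2 nonneg by (intro mult_left_mono) auto
      also have "\<dots> < d * (C1 + C2)"
        using N1[of k k'] k k' C1(1) C2(1) d by (intro mult_strict_mono) auto
      finally have 1: "\<bar>B (x k - x k') (y l)\<bar> < e / 2"
        unfolding dC using e by (intro abs_less_of_power2_less) auto
      have "(B (x k') (y l - y l'))\<^sup>2 \<le> B (x k') (x k') * B (y l - y l') (y l - y l')"
        using x y by (intro Cauchy_Schwarz) auto
      also have "\<dots> \<le> C1 * B (y l - y l') (y l - y l')"
        using y C1 nonneg by (intro mult_right_mono) auto
      also have "\<dots> < (C1 + C2) * d"
        using N2[of l l'] l l' C1(1) C2(1) d nonneg[of "y l - y l'"] y by (intro mult_strict_mono) auto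
      finally have 2: "\<bar>B (x k') (y l - y l')\<bar> < e / 2"
        unfolding mult.commute[of _ d] dC using e by (intro abs_less_of_power2_less) auto
      have "\<bar>B (x k) (y l) - B (x k') (y l)\<bar> < e / 2" "\<bar>B (x k') (y l) - B (x k') (y l')\<bar> < e / 2"
        using 1 2 x y by (simp_all add: bilin)
      then show ?thesis by linarith
    qed
    then show ?thesis by blast
  qed
  have "Cauchy (\<lambda>k. B (x k) (y k))"
  proof (rule CauchyI)
    fix e :: real assume "e > 0"
    from key[OF this] obtain N where N: "\<And>k l k' l'. k \<ge> N \<Longrightarrow> l \<ge> N \<Longrightarrow> k' \<ge> N \<Longrightarrow> l' \<ge> N \<Longrightarrow>
      \<bar>B (x k) (y l) - B (x k') (y l')\<bar> < e" by blast
    then show "\<exists>N. \<forall>k\<ge>N. \<forall>l\<ge>N. norm (B (x k) (y k) - B (x l) (y l)) < e" by (auto intro!: exI[of _ N])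
  qed
  then obtain L where L: "(\<lambda>k. B (x k) (y k)) \<longlonglongrightarrow> L"
    by (auto simp: Cauchy_convergent_iff convergent_def)
  have "\<exists>N. \<forall>k\<ge>N. \<forall>l\<ge>N. \<bar>B (x k) (y l) - L\<bar> < e" if e: "e > 0" for e
  proof -
    obtain N1 where N1: "\<And>k l k' l'. k \<ge> N1 \<Longrightarrow> l \<ge> N1 \<Longrightarrow> k' \<ge> N1 \<Longrightarrow> l' \<ge> N1 \<Longrightarrow>
      \<bar>B (x k) (y l) - B (x k') (y l')\<bar> < e / 2"
      using key[of "e / 2"] e by (meson half_gt_zero)
    obtain N2 where N2: "\<And>k. k \<ge> N2 \<Longrightarrow> \<bar>B (x k) (y k) - L\<bar> < e / 2"
      using LIMSEQ_D[OF L, of "e / 2"] e by auto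
    have "\<bar>B (x k) (y l) - L\<bar> < e" if "k \<ge> N1" "l \<ge> N1" for k l
    proof -
      have "\<bar>B (x k) (y l) - B (x (max N1 N2)) (y (max N1 N2))\<bar> < e / 2" using that by (intro N1) auto
      moreover have "\<bar>B (x (max N1 N2)) (y (max N1 N2)) - L\<bar> < e / 2" by (intro N2) auto
      ultimately show ?thesis by linarith
    qed
    then show ?thesis by blast
  qed
  with L that show ?thesis by blast
qed

lemma converges_norm:
  assumes x: "\<And>k. x k \<in> V" and u: "u \<in> V" and c: "converges x u"
  shows "(\<lambda>k. B (x k) (x k)) \<longlonglongrightarrow> B u u"
proof -
  have "(\<lambda>k. B (x k - u) (x k - u) + 2 * B (x k) u - B u u) \<longlonglongrightarrow> 0 + 2 * B u u - B u u"
    using c unfolding converges_def by (intro tendsto_intros converges_inner[OF x u u]) (simp_all add: c converges_def)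
  moreover have "B (x k - u) (x k - u) + 2 * B (x k) u - B u u = B (x k) (x k)" for k
    using x[of k] u sym[OF x[of k] u] by (simp add: bilin)
  ultimately show ?thesis by simp
qed

text \<open>
  Riesz representation without completeness.  A minimising sequence of \<open>J x = B x x - 2 * \<phi> x\<close> is a
  Cauchy sequence by the parallelogram law, and the Euler--Lagrange equation holds in the limit.  The
  limit itself lives in a completion that depends on the form, so it is represented by the sequence.
\<close>

lemma riesz_sequence:
  assumes add: "\<And>x y. x \<in> V \<Longrightarrow> y \<in> V \<Longrightarrow> \<phi> (x + y) = \<phi> x + \<phi> y"
    and scale: "\<And>x c. x \<in> V \<Longrightarrow> \<phi> (c *\<^sub>R x) = c * \<phi> x"
    and bound: "\<And>x. x \<in> V \<Longrightarrow> (\<phi> x)\<^sup>2 \<le> C * B x x"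
  obtains x where "\<And>k. x k \<in> V" "cauchy x" "\<And>y. y \<in> V \<Longrightarrow> (\<lambda>k. B (x k) y) \<longlonglongrightarrow> \<phi> y"
proof -
  define J where "J x = B x x - 2 * \<phi> x" for x
  define m where "m = (INF x\<in>V. J x)"
  have low: "J x \<ge> - \<bar>C\<bar>" if x: "x \<in> V" for x
  proof -
    have "(\<phi> x)\<^sup>2 \<le> \<bar>C\<bar> * B x x" using bound[OF x] nonneg[OF x]
      by (meson abs_ge_self mult_right_mono order_trans)
    \<comment> \<open>arithmetic and geometric mean: \<open>J\<close> is bounded below\<close>
    moreover have "4 * (\<bar>C\<bar> * B x x) \<le> (\<bar>C\<bar> + B x x)\<^sup>2"
      using zero_le_power2[of "\<bar>C\<bar> - B x x"] by (simp add: power2_eq_square algebra_simps)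
    ultimately have "(2 * \<phi> x)\<^sup>2 \<le> (\<bar>C\<bar> + B x x)\<^sup>2"
      by (simp add: power_mult_distrib)
    then have "2 * \<phi> x \<le> \<bar>C\<bar> + B x x" by (rule power2_le_imp_le) (use nonneg[OF x] in auto)
    then show ?thesis by (simp add: J_def)
  qed
  have bdd: "bdd_below (J ` V)" by (rule bdd_belowI[of _ "- \<bar>C\<bar>"]) (use low in auto)
  have m_le: "m \<le> J x" if "x \<in> V" for x unfolding m_def by (rule cINF_lower[OF bdd that])
  have "\<exists>x\<in>V. J x < m + inverse (real (Suc k))" for k
    using cINF_less_iff[of V J "m + inverse (real (Suc k))"] bdd mem(1) unfolding m_def[symmetric]
    by fastforce
  then obtain x where x: "\<And>k. x k \<in> V" and Jx: "\<And>k. J (x k) < m + inverse (real (Suc k))"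
    by metis
  have "B (x k - x l) (x k - x l) \<le> 2 * inverse (real (Suc k)) + 2 * inverse (real (Suc l))" for k l
  proof -
    have "J ((1/2) *\<^sub>R (x k + x l)) \<ge> m" using x by (intro m_le) auto
    moreover have "J ((1/2) *\<^sub>R (x k + x l)) =
        J (x k) / 2 + J (x l) / 2 - B (x k - x l) (x k - x l) / 4"
      using x[of k] x[of l] sym[OF x[of k] x[of l]]
      by (simp add: J_def bilin add scale) (simp add: field_simps)
    ultimately show ?thesis using Jx[of k] Jx[of l] by linarith
  qed
  note close = this
  have "cauchy x" unfolding cauchy_def
  proof (intro allI impI)
    fix e :: real assume e: "e > 0"
    obtain N where N: "inverse (real (Suc N)) < e / 4" using reals_Archimedean[of "e / 4"] e by auto
    have "B (x k - x l) (x k - x l) < e" if "k \<ge> N" "l \<ge> N" for k l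
    proof -
      have "inverse (real (Suc k)) \<le> inverse (real (Suc N))"
        "inverse (real (Suc l)) \<le> inverse (real (Suc N))" using that by (auto intro!: le_imp_inverse_le)
      then show ?thesis using close[of k l] N by linarith
    qed
    then show "\<exists>N. \<forall>k\<ge>N. \<forall>l\<ge>N. B (x k - x l) (x k - x l) < e" by blast
  qed
  moreover have "(\<lambda>k. B (x k) y) \<longlonglongrightarrow> \<phi> y" if y: "y \<in> V" for y
  proof -
    have "(B (x k) y - \<phi> y)\<^sup>2 \<le> B y y * inverse (real (Suc k))" for k
    proof -
      have "inverse (real (Suc k)) + 2 * t * (B (x k) y - \<phi> y) + t\<^sup>2 * B y y \<ge> 0" for t
      proof -
        have "J (x k + t *\<^sub>R y) \<ge> m" using x y by (intro m_le) auto
        moreover have "J (x k + t *\<^sub>R y) = J (x k) + 2 * t * (B (x k) y - \<phi> y) + t\<^sup>2 * B y y"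
          using x[of k] y sym[OF x[of k] y]
          by (simp add: J_def bilin add scale) (simp add: algebra_simps power2_eq_square)
        ultimately show ?thesis using Jx[of k] by linarith
      qed
      then show ?thesis by (rule nonneg_quadratic_discriminant)
    qed
    then have le: "\<bar>B (x k) y - \<phi> y\<bar> \<le> sqrt (B y y * inverse (real (Suc k)))" for k
      by (intro real_le_rsqrt) simp
    have "(\<lambda>k. sqrt (B y y * inverse (real (Suc k)))) \<longlonglongrightarrow> sqrt (B y y * 0)"
      by (intro tendsto_intros LIMSEQ_inverse_real_of_nat)
    then have "(\<lambda>k. B (x k) y - \<phi> y) \<longlonglongrightarrow> 0"
      by (intro Lim_null_comparison[of "\<lambda>k. B (x k) y - \<phi> y"
            "\<lambda>k. sqrt (B y y * inverse (real (Suc k)))"]) (use le in auto)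
    then show ?thesis by (simp add: LIM_zero_iff)
  qed
  ultimately show ?thesis using that x by blast
qed

end

section \<open>The operator of a form with precompact domain\<close>

text \<open>
  The diagonal argument.
\<close>

lemma bounded_family_convergent_subsequence:
  fixes a :: "nat \<Rightarrow> nat \<Rightarrow> real"
  assumes bdd: "\<And>n. bounded (range (a n))"
  obtains r :: "nat \<Rightarrow> nat" where "strict_mono r" "\<And>n. convergent (\<lambda>k. a n (r k))"
proof -
  interpret subseqs "\<lambda>n r. convergent (\<lambda>k. a n (r k))"
  proof
    fix n and s :: "nat \<Rightarrow> nat"
    have "bounded (range (a n \<circ> s))" by (rule bounded_subset[OF bdd[of n]]) auto
    then obtain l r where "strict_mono r" "((a n \<circ> s) \<circ> r) \<longlonglongrightarrow> l"
      using bounded_imp_convergent_subsequence by blast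
    then show "\<exists>r'. strict_mono r' \<and> convergent (\<lambda>k. a n ((s \<circ> r') k))"
      by (auto simp: o_def convergent_def)
  qed
  have "convergent (\<lambda>k. a n (diagseq k))" for n
  proof -
    have "convergent (\<lambda>k. a n ((diagseq \<circ> (+) (Suc n)) k))"
    proof (rule diagseq_holds)
      fix r s :: "nat \<Rightarrow> nat" and n assume "strict_mono r" "convergent (\<lambda>k. a n (s k))"
      then show "convergent (\<lambda>k. a n ((s \<circ> r) k))"
        using convergent_subseq_convergent[of "\<lambda>k. a n (s k)" r] by (simp add: o_def)
    qed
    then have "convergent (\<lambda>k. a n (diagseq (k + Suc n)))" by (simp add: add.commute)
    then show ?thesis using convergent_ignore_initial_segment[of "\<lambda>k. a n (diagseq k)" "Suc n"] by simp
  qed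
  with subseq_diagseq that show ?thesis by blast
qed

lemma sum_list_small_of_Cauchy:
  fixes a :: "'w \<Rightarrow> nat \<Rightarrow> real"
  assumes "\<And>w. w \<in> set ws \<Longrightarrow> Cauchy (a w)" and "e > 0"
  shows "\<exists>N. \<forall>k\<ge>N. \<forall>l\<ge>N. (\<Sum>w\<leftarrow>ws. (a w k - a w l)\<^sup>2) < e"
  using assms
proof (induction ws arbitrary: e)
  case Nil
  then show ?case by auto
next
  case (Cons w ws)
  obtain N1 where N1: "\<And>k l. k \<ge> N1 \<Longrightarrow> l \<ge> N1 \<Longrightarrow> (\<Sum>w\<leftarrow>ws. (a w k - a w l)\<^sup>2) < e / 2"
    using Cons.IH[of "e / 2"] Cons.prems by auto
  have "Cauchy (a w)" using Cons.prems by auto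
  then obtain N2 where N2: "\<And>k l. k \<ge> N2 \<Longrightarrow> l \<ge> N2 \<Longrightarrow> norm (a w k - a w l) < sqrt (e / 2)"
    using CauchyD[of "a w" "sqrt (e / 2)"] Cons.prems(2) by auto
  have "(\<Sum>w\<leftarrow>w # ws. (a w k - a w l)\<^sup>2) < e" if "k \<ge> max N1 N2" "l \<ge> max N1 N2" for k l
  proof -
    have "\<bar>a w k - a w l\<bar>\<^sup>2 < (sqrt (e / 2))\<^sup>2"
      using N2[of k l] that by (intro power_strict_mono) auto
    then have "(a w k - a w l)\<^sup>2 < e / 2" using Cons.prems(2) by simp
    then show ?thesis using N1[of k l] that by simp
  qed
  then show ?case by blast
qed

text \<open>
  The Hilbert space is \<open>V\<close> with the form \<open>B\<close>, the energy \<open>D\<close> is given on the form core \<open>X\<close>.  The last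
  assumption says that sets of bounded energy and bounded norm are totally bounded in \<open>V\<close>: up to an
  error that is small compared with the energy, the norm is controlled by finitely many functionals.
  It replaces Rellich's compactness theorem.
\<close>

locale form_operator =
  semi_inner V B + energy: semi_inner X D
  for V :: "'v::real_vector set" and B and X :: "'v set" and D +
  assumes XV: "X \<subseteq> V"
    and complete: "(\<And>k::nat. x k \<in> V) \<Longrightarrow> cauchy x \<Longrightarrow> \<exists>u\<in>V. converges x u"
    and dense: "f \<in> V \<Longrightarrow> (\<And>\<psi>. \<psi> \<in> X \<Longrightarrow> B f \<psi> = 0) \<Longrightarrow> B f f = 0"
    and precompact: "e > 0 \<Longrightarrow>
      \<exists>ws. set ws \<subseteq> V \<and> (\<forall>\<phi>\<in>X. B \<phi> \<phi> \<le> e * D \<phi> \<phi> + (\<Sum>w\<leftarrow>ws. (B w \<phi>)\<^sup>2))"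
begin

definition approximates :: "(nat \<Rightarrow> 'v) \<Rightarrow> 'v \<Rightarrow> 'v \<Rightarrow> bool" where
  "approximates \<phi> u h \<longleftrightarrow> (\<forall>k. \<phi> k \<in> X) \<and> converges \<phi> u \<and> energy.cauchy \<phi> \<and>
     (\<forall>\<psi>\<in>X. (\<lambda>k. D (\<phi> k) \<psi>) \<longlonglongrightarrow> B h \<psi>)"

text \<open>
  The operator of the form, as a relation: \<open>u\<close> is a limit of elements of the core, the limit of their
  energy pairings with a test vector exists, and it is represented by \<open>h\<close>.  Both the element \<open>u\<close> and its
  energy are determined by the approximating sequence.
\<close>

definition graph :: "'v \<Rightarrow> 'v \<Rightarrow> bool" where
  "graph u h \<longleftrightarrow> u \<in> V \<and> h \<in> V \<and> (\<exists>\<phi>. approximates \<phi> u h)"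

lemma XV' [simp, intro]: "x \<in> X \<Longrightarrow> x \<in> V" using XV by auto

lemma graphD: "graph u h \<Longrightarrow> u \<in> V" "graph u h \<Longrightarrow> h \<in> V" by (auto simp: graph_def)

text \<open>
  Take the limit of \<open>D (\<phi> k) (\<phi>' l)\<close> first in \<open>k\<close>, which tests \<open>h\<close> against \<open>\<phi>' l\<close>, and then in \<open>l\<close>.
  The diagonal limit is the same because the convergence is joint.
\<close>

lemma energy_limit:
  assumes u: "u' \<in> V" "h \<in> V" and a: "approximates \<phi> u h" and X': "\<And>k. \<phi>' k \<in> X"
    and c: "converges \<phi>' u'" and ec: "energy.cauchy \<phi>'"
  shows "(\<lambda>k. D (\<phi> k) (\<phi>' k)) \<longlonglongrightarrow> B h u'"
proof -
  have X: "\<And>k. \<phi> k \<in> X" and ca: "energy.cauchy \<phi>"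
    and lim: "\<And>\<psi>. \<psi> \<in> X \<Longrightarrow> (\<lambda>k. D (\<phi> k) \<psi>) \<longlonglongrightarrow> B h \<psi>"
    using a by (auto simp: approximates_def)
  obtain L where L: "(\<lambda>k. D (\<phi> k) (\<phi>' k)) \<longlonglongrightarrow> L"
    and unif: "\<And>e. e > 0 \<Longrightarrow> \<exists>N. \<forall>k\<ge>N. \<forall>l\<ge>N. \<bar>D (\<phi> k) (\<phi>' l) - L\<bar> < e"
    using energy.cauchy_inner_uniform[OF X ca X' ec] by metis
  have "\<bar>B h u' - L\<bar> \<le> e" if e: "e > 0" for e
  proof -
    obtain N where N: "\<And>k l. k \<ge> N \<Longrightarrow> l \<ge> N \<Longrightarrow> \<bar>D (\<phi> k) (\<phi>' l) - L\<bar> < e"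
      using unif[OF e] by blast
    have 1: "\<bar>B h (\<phi>' l) - L\<bar> \<le> e" if "l \<ge> N" for l
    proof (rule LIMSEQ_le_const2)
      show "(\<lambda>k. \<bar>D (\<phi> k) (\<phi>' l) - L\<bar>) \<longlonglongrightarrow> \<bar>B h (\<phi>' l) - L\<bar>"
        by (intro tendsto_intros lim X')
    qed (use N that in \<open>auto intro!: exI[of _ N] less_imp_le\<close>)
    show ?thesis
    proof (rule LIMSEQ_le_const2)
      have "(\<lambda>l. B (\<phi>' l) h) \<longlonglongrightarrow> B u' h" using converges_inner[OF _ u c] X' by blast
      then have "(\<lambda>l. B h (\<phi>' l)) \<longlonglongrightarrow> B h u'" using sym u X' by simp
      then show "(\<lambda>l. \<bar>B h (\<phi>' l) - L\<bar>) \<longlonglongrightarrow> \<bar>B h u' - L\<bar>" by (intro tendsto_intros)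
    qed (use 1 in blast)
  qed
  then have "\<bar>B h u' - L\<bar> \<le> 0" by (metis add.left_neutral field_le_epsilon)
  then have "L = B h u'" by simp
  with L show ?thesis by simp
qed

lemma graph_symmetric:
  assumes "graph u h" "graph u' h'"
  shows "B h u' = B u h'"
proof -
  obtain \<phi> \<phi>' where a: "approximates \<phi> u h" "approximates \<phi>' u' h'"
    and V: "u \<in> V" "h \<in> V" "u' \<in> V" "h' \<in> V" using assms by (auto simp: graph_def)
  have X: "\<phi> k \<in> X" "\<phi>' k \<in> X" for k using a by (auto simp: approximates_def)
  have "(\<lambda>k. D (\<phi> k) (\<phi>' k)) \<longlonglongrightarrow> B h u'"
    using a V by (intro energy_limit) (auto simp: approximates_def)
  moreover have "(\<lambda>k. D (\<phi>' k) (\<phi> k)) \<longlonglongrightarrow> B h' u"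
    using a V by (intro energy_limit) (auto simp: approximates_def)
  ultimately show ?thesis using energy.sym[OF X] LIMSEQ_unique sym V by auto
qed

lemma graph_energy_limit:
  assumes "approximates \<phi> u h" "u \<in> V" "h \<in> V"
  shows "(\<lambda>k. D (\<phi> k) (\<phi> k)) \<longlonglongrightarrow> B h u"
  using assms by (intro energy_limit) (auto simp: approximates_def)

lemma graph_nonneg:
  assumes "graph u h"
  shows "B h u \<ge> 0"
proof -
  obtain \<phi> where "approximates \<phi> u h" using assms by (auto simp: graph_def)
  then show ?thesis using graph_energy_limit graphD[OF assms] energy.nonneg
    by (intro LIMSEQ_le_const[of "\<lambda>k. D (\<phi> k) (\<phi> k)"]) (auto simp: approximates_def)
qed

lemma graph_add:
  assumes "graph u h" "graph u' h'"
  shows "graph (u + u') (h + h')"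
proof -
  obtain \<phi> \<phi>' where a: "approximates \<phi> u h" "approximates \<phi>' u' h'"
    and V: "u \<in> V" "h \<in> V" "u' \<in> V" "h' \<in> V" using assms by (auto simp: graph_def)
  have X: "\<phi> k \<in> X" "\<phi>' k \<in> X" for k using a by (auto simp: approximates_def)
  have "approximates (\<lambda>k. \<phi> k + \<phi>' k) (u + u') (h + h')"
    unfolding approximates_def
  proof (intro conjI ballI allI)
    show "\<phi> k + \<phi>' k \<in> X" for k using X by simp
    have "(\<lambda>k. 2 * B (\<phi> k - u) (\<phi> k - u) + 2 * B (\<phi>' k - u') (\<phi>' k - u')) \<longlonglongrightarrow> 2 * 0 + 2 * 0"
      using a by (intro tendsto_intros) (auto simp: approximates_def converges_def)
    then have l: "(\<lambda>k. 2 * B (\<phi> k - u) (\<phi> k - u) + 2 * B (\<phi>' k - u') (\<phi>' k - u')) \<longlonglongrightarrow> 0"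
      by simp
    have "B (\<phi> k + \<phi>' k - (u + u')) (\<phi> k + \<phi>' k - (u + u')) \<le>
        2 * B (\<phi> k - u) (\<phi> k - u) + 2 * B (\<phi>' k - u') (\<phi>' k - u')" for k
      using quasi_triangle[of "\<phi> k - u" "\<phi>' k - u'"] X V by (simp add: algebra_simps)
    then show "converges (\<lambda>k. \<phi> k + \<phi>' k) (u + u')"
      unfolding converges_def using X V
      by (intro tendsto_sandwich[OF _ _ tendsto_const l]) (auto intro!: nonneg always_eventually)
    show "energy.cauchy (\<lambda>k. \<phi> k + \<phi>' k)"
      unfolding energy.cauchy_def
    proof (intro allI impI)
      fix e :: real assume e: "e > 0"
      obtain N1 where N1: "\<And>k l. k \<ge> N1 \<Longrightarrow> l \<ge> N1 \<Longrightarrow> D (\<phi> k - \<phi> l) (\<phi> k - \<phi> l) < e / 4"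
        using a(1) e unfolding approximates_def energy.cauchy_def
        by (meson divide_pos_pos zero_less_numeral)
      obtain N2 where N2: "\<And>k l. k \<ge> N2 \<Longrightarrow> l \<ge> N2 \<Longrightarrow> D (\<phi>' k - \<phi>' l) (\<phi>' k - \<phi>' l) < e / 4"
        using a(2) e unfolding approximates_def energy.cauchy_def
        by (meson divide_pos_pos zero_less_numeral)
      have "D (\<phi> k + \<phi>' k - (\<phi> l + \<phi>' l)) (\<phi> k + \<phi>' k - (\<phi> l + \<phi>' l)) < e"
        if "k \<ge> max N1 N2" "l \<ge> max N1 N2" for k l
      proof -
        have eq: "\<phi> k + \<phi>' k - (\<phi> l + \<phi>' l) = (\<phi> k - \<phi> l) + (\<phi>' k - \<phi>' l)" by simp
        have "D (\<phi> k - \<phi> l) (\<phi> k - \<phi> l) < e / 4" "D (\<phi>' k - \<phi>' l) (\<phi>' k - \<phi>' l) < e / 4"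
          using that N1[of k l] N2[of k l] by auto
        moreover have "D ((\<phi> k - \<phi> l) + (\<phi>' k - \<phi>' l)) ((\<phi> k - \<phi> l) + (\<phi>' k - \<phi>' l)) \<le>
            2 * D (\<phi> k - \<phi> l) (\<phi> k - \<phi> l) + 2 * D (\<phi>' k - \<phi>' l) (\<phi>' k - \<phi>' l)"
          using X by (intro energy.quasi_triangle) auto
        ultimately show ?thesis unfolding eq using e by linarith
      qed
      then show "\<exists>N. \<forall>k\<ge>N. \<forall>l\<ge>N.
        D (\<phi> k + \<phi>' k - (\<phi> l + \<phi>' l)) (\<phi> k + \<phi>' k - (\<phi> l + \<phi>' l)) < e" by blast
    qed
    fix \<psi> assume \<psi>: "\<psi> \<in> X"
    have "(\<lambda>k. D (\<phi> k) \<psi> + D (\<phi>' k) \<psi>) \<longlonglongrightarrow> B h \<psi> + B h' \<psi>"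
      using a \<psi> by (intro tendsto_intros) (auto simp: approximates_def)
    then show "(\<lambda>k. D (\<phi> k + \<phi>' k) \<psi>) \<longlonglongrightarrow> B (h + h') \<psi>"
      using X \<psi> V by (simp add: add_left energy.add_left)
  qed
  then show ?thesis using V by (auto simp: graph_def)
qed

lemma graph_scale:
  assumes "graph u h"
  shows "graph (c *\<^sub>R u) (c *\<^sub>R h)"
proof -
  obtain \<phi> where a: "approximates \<phi> u h" and V: "u \<in> V" "h \<in> V" using assms by (auto simp: graph_def)
  have X: "\<phi> k \<in> X" for k using a by (auto simp: approximates_def)
  have "approximates (\<lambda>k. c *\<^sub>R \<phi> k) (c *\<^sub>R u) (c *\<^sub>R h)"
    unfolding approximates_def
  proof (intro conjI ballI allI)
    show "c *\<^sub>R \<phi> k \<in> X" for k using X by simp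
    have "(\<lambda>k. c * (c * B (\<phi> k - u) (\<phi> k - u))) \<longlonglongrightarrow> c * (c * 0)"
      using a by (intro tendsto_intros) (auto simp: approximates_def converges_def)
    moreover have "B (c *\<^sub>R \<phi> k - c *\<^sub>R u) (c *\<^sub>R \<phi> k - c *\<^sub>R u) = c * (c * B (\<phi> k - u) (\<phi> k - u))" for k
      using X V unfolding scaleR_diff_right[symmetric] by (simp add: scale_left scale_right)
    ultimately show "converges (\<lambda>k. c *\<^sub>R \<phi> k) (c *\<^sub>R u)" by (simp add: converges_def)
    have D: "D (c *\<^sub>R \<phi> k - c *\<^sub>R \<phi> l) (c *\<^sub>R \<phi> k - c *\<^sub>R \<phi> l) = c\<^sup>2 * D (\<phi> k - \<phi> l) (\<phi> k - \<phi> l)" for k l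
      using X unfolding scaleR_diff_right[symmetric]
      by (simp add: energy.scale_left energy.scale_right power2_eq_square)
    show "energy.cauchy (\<lambda>k. c *\<^sub>R \<phi> k)"
      unfolding energy.cauchy_def D
    proof (intro allI impI)
      fix e :: real assume e: "e > 0"
      have "e / (c\<^sup>2 + 1) > 0" using e by (auto intro!: divide_pos_pos add_nonneg_pos)
      then obtain N where N: "\<And>k l. k \<ge> N \<Longrightarrow> l \<ge> N \<Longrightarrow> D (\<phi> k - \<phi> l) (\<phi> k - \<phi> l) < e / (c\<^sup>2 + 1)"
        using a unfolding approximates_def energy.cauchy_def by blast
      have "c\<^sup>2 * D (\<phi> k - \<phi> l) (\<phi> k - \<phi> l) < e" if "k \<ge> N" "l \<ge> N" for k l
      proof -
        have "c\<^sup>2 * D (\<phi> k - \<phi> l) (\<phi> k - \<phi> l) \<le> (c\<^sup>2 + 1) * D (\<phi> k - \<phi> l) (\<phi> k - \<phi> l)"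
          using energy.nonneg[of "\<phi> k - \<phi> l"] X by (intro mult_right_mono) auto
        also have "\<dots> < (c\<^sup>2 + 1) * (e / (c\<^sup>2 + 1))"
          using N[OF that] by (intro mult_strict_left_mono) (auto intro!: add_nonneg_pos)
        also have "\<dots> = e" using add_nonneg_pos[of "c\<^sup>2" 1] by simp
        finally show ?thesis .
      qed
      then show "\<exists>N. \<forall>k\<ge>N. \<forall>l\<ge>N. c\<^sup>2 * D (\<phi> k - \<phi> l) (\<phi> k - \<phi> l) < e" by blast
    qed
    fix \<psi> assume \<psi>: "\<psi> \<in> X"
    have "(\<lambda>k. c * D (\<phi> k) \<psi>) \<longlonglongrightarrow> c * B h \<psi>"
      using a \<psi> by (intro tendsto_intros) (auto simp: approximates_def)
    then show "(\<lambda>k. D (c *\<^sub>R \<phi> k) \<psi>) \<longlonglongrightarrow> B (c *\<^sub>R h) \<psi>"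
      using X \<psi> V by (simp add: scale_left energy.scale_left)
  qed
  then show ?thesis using V by (auto simp: graph_def)
qed

lemma graph_diff:
  assumes "graph u h" "graph u' h'"
  shows "graph (u - u') (h - h')"
  using graph_add[OF assms(1) graph_scale[OF assms(2), of "-1"]] by simp

lemma graph_null:
  assumes g: "graph u h" and V': "u' \<in> V" "h' \<in> V"
    and null': "B (u - u') (u - u') = 0" "B (h - h') (h - h') = 0"
  shows "graph u' h'"
proof -
  obtain \<phi> where a: "approximates \<phi> u h" and V: "u \<in> V" "h \<in> V" using g by (auto simp: graph_def)
  have X: "\<phi> k \<in> X" for k using a by (auto simp: approximates_def)
  have "B (\<phi> k - u') (\<phi> k - u') = B (\<phi> k - u) (\<phi> k - u)" for k
  proof -
    define a b where "a = \<phi> k - u" and "b = u - u'"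
    have ab: "a \<in> V" "b \<in> V" "B b b = 0" using V V' X null' by (auto simp: a_def b_def)
    have "\<phi> k - u' = a + b" by (simp add: a_def b_def)
    then show ?thesis using ab null[of b a] null_right[of a b] unfolding a_def[symmetric]
      by (simp add: add_left add_right)
  qed
  moreover have "B h' \<psi> = B h \<psi>" if "\<psi> \<in> X" for \<psi>
    using null[of "h - h'" \<psi>] null' V V' that by (simp add: diff_left)
  ultimately have "approximates \<phi> u' h'" using a by (simp add: approximates_def converges_def)
  then show ?thesis using V' by (auto simp: graph_def)
qed

text \<open>
  The vector \<open>u\<close> represents the functional \<open>B f\<close> with respect to the form \<open>B + D\<close>.
\<close>

lemma resolvent_exists:
  assumes f: "f \<in> V"
  shows "\<exists>u. graph u (f - u)"
proof -
  interpret E: semi_inner X "\<lambda>x y. B x y + D x y"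
  proof
    show "B x y + D x y = B y x + D y x" if "x \<in> X" "y \<in> X" for x y
      using that sym energy.sym by simp
  qed (auto simp: energy.V add_left energy.add_left scale_left energy.scale_left
         nonneg energy.nonneg distrib_left)
  have bound: "(B f x)\<^sup>2 \<le> B f f * (B x x + D x x)" if x: "x \<in> X" for x
  proof -
    have "(B f x)\<^sup>2 \<le> B f f * B x x" using Cauchy_Schwarz f x by auto
    also have "\<dots> \<le> B f f * (B x x + D x x)"
      using nonneg[OF f] energy.nonneg[OF x] by (intro mult_left_mono) auto
    finally show ?thesis .
  qed
  obtain \<phi> where X: "\<And>k. \<phi> k \<in> X" and c: "E.cauchy \<phi>"
    and lim: "\<And>\<psi>. \<psi> \<in> X \<Longrightarrow> (\<lambda>k. B (\<phi> k) \<psi> + D (\<phi> k) \<psi>) \<longlonglongrightarrow> B f \<psi>"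
    by (rule E.riesz_sequence[of "B f" "B f f"]) (use f bound in \<open>auto simp: bilin\<close>)
  have pos: "B (\<phi> k - \<phi> l) (\<phi> k - \<phi> l) \<ge> 0" "D (\<phi> k - \<phi> l) (\<phi> k - \<phi> l) \<ge> 0" for k l
    using X by (auto intro!: nonneg energy.nonneg)
  have cB: "cauchy \<phi>" unfolding cauchy_def
  proof (intro allI impI)
    fix e :: real assume "e > 0"
    then obtain N where "\<And>k l. k \<ge> N \<Longrightarrow> l \<ge> N \<Longrightarrow>
        B (\<phi> k - \<phi> l) (\<phi> k - \<phi> l) + D (\<phi> k - \<phi> l) (\<phi> k - \<phi> l) < e"
      using c unfolding E.cauchy_def by blast
    then show "\<exists>N. \<forall>k\<ge>N. \<forall>l\<ge>N. B (\<phi> k - \<phi> l) (\<phi> k - \<phi> l) < e"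
      using pos by (smt (verit))
  qed
  have cD: "energy.cauchy \<phi>" unfolding energy.cauchy_def
  proof (intro allI impI)
    fix e :: real assume "e > 0"
    then obtain N where "\<And>k l. k \<ge> N \<Longrightarrow> l \<ge> N \<Longrightarrow>
        B (\<phi> k - \<phi> l) (\<phi> k - \<phi> l) + D (\<phi> k - \<phi> l) (\<phi> k - \<phi> l) < e"
      using c unfolding E.cauchy_def by blast
    then show "\<exists>N. \<forall>k\<ge>N. \<forall>l\<ge>N. D (\<phi> k - \<phi> l) (\<phi> k - \<phi> l) < e"
      using pos by (smt (verit))
  qed
  obtain u where u: "u \<in> V" "converges \<phi> u" using complete[OF _ cB] X by auto
  have "(\<lambda>k. D (\<phi> k) \<psi>) \<longlonglongrightarrow> B (f - u) \<psi>" if \<psi>: "\<psi> \<in> X" for \<psi>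
  proof -
    have "(\<lambda>k. (B (\<phi> k) \<psi> + D (\<phi> k) \<psi>) - B (\<phi> k) \<psi>) \<longlonglongrightarrow> B f \<psi> - B u \<psi>"
      using X u \<psi> by (intro tendsto_diff lim converges_inner) auto
    then show ?thesis using f u \<psi> by (simp add: diff_left)
  qed
  then have "approximates \<phi> u (f - u)" using X u cD by (auto simp: approximates_def)
  then show ?thesis using u f by (auto simp: graph_def)
qed

text \<open>
  The resolvent of the operator at \<open>-1\<close>.  It is determined up to vectors of norm zero, so its linearity
  only holds after pairing with a vector; \<open>Q\<close> below is the resulting bilinear form.
\<close>

definition T :: "'v \<Rightarrow> 'v" where "T f = (SOME u. graph u (f - u))"

lemma graph_T: "f \<in> V \<Longrightarrow> graph (T f) (f - T f)"
  unfolding T_def by (rule someI_ex) (rule resolvent_exists)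

lemma T_mem [simp, intro]: "f \<in> V \<Longrightarrow> T f \<in> V"
  using graph_T graphD by blast

lemma T_symmetric: "f \<in> V \<Longrightarrow> h \<in> V \<Longrightarrow> B (T f) h = B f (T h)"
  using graph_symmetric[OF graph_T[of f] graph_T[of h]] by (simp add: bilin)

lemma T_nonneg: "f \<in> V \<Longrightarrow> B (T f) (T f) \<le> B (T f) f"
  using graph_nonneg[OF graph_T[of f]] sym[of f "T f"] by (simp add: bilin)

sublocale Q: semi_inner V "\<lambda>f h. B (T f) h"
proof
  show "subspace V" by (rule V)
  show "B (T x) y = B (T y) x" if "x \<in> V" "y \<in> V" for x y
    using that T_symmetric sym by simp
  show "B (T (x + y)) z = B (T x) z + B (T y) z" if "x \<in> V" "y \<in> V" "z \<in> V" for x y z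
    using that by (simp add: T_symmetric add_left)
  show "B (T (c *\<^sub>R x)) y = c * B (T x) y" if "x \<in> V" "y \<in> V" for x y c
    using that by (simp add: T_symmetric scale_left)
  show "B (T x) x \<ge> 0" if "x \<in> V" for x
    using that T_nonneg[OF that] nonneg[OF T_mem[OF that]] by linarith
qed

lemma T_le: 
  assumes f: "f \<in> V"
  shows "B (T f) f \<le> B f f"
proof -
  have "0 \<le> B (f - T f) (f - T f)" using f by (intro nonneg) auto
  then show ?thesis using T_nonneg[OF f] f sym[of f "T f"] by (simp add: bilin)
qed

text \<open>
  The compactness inequality passes to the limit, where the energy of \<open>u\<close> becomes \<open>B h u\<close>.
\<close>

lemma graph_precompact:
  assumes g: "graph u h" and ws: "set ws \<subseteq> V"
    and le: "\<And>\<phi>. \<phi> \<in> X \<Longrightarrow> B \<phi> \<phi> \<le> e * D \<phi> \<phi> + (\<Sum>w\<leftarrow>ws. (B w \<phi>)\<^sup>2)"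
  shows "B u u \<le> e * B h u + (\<Sum>w\<leftarrow>ws. (B w u)\<^sup>2)"
proof -
  obtain \<phi> where a: "approximates \<phi> u h" and V: "u \<in> V" "h \<in> V" using g by (auto simp: graph_def)
  have X: "\<phi> k \<in> X" for k using a by (auto simp: approximates_def)
  have c: "converges \<phi> u" using a by (auto simp: approximates_def)
  have s: "(\<lambda>k. \<Sum>w\<leftarrow>ws. (B w (\<phi> k))\<^sup>2) \<longlonglongrightarrow> (\<Sum>w\<leftarrow>ws. (B w u)\<^sup>2)"
    using ws
  proof (induction ws)
    case (Cons w ws)
    have "(\<lambda>k. B (\<phi> k) w) \<longlonglongrightarrow> B u w" using Cons.prems X V c by (intro converges_inner) auto
    then have "(\<lambda>k. B w (\<phi> k)) \<longlonglongrightarrow> B w u" using sym X V Cons.prems by simp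
    then show ?case using Cons by (auto intro!: tendsto_intros)
  qed auto
  show ?thesis
  proof (rule LIMSEQ_le)
    show "(\<lambda>k. B (\<phi> k) (\<phi> k)) \<longlonglongrightarrow> B u u" using X V c by (intro converges_norm) auto
    show "(\<lambda>k. e * D (\<phi> k) (\<phi> k) + (\<Sum>w\<leftarrow>ws. (B w (\<phi> k))\<^sup>2)) \<longlonglongrightarrow> e * B h u + (\<Sum>w\<leftarrow>ws. (B w u)\<^sup>2)"
      by (intro tendsto_intros s graph_energy_limit a V)
  qed (use le X in auto)
qed

text \<open>
  Countably many functionals control all the inequalities for \<open>e = 1 / (m + 1)\<close>.  Along a diagonal
  subsequence they all converge, and then the inequality for the difference of two terms shows that the
  subsequence is a Cauchy sequence.
\<close>

lemma T_compact:
  assumes f: "\<And>k. f k \<in> V" and bd: "\<And>k. B (f k) (f k) \<le> 1"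
  obtains r :: "nat \<Rightarrow> nat" where "strict_mono r" "cauchy (\<lambda>k. T (f (r k)))"
proof -
  obtain W where W: "\<And>e. e > 0 \<Longrightarrow> set (W e) \<subseteq> V \<and>
      (\<forall>\<phi>\<in>X. B \<phi> \<phi> \<le> e * D \<phi> \<phi> + (\<Sum>w\<leftarrow>W e. (B w \<phi>)\<^sup>2))"
    using precompact by metis
  define S where "S = insert 0 (\<Union>m::nat. set (W (inverse (real (Suc m)))))"
  have Wi: "set (W (inverse (real (Suc m)))) \<subseteq> V" for m using W[of "inverse (real (Suc m))"] by simp
  have S1: "countable S" unfolding S_def by (rule countable_insert, rule countable_UN) (simp_all add: countable_finite)
  have S2: "S \<noteq> {}" by (simp add: S_def)
  have S3: "S \<subseteq> V" unfolding S_def using Wi by blast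
  note S = S1 S2 S3
  define w where "w = from_nat_into S"
  have wS: "w n \<in> S" for n using S by (simp add: w_def from_nat_into)
  have wV: "w n \<in> V" for n using wS S by blast
  have T1: "B (T (f k)) (T (f k)) \<le> 1" for k
    using T_nonneg[OF f, of k] T_le[OF f, of k] bd[of k] by linarith
  have "bounded (range (\<lambda>k. B (w n) (T (f k))))" for n
  proof -
    have "\<bar>B (w n) (T (f k))\<bar> \<le> sqrt (B (w n) (w n))" for k
    proof (rule real_le_rsqrt)
      have "(B (w n) (T (f k)))\<^sup>2 \<le> B (w n) (w n) * B (T (f k)) (T (f k))"
        using wV f by (intro Cauchy_Schwarz) auto
      also have "\<dots> \<le> B (w n) (w n) * 1" using T1 nonneg[OF wV] by (intro mult_left_mono) auto
      finally show "\<bar>B (w n) (T (f k))\<bar>\<^sup>2 \<le> B (w n) (w n)" by simp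
    qed
    then show ?thesis by (auto simp: bounded_iff)
  qed
  then obtain r :: "nat \<Rightarrow> nat" where r: "strict_mono r"
    and conv: "\<And>n. convergent (\<lambda>k. B (w n) (T (f (r k))))"
    using bounded_family_convergent_subsequence[of "\<lambda>n k. B (w n) (T (f k))"] by metis
  have "cauchy (\<lambda>k. T (f (r k)))" unfolding cauchy_def
  proof (intro allI impI)
    fix e :: real assume e: "e > 0"
    \<comment> \<open>\<open>B h d \<le> 4\<close> below, so the energy term contributes less than \<open>e / 4\<close>\<close>
    obtain m where m: "inverse (real (Suc m)) < e / 16" using reals_Archimedean[of "e / 16"] e by auto
    define \<epsilon> where "\<epsilon> = inverse (real (Suc m))"
    have \<epsilon>: "\<epsilon> > 0" "\<epsilon> < e / 16" using m by (auto simp: \<epsilon>_def)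
    let ?W = "W (\<epsilon>)"
    have WV: "set ?W \<subseteq> V" using W[OF \<epsilon>(1)] by simp
    have "Cauchy (\<lambda>k. B v (T (f (r k))))" if "v \<in> set ?W" for v
    proof -
      have "v \<in> S" using that by (auto simp: S_def \<epsilon>_def)
      then obtain n where "v = w n" using S from_nat_into_surj[OF S(1)] by (metis w_def)
      then show ?thesis using conv by (simp add: Cauchy_convergent_iff)
    qed
    then obtain N where N: "\<And>k l. k \<ge> N \<Longrightarrow> l \<ge> N \<Longrightarrow>
        (\<Sum>v\<leftarrow>?W. (B v (T (f (r k))) - B v (T (f (r l))))\<^sup>2) < e / 2"
      using sum_list_small_of_Cauchy[of ?W "\<lambda>v k. B v (T (f (r k)))" "e / 2"] e by auto
    have "B (T (f (r k)) - T (f (r l))) (T (f (r k)) - T (f (r l))) < e" if kl: "k \<ge> N" "l \<ge> N" for k l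
    proof -
      define d h where "d = T (f (r k)) - T (f (r l))"
        and "h = (f (r k) - T (f (r k))) - (f (r l) - T (f (r l)))"
      have V: "d \<in> V" "h \<in> V" using f by (auto simp: d_def h_def)
      have g: "graph d h" unfolding d_def h_def by (intro graph_diff graph_T f)
      have "B d d \<le> \<epsilon> * B h d + (\<Sum>v\<leftarrow>?W. (B v d)\<^sup>2)"
        using W[OF \<epsilon>(1)] by (intro graph_precompact[OF g]) auto
      moreover have "(\<Sum>v\<leftarrow>?W. (B v d)\<^sup>2) = (\<Sum>v\<leftarrow>?W. (B v (T (f (r k))) - B v (T (f (r l))))\<^sup>2)"
        using WV f unfolding d_def by (intro arg_cong[where f = sum_list] map_cong) (auto simp: diff_right)
      moreover have "\<epsilon> * B h d \<le> e / 2"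
      proof -
        have eq: "h = (f (r k) - f (r l)) - d" by (simp add: d_def h_def)
        have "0 \<le> B d d" using V by (intro nonneg)
        then have "B h d \<le> B (f (r k) - f (r l)) d" using V f unfolding eq by (simp add: diff_left)
        also have "\<dots> \<le> 4"
        proof -
          have "(B (f (r k) - f (r l)) d)\<^sup>2 \<le> B (f (r k) - f (r l)) (f (r k) - f (r l)) * B d d"
            using V f by (intro Cauchy_Schwarz) auto
          also have "\<dots> \<le> 4 * 4"
          proof (intro mult_mono)
            show "B (f (r k) - f (r l)) (f (r k) - f (r l)) \<le> 4"
              using quasi_triangle_diff[of "f (r k)" "f (r l)"] f bd[of "r k"] bd[of "r l"] by simp
            show "B d d \<le> 4"
              using quasi_triangle_diff[of "T (f (r k))" "T (f (r l))"] f T1[of "r k"] T1[of "r l"]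
              by (simp add: d_def)
          qed (use \<open>0 \<le> B d d\<close> in auto)
          finally have "(B (f (r k) - f (r l)) d)\<^sup>2 \<le> 4\<^sup>2" by simp
          then show ?thesis by (rule power2_le_imp_le) simp
        qed
        finally have "B h d \<le> 4" .
        then have "\<epsilon> * B h d \<le> \<epsilon> * 4"
          using \<epsilon> by (intro mult_left_mono) auto
        then show ?thesis using \<epsilon> by linarith
      qed
      ultimately show ?thesis using N[OF kl] unfolding d_def by linarith
    qed
    then show "\<exists>N. \<forall>k\<ge>N. \<forall>l\<ge>N. B (T (f (r k)) - T (f (r l))) (T (f (r k)) - T (f (r l))) < e" by blast
  qed
  with r that show ?thesis by blast
qed

definition eigen :: "real \<Rightarrow> 'v set" where "eigen \<kappa> = {u. graph u (\<kappa> *\<^sub>R u)}"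

lemma eigen_mem: "u \<in> eigen \<kappa> \<Longrightarrow> u \<in> V" by (auto simp: eigen_def graphD)

lemma eigen_orthogonal:
  assumes "u \<in> eigen \<kappa>" "v \<in> eigen \<rho>" "\<kappa> \<noteq> \<rho>"
  shows "B u v = 0"
proof -
  have "B (\<kappa> *\<^sub>R u) v = B u (\<rho> *\<^sub>R v)" using assms by (intro graph_symmetric) (auto simp: eigen_def)
  then show ?thesis using assms eigen_mem[of u] eigen_mem[of v] by (simp add: bilin)
qed

lemma eigen_subspace: "subspace (eigen \<kappa>)"
proof -
  have "graph 0 0" using graph_diff[OF graph_T[OF mem(1)] graph_T[OF mem(1)]] by simp
  moreover have "graph (x + y) (\<kappa> *\<^sub>R (x + y))" if "graph x (\<kappa> *\<^sub>R x)" "graph y (\<kappa> *\<^sub>R y)" for x y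
    using graph_add[OF that] by (simp add: scaleR_add_right)
  moreover have "graph (c *\<^sub>R x) (\<kappa> *\<^sub>R (c *\<^sub>R x))" if "graph x (\<kappa> *\<^sub>R x)" for c x
    using graph_scale[OF that, of c] by (simp add: mult.commute)
  ultimately show ?thesis by (simp add: subspace_def eigen_def)
qed

lemma eigenvalue_nonneg:
  assumes "u \<in> eigen \<kappa>" "B u u \<noteq> 0"
  shows "\<kappa> \<ge> 0"
proof -
  have "u \<in> V" using assms eigen_mem by auto
  have "B (\<kappa> *\<^sub>R u) u \<ge> 0" using assms by (intro graph_nonneg) (auto simp: eigen_def)
  then show ?thesis using assms(2) nonneg[OF \<open>u \<in> V\<close>] \<open>u \<in> V\<close>
    by (simp add: bilin zero_le_mult_iff)
qed

text \<open>
  In this form the eigenvalue equation does not mention approximating sequences and is continuous in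
  \<open>u\<close>; this is why eigenspaces are closed.
\<close>

lemma eigen_iff_T:
  assumes k: "\<kappa> > -1" and u: "u \<in> V"
  shows "u \<in> eigen \<kappa> \<longleftrightarrow> (\<forall>v\<in>V. (1 + \<kappa>) * B u (T v) = B u v)"
proof
  assume e: "u \<in> eigen \<kappa>"
  show "\<forall>v\<in>V. (1 + \<kappa>) * B u (T v) = B u v"
  proof
    fix v assume v: "v \<in> V"
    have "B (\<kappa> *\<^sub>R u) (T v) = B u (v - T v)"
      using e v by (intro graph_symmetric graph_T) (auto simp: eigen_def)
    then show "(1 + \<kappa>) * B u (T v) = B u v" using u v by (simp add: bilin algebra_simps)
  qed
next
  assume weak: "\<forall>v\<in>V. (1 + \<kappa>) * B u (T v) = B u v"
  define f where "f = (1 + \<kappa>) *\<^sub>R u"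
  have f: "f \<in> V" using u by (simp add: f_def)
  have "B (T f - u) v = 0" if v: "v \<in> V" for v
    using weak v u f by (simp add: bilin T_symmetric) (simp add: f_def bilin u v)
  then have n: "B (T f - u) (T f - u) = 0" using f u by auto
  have "(f - T f) - \<kappa> *\<^sub>R u = (-1) *\<^sub>R (T f - u)" by (simp add: f_def algebra_simps)
  then have "B ((f - T f) - \<kappa> *\<^sub>R u) ((f - T f) - \<kappa> *\<^sub>R u) = 0"
    using n f u by (simp only: scale_left scale_right mem T_mem)
  then have "graph u (\<kappa> *\<^sub>R u)" using n f u by (intro graph_null[OF graph_T[OF f]]) auto
  then show "u \<in> eigen \<kappa>" by (simp add: eigen_def)
qed

lemma eigen_closed:
  assumes k: "\<kappa> > -1" and x: "\<And>k. x k \<in> eigen \<kappa>" and u: "u \<in> V" and c: "converges x u"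
  shows "u \<in> eigen \<kappa>"
  unfolding eigen_iff_T[OF k u]
proof
  fix v assume v: "v \<in> V"
  have xV: "x k \<in> V" for k using x eigen_mem by blast
  have "(\<lambda>k. (1 + \<kappa>) * B (x k) (T v)) \<longlonglongrightarrow> (1 + \<kappa>) * B u (T v)"
    using v u xV c by (intro tendsto_intros converges_inner) auto
  moreover have "(\<lambda>k. B (x k) v) \<longlonglongrightarrow> B u v" using v u xV c by (intro converges_inner) auto
  moreover have "(1 + \<kappa>) * B (x k) (T v) = B (x k) v" for k
    using eigen_iff_T[OF k xV] x v by blast
  ultimately show "(1 + \<kappa>) * B u (T v) = B u v" using LIMSEQ_unique by simp
qed

lemma eigen_projection:
  assumes k: "\<kappa> > -1" and f: "f \<in> V"
  shows "\<exists>u\<in>eigen \<kappa>. \<forall>h\<in>eigen \<kappa>. B (f - u) h = 0"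
proof -
  interpret E: semi_inner "eigen \<kappa>" B
  proof
    show "B x y = B y x" if "x \<in> eigen \<kappa>" "y \<in> eigen \<kappa>" for x y
      using that sym eigen_mem by blast
  qed (auto simp: eigen_subspace add_left scale_left nonneg eigen_mem)
  obtain x where x: "\<And>k. x k \<in> eigen \<kappa>" and c: "E.cauchy x"
    and lim: "\<And>y. y \<in> eigen \<kappa> \<Longrightarrow> (\<lambda>k. B (x k) y) \<longlonglongrightarrow> B f y"
    by (rule E.riesz_sequence[of "B f" "B f f"]) (use f Cauchy_Schwarz eigen_mem in \<open>auto simp: bilin\<close>)
  have "cauchy x" using c by (simp add: cauchy_def E.cauchy_def)
  then obtain u where u: "u \<in> V" "converges x u" using complete x eigen_mem by metis
  have "B (f - u) h = 0" if h: "h \<in> eigen \<kappa>" for h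
  proof -
    have "(\<lambda>k. B (x k) h) \<longlonglongrightarrow> B u h" using x u h eigen_mem by (intro converges_inner) auto
    then have "B u h = B f h" using lim[OF h] LIMSEQ_unique by blast
    then show ?thesis using f u h eigen_mem by (simp add: diff_left)
  qed
  then show ?thesis using eigen_closed[OF k x u] by blast
qed

text \<open>
  Let \<open>\<rho>\<close> be the supremum of \<open>B (T f) f\<close> over the unit ball of the complement \<open>F\<close> of the eigenvectors,
  which \<open>T\<close> maps to itself.  If \<open>f k\<close> is a maximising sequence, then \<open>T (f k) - \<rho> f k\<close> tends to zero,
  because \<open>B (T f) (T f) \<le> \<rho> * B (T f) f\<close> on \<open>F\<close>.  If \<open>\<rho> > 0\<close>, compactness of \<open>T\<close> yields a limit of a
  subsequence of \<open>f k\<close>; it is an eigenvector in \<open>F\<close>, hence zero, although its norm is at least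
  \<open>sqrt \<rho>\<close>.  So \<open>\<rho> = 0\<close>, the energy of \<open>T f0\<close> vanishes, and \<open>f0\<close> is orthogonal to the dense core.
\<close>

theorem eigenvectors_complete:
  assumes f0: "f0 \<in> V" and perp: "\<And>\<kappa> u. u \<in> eigen \<kappa> \<Longrightarrow> B f0 u = 0"
  shows "B f0 f0 = 0"
proof -
  define F where "F = {f\<in>V. \<forall>\<kappa>. \<forall>u\<in>eigen \<kappa>. B f u = 0}"
  have FV: "f \<in> F \<Longrightarrow> f \<in> V" for f by (simp add: F_def)
  have F_scale: "f \<in> F \<Longrightarrow> c *\<^sub>R f \<in> F" for f c by (auto simp: F_def scale_left eigen_mem)
  have F_T: "T f \<in> F" if f: "f \<in> F" for f
  proof -
    have "B (T f) u = 0" if u: "u \<in> eigen \<kappa>" for u \<kappa>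
    proof (cases "B u u = 0")
      case True
      then show ?thesis using u f FV eigen_mem by (intro null_right[OF _ _ True]) auto
    next
      case False
      then have k: "\<kappa> \<ge> 0" using eigenvalue_nonneg u by blast
      have "B (f - T f) u = B (T f) (\<kappa> *\<^sub>R u)"
        using f u FV by (intro graph_symmetric graph_T) (auto simp: eigen_def)
      moreover have "B f u = 0" using f u by (auto simp: F_def)
      ultimately have "(1 + \<kappa>) * B (T f) u = 0" using f u FV eigen_mem by (simp add: bilin algebra_simps)
      then show ?thesis using k by simp
    qed
    then show ?thesis using T_mem[OF FV[OF f]] unfolding F_def by blast
  qed
  define A where "A = (\<lambda>f. B (T f) f) ` {f\<in>F. B f f \<le> 1}"
  define \<rho> where "\<rho> = Sup A"
  have zF: "0 \<in> F" using eigen_mem by (auto simp: F_def)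
  then have A_ne: "A \<noteq> {}" by (auto simp: A_def intro!: exI[of _ 0])
  have A_bdd: "bdd_above A"
    using T_le FV by (auto simp: A_def intro!: bdd_aboveI[of _ 1]) (meson order_trans)
  have le1: "B (T f) f \<le> \<rho>" if "f \<in> F" "B f f \<le> 1" for f
    unfolding \<rho>_def using that by (intro cSup_upper A_bdd) (auto simp: A_def)
  have le: "B (T f) f \<le> \<rho> * B f f" if f: "f \<in> F" for f
  proof (cases "B f f = 0")
    case True
    then have "B (T f) f = 0" using f FV by (intro null_right[OF _ _ True]) auto
    then show ?thesis using True by simp
  next
    case False
    then have p: "B f f > 0" using nonneg[OF FV[OF f]] by simp
    define c where "c = 1 / sqrt (B f f)"
    have c2: "c * c = 1 / B f f" using p by (simp add: c_def real_sqrt_mult_self)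
    have "B (T (c *\<^sub>R f)) (c *\<^sub>R f) \<le> \<rho>"
      using f FV p c2 by (intro le1 F_scale) (auto simp: bilin mult.assoc[symmetric])
    moreover have "B (T (c *\<^sub>R f)) (c *\<^sub>R f) = (c * c) * B (T f) f"
      using f FV by (simp add: Q.scale_left scale_right)
    ultimately show ?thesis using p c2 by (simp add: field_simps)
  qed
  have lam0: "\<rho> \<ge> 0" using le1[OF zF] by simp
  have Tsq: "B (T f) (T f) \<le> \<rho> * B (T f) f" if f: "f \<in> F" for f
  proof (cases "B (T f) (T f) = 0")
    case True
    then show ?thesis using Q.nonneg[OF FV[OF f]] lam0 by simp
  next
    case False
    have V: "f \<in> V" "T f \<in> V" using f FV by auto
    have p: "B (T f) (T f) > 0" using False nonneg[OF V(2)] by simp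
    have "(B (T f) (T f))\<^sup>2 \<le> B (T f) f * B (T (T f)) (T f)"
      using Q.Cauchy_Schwarz[of f "T f"] V by simp
    also have "\<dots> \<le> B (T f) f * (\<rho> * B (T f) (T f))"
      using le[OF F_T[OF f]] Q.nonneg[OF V(1)] by (intro mult_left_mono) auto
    finally have "B (T f) (T f) * B (T f) (T f) \<le> (\<rho> * B (T f) f) * B (T f) (T f)"
      by (simp add: power2_eq_square mult_ac)
    then show ?thesis using p by simp
  qed
  have "\<rho> = 0"
  proof (rule ccontr)
    assume "\<rho> \<noteq> 0"
    then have lam: "\<rho> > 0" using lam0 by simp
    have "\<exists>f\<in>F. B f f \<le> 1 \<and> \<rho> - inverse (real (Suc k)) < B (T f) f" for k
    proof -
      have "\<rho> - inverse (real (Suc k)) < Sup A" by (simp add: \<rho>_def[symmetric])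
      then obtain y where "y \<in> A" "\<rho> - inverse (real (Suc k)) < y"
        using less_cSup_iff[OF A_ne A_bdd] by blast
      then show ?thesis by (auto simp: A_def)
    qed
    then obtain f where fF: "\<And>k. f k \<in> F" and f1: "\<And>k. B (f k) (f k) \<le> 1"
      and f2: "\<And>k. \<rho> - inverse (real (Suc k)) < B (T (f k)) (f k)" by metis
    have fV: "f k \<in> V" for k using fF FV by blast
    obtain r :: "nat \<Rightarrow> nat" where r: "strict_mono r" and c: "cauchy (\<lambda>k. T (f (r k)))"
      by (rule T_compact[of f]) (use fV f1 in blast)+
    obtain w where w: "w \<in> V" and cw: "converges (\<lambda>k. T (f (r k))) w" using complete[of "\<lambda>k. T (f (r k))"] c T_mem[OF fV] by blast
    define g where "g = (1 / \<rho>) *\<^sub>R w"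
    have g: "g \<in> V" using w by (simp add: g_def)
    have wg: "w = \<rho> *\<^sub>R g" using lam by (simp add: g_def)
    have d: "B (T (f k) - \<rho> *\<^sub>R f k) (T (f k) - \<rho> *\<^sub>R f k) \<le> \<rho> * inverse (real (Suc k))" for k
    proof -
      have "B (T (f k) - \<rho> *\<^sub>R f k) (T (f k) - \<rho> *\<^sub>R f k)
          = B (T (f k)) (T (f k)) - 2 * (\<rho> * B (T (f k)) (f k)) + \<rho> * \<rho> * B (f k) (f k)"
        using fV[of k] sym[of "f k" "T (f k)"] by (simp add: bilin algebra_simps)
      also have "\<dots> \<le> \<rho> * B (T (f k)) (f k) - 2 * (\<rho> * B (T (f k)) (f k)) + \<rho> * \<rho> * 1"
        using Tsq[OF fF[of k]] f1[of k] lam by (intro add_mono diff_mono mult_left_mono) auto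
      also have "\<dots> = \<rho> * (\<rho> - B (T (f k)) (f k))" by (simp add: algebra_simps)
      also have "\<dots> \<le> \<rho> * inverse (real (Suc k))" using f2[of k] lam by (intro mult_left_mono) auto
      finally show ?thesis .
    qed
    have cf: "converges (\<lambda>k. f (r k)) g"
    proof -
      have bnd: "B (f (r k) - g) (f (r k) - g) \<le>
          (2 * B (T (f (r k)) - w) (T (f (r k)) - w) + 2 * (\<rho> * inverse (real (Suc (r k))))) / \<rho>\<^sup>2" for k
      proof -
        have "\<rho> *\<^sub>R (f (r k) - g) = (T (f (r k)) - w) - (T (f (r k)) - \<rho> *\<^sub>R f (r k))"
          by (simp add: wg algebra_simps)
        then have "B (\<rho> *\<^sub>R (f (r k) - g)) (\<rho> *\<^sub>R (f (r k) - g)) \<le>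
            2 * B (T (f (r k)) - w) (T (f (r k)) - w) + 2 * (\<rho> * inverse (real (Suc (r k))))"
          using quasi_triangle_diff[of "T (f (r k)) - w" "T (f (r k)) - \<rho> *\<^sub>R f (r k)"] d[of "r k"] fV w
          by simp
        moreover have "B (\<rho> *\<^sub>R (f (r k) - g)) (\<rho> *\<^sub>R (f (r k) - g)) = B (f (r k) - g) (f (r k) - g) * \<rho>\<^sup>2"
          using fV g by (simp add: scale_left scale_right power2_eq_square mem(3))
        ultimately show ?thesis using lam by (simp add: pos_le_divide_eq)
      qed
      have inv: "(\<lambda>k. inverse (real (Suc (r k)))) \<longlonglongrightarrow> 0"
        using LIMSEQ_subseq_LIMSEQ[OF LIMSEQ_inverse_real_of_nat r] by (simp add: o_def)
      have "(\<lambda>k. (2 * B (T (f (r k)) - w) (T (f (r k)) - w) + 2 * (\<rho> * inverse (real (Suc (r k))))) / \<rho>\<^sup>2)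
          \<longlonglongrightarrow> (2 * 0 + 2 * (\<rho> * 0)) / \<rho>\<^sup>2"
        using cw lam unfolding converges_def by (intro tendsto_intros inv) auto
      then have l: "(\<lambda>k. (2 * B (T (f (r k)) - w) (T (f (r k)) - w) + 2 * (\<rho> * inverse (real (Suc (r k))))) / \<rho>\<^sup>2)
          \<longlonglongrightarrow> 0" by simp
      show ?thesis unfolding converges_def
        using bnd fV g by (intro tendsto_sandwich[OF _ _ tendsto_const l]) (auto intro!: nonneg always_eventually)
    qed
    have "(1 + (1 / \<rho> - 1)) * B g (T v) = B g v" if v: "v \<in> V" for v
    proof -
      have "(\<lambda>k. B (f (r k)) (T v)) \<longlonglongrightarrow> B g (T v)" using fV g v cf by (intro converges_inner) auto
      moreover have "(\<lambda>k. B (T (f (r k))) v) \<longlonglongrightarrow> B w v" using fV w v cw by (intro converges_inner) auto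
      ultimately have "B g (T v) = B w v"
        using T_symmetric[OF fV v] LIMSEQ_unique by simp
      then show ?thesis using lam g v by (simp add: wg scale_left)
    qed
    then have ge: "g \<in> eigen (1 / \<rho> - 1)" using lam g by (subst eigen_iff_T) auto
    have "B (f (r k)) g = 0" for k using fF[of "r k"] ge by (auto simp: F_def)
    moreover have "(\<lambda>k. B (f (r k)) g) \<longlonglongrightarrow> B g g" using fV g cf by (intro converges_inner) auto
    ultimately have "B g g = 0" by (simp add: LIMSEQ_const_iff)
    have "(\<lambda>k. B (f (r k)) (f (r k))) \<longlonglongrightarrow> B g g" using fV g cf by (intro converges_norm) auto
    moreover have "(\<lambda>k. \<rho> - inverse (real (Suc (r k)))) \<longlonglongrightarrow> \<rho> - 0"
      using LIMSEQ_subseq_LIMSEQ[OF LIMSEQ_inverse_real_of_nat r] by (intro tendsto_intros) (simp add: o_def)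
    moreover have "\<rho> - inverse (real (Suc (r k))) \<le> B (f (r k)) (f (r k))" for k
      using f2[of "r k"] T_le[OF fV[of "r k"]] by linarith
    ultimately have "\<rho> - 0 \<le> B g g" by (intro LIMSEQ_le[of "\<lambda>k. \<rho> - inverse (real (Suc (r k)))"]) auto
    then show False using lam \<open>B g g = 0\<close> by simp
  qed
  moreover have f0F: "f0 \<in> F" using f0 perp by (auto simp: F_def)
  ultimately have Q0: "B (T f0) f0 = 0" using le[OF f0F] Q.nonneg[OF f0] by simp
  have T0: "B (T f0) (T f0) = 0" using Q0 T_nonneg[OF f0] nonneg[OF T_mem[OF f0]] by simp
  show ?thesis
  proof (rule dense[OF f0])
    fix \<psi> assume \<psi>: "\<psi> \<in> X"
    obtain \<phi> where a: "approximates \<phi> (T f0) (f0 - T f0)" using graph_T[OF f0] by (auto simp: graph_def)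
    have X: "\<phi> k \<in> X" for k using a by (auto simp: approximates_def)
    have "(\<lambda>k. D (\<phi> k) (\<phi> k)) \<longlonglongrightarrow> B (f0 - T f0) (T f0)" using f0 by (intro graph_energy_limit a) auto
    moreover have "B (f0 - T f0) (T f0) = 0" using f0 Q0 T0 sym[of f0 "T f0"] by (simp add: bilin)
    ultimately have "(\<lambda>k. sqrt (D (\<phi> k) (\<phi> k) * D \<psi> \<psi>)) \<longlonglongrightarrow> sqrt (0 * D \<psi> \<psi>)"
      by (intro tendsto_intros) simp
    then have l: "(\<lambda>k. sqrt (D (\<phi> k) (\<phi> k) * D \<psi> \<psi>)) \<longlonglongrightarrow> 0" by simp
    have "\<bar>D (\<phi> k) \<psi>\<bar> \<le> sqrt (D (\<phi> k) (\<phi> k) * D \<psi> \<psi>)" for k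
      using energy.Cauchy_Schwarz[OF X \<psi>] by (intro real_le_rsqrt) simp
    then have "(\<lambda>k. D (\<phi> k) \<psi>) \<longlonglongrightarrow> 0" by (intro Lim_null_comparison[OF _ l]) auto
    moreover have "(\<lambda>k. D (\<phi> k) \<psi>) \<longlonglongrightarrow> B (f0 - T f0) \<psi>" using a \<psi> by (auto simp: approximates_def)
    ultimately have "B (f0 - T f0) \<psi> = 0" using LIMSEQ_unique by blast
    moreover have "B (T f0) \<psi> = 0" using f0 \<psi> by (intro null[OF _ _ T0]) auto
    ultimately show "B f0 \<psi> = 0" using f0 \<psi> by (simp add: diff_left)
  qed
qed

end

section \<open>Best approximation of a summable sequence by few terms\<close>

lemma largest_terms_exist:
  fixes a :: "nat \<Rightarrow> real"
  assumes lim: "a \<longlonglongrightarrow> 0" and nonneg: "\<And>j. a j \<ge> 0"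
  shows "\<exists>S. finite S \<and> card S = K \<and> (\<forall>i\<in>S. \<forall>j. j \<notin> S \<longrightarrow> a j \<le> a i)"
proof (induction K)
  case 0
  then show ?case by (intro exI[of _ "{}"]) auto
next
  case (Suc K)
  then obtain S where S: "finite S" "card S = K" "\<forall>i\<in>S. \<forall>j. j \<notin> S \<longrightarrow> a j \<le> a i" by blast
  have "\<exists>m. m \<notin> S \<and> (\<forall>j. j \<notin> S \<longrightarrow> a j \<le> a m)"
  proof (cases "\<exists>m. m \<notin> S \<and> a m > 0")
    case True
    then obtain m0 where m0: "m0 \<notin> S" "a m0 > 0" by blast
    obtain N where N: "\<And>j. j \<ge> N \<Longrightarrow> a j < a m0"
      using order_tendstoD(2)[OF lim m0(2)] by (auto simp: eventually_sequentially)
    define C where "C = {..<N} - S"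
    have C: "finite C" "m0 \<in> C" using m0 N[of m0] by (auto simp: C_def not_le[symmetric])
    obtain m where m: "m \<in> C" "\<And>j. j \<in> C \<Longrightarrow> a j \<le> a m"
    proof -
      have "Max (a ` C) \<in> a ` C" using C by (intro Max_in) auto
      then obtain m where "m \<in> C" "a m = Max (a ` C)" by auto
      with that C show ?thesis by (metis Max_ge finite_imageI imageI)
    qed
    have "a j \<le> a m" if "j \<notin> S" for j
    proof (cases "j < N")
      case True
      then show ?thesis using m that by (auto simp: C_def)
    next
      case False
      then show ?thesis using N[of j] m(2)[OF C(2)] by simp
    qed
    then show ?thesis using m(1) by (auto simp: C_def)
  next
    case False
    moreover obtain m where "m \<notin> S" using S(1) ex_new_if_finite infinite_UNIV_nat by blast
    ultimately show ?thesis using nonneg by (metis not_less order_trans)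
  qed
  then obtain m where m: "m \<notin> S" "\<And>j. j \<notin> S \<Longrightarrow> a j \<le> a m" by blast
  then show ?case using S by (intro exI[of _ "insert m S"]) auto
qed

text \<open>
  If \<open>t\<close> is the least of the \<open>K\<close> largest terms, the squares of the others sum to at most \<open>t\<close> times the sum
  of the others, which is at most \<open>suminf a - K * t\<close>.  Maximising over \<open>t\<close> gives \<open>(suminf a)\<^sup>2 / (4 * K)\<close>.
\<close>

theorem l2_tail_of_summable:
  fixes a :: "nat \<Rightarrow> real"
  assumes sum: "summable a" and nonneg: "\<And>j. a j \<ge> 0" and K: "K \<ge> 1"
  obtains S where "finite S" "card S \<le> K" "summable (\<lambda>j. if j \<in> S then 0 else (a j)\<^sup>2)"
    "(\<Sum>j. if j \<in> S then 0 else (a j)\<^sup>2) \<le> (suminf a)\<^sup>2 / (real K + 1)"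
proof -
  obtain S where S: "finite S" "card S = K" "\<And>i j. i \<in> S \<Longrightarrow> j \<notin> S \<Longrightarrow> a j \<le> a i"
    using largest_terms_exist[OF summable_LIMSEQ_zero[OF sum] nonneg] by metis
  define t where "t = Min (a ` S)"
  have S_ne: "S \<noteq> {}" using S K by auto
  have t0: "t \<ge> 0" unfolding t_def using S S_ne nonneg by (subst Min_ge_iff) auto
  have ta: "a j \<le> t" if "j \<notin> S" for j unfolding t_def using S S_ne that by (subst Min_ge_iff) auto
  have tS: "real K * t \<le> sum a S"
    using sum_bounded_below[of S t a] S(1,2) by (auto simp: t_def)
  have sb: "summable (\<lambda>j. if j \<in> S then 0 else a j)"
    by (rule summable_comparison_test'[OF sum, of 0]) (use nonneg in auto)
  have eq: "(\<Sum>j. if j \<in> S then 0 else a j) = suminf a - sum a S"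
  proof -
    have "(\<lambda>j. a j - (if j \<in> S then a j else 0)) sums (suminf a - sum a S)"
      by (intro sums_diff summable_sums sum sums_If_finite_set S)
    moreover have "(\<lambda>j. a j - (if j \<in> S then a j else 0)) = (\<lambda>j. if j \<in> S then 0 else a j)" by auto
    ultimately show ?thesis by (simp add: sums_iff)
  qed
  have le: "(if j \<in> S then 0 else (a j)\<^sup>2) \<le> t * (if j \<in> S then 0 else a j)" for j
    using ta[of j] nonneg[of j] by (auto simp: power2_eq_square intro!: mult_right_mono)
  have s2: "summable (\<lambda>j. if j \<in> S then 0 else (a j)\<^sup>2)"
    by (rule summable_comparison_test'[OF summable_mult[OF sb, of t], of 0]) (use le in auto)
  have "(\<Sum>j. if j \<in> S then 0 else (a j)\<^sup>2) \<le> (\<Sum>j. t * (if j \<in> S then 0 else a j))"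
    by (intro suminf_le le s2 summable_mult sb)
  also have "\<dots> = t * (suminf a - sum a S)" by (simp only: suminf_mult[OF sb] eq)
  also have "\<dots> \<le> t * (suminf a - real K * t)" using tS t0 by (intro mult_left_mono) auto
  also have "\<dots> \<le> (suminf a)\<^sup>2 / (real K + 1)"
  proof -
    define A Y where "A = suminf a" and "Y = (real K + 1) * (t * (A - real K * t))"
    \<comment> \<open>completing the square; the last summand is nonnegative because \<open>K \<ge> 1\<close>\<close>
    have "0 \<le> (2 * A - (real K + 1) * t)\<^sup>2 + (real K + 1) * (3 * real K - 1) * t\<^sup>2"
      using K by (intro add_nonneg_nonneg mult_nonneg_nonneg) auto
    also have "\<dots> = 4 * (A\<^sup>2 - Y)"
      by (simp add: Y_def power2_eq_square algebra_simps)
    finally have "Y \<le> A\<^sup>2" by simp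
    then have "t * (A - real K * t) * (real K + 1) \<le> A\<^sup>2" by (simp only: Y_def mult_ac)
    then show ?thesis unfolding A_def[symmetric] by (simp add: pos_le_divide_eq)
  qed
  finally show ?thesis using that S(1,2) s2 by blast
qed

section \<open>Expansion in eigenspaces\<close>

context semi_inner begin

lemma sum_mem: "(\<And>j. j \<in> F \<Longrightarrow> p j \<in> V) \<Longrightarrow> sum p F \<in> V"
  using V by (rule subspace_sum)

lemma sum_left:
  assumes "h \<in> V" "\<And>j. j \<in> F \<Longrightarrow> p j \<in> V"
  shows "B (sum p F) h = (\<Sum>j\<in>F. B (p j) h)"
  using assms(2)
proof (induction F rule: infinite_finite_induct)
  case (insert j F)
  then show ?case using assms(1) by (simp add: add_left sum_mem)
qed (use assms in auto)

end

text \<open>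
  The vectors \<open>p j\<close> are the projections of \<open>f\<close> to the eigenspaces.
\<close>

locale eigen_expansion = form_operator V B X D
  for V :: "'v::real_vector set" and B X D +
  fixes \<mu> :: "nat \<Rightarrow> real" and f :: 'v and p :: "nat \<Rightarrow> 'v"
  assumes inj: "inj \<mu>" and range: "range \<mu> = {\<kappa>. \<exists>u\<in>eigen \<kappa>. B u u \<noteq> 0}"
    and f: "f \<in> V" and p: "p j \<in> eigen (\<mu> j)"
    and p_orth: "h \<in> eigen (\<mu> j) \<Longrightarrow> B (f - p j) h = 0"
begin

lemma pV [simp]: "p j \<in> V" using p eigen_mem by blast

lemma p_inner_eigen: "h \<in> eigen (\<mu> j) \<Longrightarrow> B (p i) h = (if i = j then B f h else 0)"
  using eigen_orthogonal[OF p[of i], of h "\<mu> j"] p_orth[of h j] inj f eigen_mem[of h]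
  by (auto simp: diff_left inj_eq)

lemma residual_inner_eigen:
  assumes h: "h \<in> eigen (\<mu> j)" and F: "finite F"
  shows "B (f - sum p F) h = (if j \<in> F then 0 else B f h)"
  using f eigen_mem[OF h] F by (simp add: diff_left sum_left sum_mem p_inner_eigen[OF h])

lemma residual_norm:
  assumes F: "finite F"
  shows "B (f - sum p F) (f - sum p F) = B f f - (\<Sum>j\<in>F. B (p j) (p j))"
proof -
  have W: "sum p F \<in> V" by (simp add: sum_mem)
  have "B (sum p F) (f - sum p F) = (\<Sum>j\<in>F. B (p j) (f - sum p F))"
    using f W by (intro sum_left) auto
  also have "\<dots> = 0"
  proof (intro sum.neutral ballI)
    fix j assume j: "j \<in> F"
    have "B (p j) (f - sum p F) = B (f - sum p F) (p j)" using f W by (intro sym) auto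
    then show "B (p j) (f - sum p F) = 0" using residual_inner_eigen[OF p F, of j] j by simp
  qed
  finally have 0: "B (sum p F) (f - sum p F) = 0" .
  have "B (sum p F) f = (\<Sum>j\<in>F. B (p j) (p j))"
  proof -
    have "B (p j) f = B (p j) (p j)" for j
      using p_inner_eigen[OF p[of j], of j] sym[OF f pV, of j] by simp
    then show ?thesis using f by (simp add: sum_left)
  qed
  then show ?thesis using 0 f W sym[OF f W] by (simp add: diff_left diff_right)
qed

text \<open>
  The partial sums of the \<open>p j\<close> are a Cauchy sequence by Bessel's inequality.  What remains of \<open>f\<close> in the
  limit is orthogonal to all eigenvectors, hence zero.
\<close>

theorem parseval: "(\<lambda>j. B (p j) (p j)) sums B f f"
proof -
  define c where "c j = B (p j) (p j)" for j
  have c0: "c j \<ge> 0" for j by (simp add: c_def nonneg)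
  define x where "x N = sum p {..<N}" for N
  have xV: "x N \<in> V" for N by (simp add: x_def sum_mem)
  have "sum c F \<le> B f f" if "finite F" for F
    using residual_norm[OF that] nonneg[of "f - sum p F"] f by (simp add: c_def sum_mem)
  then have sc: "summable c" by (intro summableI_nonneg_bounded[of c "B f f"] c0) auto
  have tail: "B (x n - x m) (x n - x m) = sum c {m..<n}" if "m \<le> n" for m n
  proof -
    have "B (f - x m) (f - x m) = B f f - sum c {..<m}" "B (f - x n) (f - x n) = B f f - sum c {..<n}"
      by (simp_all add: x_def residual_norm c_def)
    moreover have "B (f - x n) (x n - x m) = 0"
    proof -
      have "x n - x m = sum p {m..<n}"
        unfolding x_def using that
        by (metis add_diff_cancel_left' atLeast0LessThan sum.atLeastLessThan_concat zero_le)
      then have "B (x n - x m) (f - x n) = (\<Sum>j\<in>{m..<n}. B (p j) (f - x n))"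
        using f xV by (simp add: sum_left)
      also have "\<dots> = (\<Sum>j\<in>{m..<n}. 0)"
      proof (intro sum.cong refl)
        fix j assume j: "j \<in> {m..<n}"
        have "B (p j) (f - x n) = B (f - x n) (p j)" using f xV by (intro sym) auto
        then show "B (p j) (f - x n) = 0"
          unfolding x_def using residual_inner_eigen[OF p, of "{..<n}" j] j by simp
      qed
      finally show ?thesis using sym[of "x n - x m" "f - x n"] f xV by simp
    qed
    moreover have "sum c {..<n} = sum c {..<m} + sum c {m..<n}"
      using that sum.atLeastLessThan_concat[of 0 m n c] by (simp add: atLeast0LessThan)
    moreover have "B (f - x m) (f - x m) =
        B (f - x n) (f - x n) + 2 * B (f - x n) (x n - x m) + B (x n - x m) (x n - x m)"
    proof -
      define a b where "a = f - x n" and "b = x n - x m"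
      have "a \<in> V" "b \<in> V" using f xV by (auto simp: a_def b_def)
      moreover have "f - x m = a + b" by (simp add: a_def b_def)
      ultimately show ?thesis unfolding a_def[symmetric] b_def[symmetric]
        using sym[of a b] by (simp add: add_left add_right)
    qed
    ultimately show ?thesis by linarith
  qed
  have "cauchy x" unfolding cauchy_def
  proof (intro allI impI)
    fix e :: real assume e: "e > 0"
    obtain N where N: "\<And>m n. m \<ge> N \<Longrightarrow> norm (sum c {m..<n}) < e"
      using sc e unfolding summable_Cauchy by blast
    have "B (x k - x l) (x k - x l) < e" if "k \<ge> N" "l \<ge> N" for k l
    proof (cases "l \<le> k")
      case True
      then show ?thesis using tail[OF True] N[of l k] that by simp
    next
      case False
      then show ?thesis using tail[of k l] N[of k l] that sym_diff[OF xV xV, of k l] by simp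
    qed
    then show "\<exists>N. \<forall>k\<ge>N. \<forall>l\<ge>N. B (x k - x l) (x k - x l) < e" by blast
  qed
  then obtain u where u: "u \<in> V" "converges x u" using complete[of x] xV by blast
  have perp: "B (f - u) h = 0" if h: "h \<in> eigen \<kappa>" for \<kappa> h
  proof (cases "B h h = 0")
    case True
    then show ?thesis using f u eigen_mem[OF h] by (intro null_right[OF _ _ True]) auto
  next
    case False
    then have "\<kappa> \<in> range \<mu>" using h range by blast
    then obtain j where j: "\<kappa> = \<mu> j" by blast
    have "B (x N) h = B f h" if "N \<ge> Suc j" for N
      using residual_inner_eigen[of h j "{..<N}"] h j that f eigen_mem[OF h] xV[of N]
      by (simp add: diff_left x_def)
    then have "(\<lambda>N. B (x N) h) \<longlonglongrightarrow> B f h"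
      by (intro tendsto_eventually) (auto simp: eventually_sequentially)
    moreover have "(\<lambda>N. B (x N) h) \<longlonglongrightarrow> B u h" using xV u eigen_mem[OF h] by (intro converges_inner) auto
    ultimately have "B u h = B f h" using LIMSEQ_unique by blast
    then show ?thesis using f u eigen_mem[OF h] by (simp add: diff_left)
  qed
  have null': "B (f - u) (f - u) = 0" using f u perp by (intro eigenvectors_complete) auto
  have "B (f - x N) (f - x N) = B (x N - u) (x N - u)" for N
  proof -
    define a b where "a = u - x N" and "b = f - u"
    have ab: "a \<in> V" "b \<in> V" "B b b = 0" using f u xV null' by (auto simp: a_def b_def)
    have "f - x N = a + b" by (simp add: a_def b_def)
    then have "B (f - x N) (f - x N) = B a a"
      using ab null[of b a] null_right[of a b] by (simp add: add_left add_right)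
    then show ?thesis using sym_diff[OF u(1) xV, of N] by (simp add: a_def)
  qed
  then have "(\<lambda>N. B f f - sum c {..<N}) \<longlonglongrightarrow> 0"
    using u(2) by (simp add: converges_def x_def residual_norm c_def)
  then have "(\<lambda>N. B f f - (B f f - sum c {..<N})) \<longlonglongrightarrow> B f f - 0" by (intro tendsto_intros)
  then show ?thesis by (simp add: sums_def c_def)
qed

lemma residual_sums:
  assumes F: "finite F"
  shows "(\<lambda>j. if j \<in> F then 0 else B (p j) (p j)) sums B (f - sum p F) (f - sum p F)"
proof -
  have "(\<lambda>j. B (p j) (p j) - (if j \<in> F then B (p j) (p j) else 0)) sums (B f f - (\<Sum>j\<in>F. B (p j) (p j)))"
    by (intro sums_diff parseval sums_If_finite_set F)
  moreover have "(\<lambda>j. B (p j) (p j) - (if j \<in> F then B (p j) (p j) else 0)) =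
      (\<lambda>j. if j \<in> F then 0 else B (p j) (p j))" by auto
  ultimately show ?thesis by (simp add: residual_norm[OF F])
qed

lemma residual_projection_norm:
  assumes F: "finite F" and q: "q \<in> eigen (\<mu> j)"
    and q_orth: "\<And>h. h \<in> eigen (\<mu> j) \<Longrightarrow> B ((f - sum p F) - q) h = 0"
  shows "B q q = (if j \<in> F then 0 else B (p j) (p j))"
proof -
  have qV: "q \<in> V" using q eigen_mem by blast
  have W: "f - sum p F \<in> V" using f by (simp add: sum_mem)
  have inner: "B q h = (if j \<in> F then 0 else B f h)" if h: "h \<in> eigen (\<mu> j)" for h
    using q_orth[OF h] residual_inner_eigen[OF h F] W qV eigen_mem[OF h] by (simp add: diff_left)
  show ?thesis
  proof (cases "j \<in> F")
    case True
    then show ?thesis using inner[OF q] by simp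
  next
    case False
    have "B q q = B f q" "B q (p j) = B f (p j)" using inner q p False by auto
    moreover have "B (p j) q = B f q" "B (p j) (p j) = B f (p j)" using p_inner_eigen[OF q, of j] p_inner_eigen[OF p, of j j] by auto
    ultimately show ?thesis using False sym[OF qV pV, of j] by simp
  qed
qed

end

section \<open>Calculus of smooth functions\<close>

lemma tcd_cong:
  assumes "open S" "times_cont_diff_on k S f" "\<And>x. x \<in> S \<Longrightarrow> f x = g x"
  shows "times_cont_diff_on k S g"
  using assms(2,3)
proof (induction k arbitrary: f g)
  case 0
  then show ?case using continuous_on_cong by force
next
  case (Suc k)
  have d: "f differentiable (at x)" if "x \<in> S" for x using Suc.prems that by simp
  have eq: "frechet_derivative f (at x) = frechet_derivative g (at x)" if "x \<in> S" for x
    by (rule frechet_derivative_transform_within_open[OF d[OF that] assms(1) that]) (use Suc.prems in auto)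
  have "g differentiable (at x)" if "x \<in> S" for x
    using d[OF that] Suc.prems(2) that assms(1) unfolding differentiable_def
    by (meson has_derivative_transform_within_open)
  moreover have "times_cont_diff_on k S (\<lambda>x. frechet_derivative g (at x) v)" for v
    by (rule Suc.IH[of "\<lambda>x. frechet_derivative f (at x) v"]) (use Suc.prems eq in auto)
  ultimately show ?case by simp
qed

lemma tcd_differentiable_imp_continuous: "(\<forall>x\<in>S. f differentiable (at x)) \<Longrightarrow> continuous_on S f"
  by (meson continuous_at_imp_continuous_on differentiable_imp_continuous_within)

lemma tcd_SucD: "times_cont_diff_on (Suc k) S f \<Longrightarrow> times_cont_diff_on k S f"
proof (induction k arbitrary: f)
  case 0
  then show ?case using tcd_differentiable_imp_continuous by auto
next
  case (Suc k)
  then show ?case by (metis times_cont_diff_on.simps(2))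
qed

lemma tcd_SucI:
  assumes "open S" "\<And>x. x \<in> S \<Longrightarrow> (f has_derivative (\<lambda>v. f' v x)) (at x)"
    and "\<And>v. times_cont_diff_on k S (f' v)"
  shows "times_cont_diff_on (Suc k) S f"
proof -
  have "frechet_derivative f (at x) = (\<lambda>v. f' v x)" if "x \<in> S" for x
    using frechet_derivative_at[OF assms(2)[OF that]] by simp
  then have "times_cont_diff_on k S (\<lambda>x. frechet_derivative f (at x) v)" for v
    by (intro tcd_cong[OF assms(1) assms(3)[of v]]) simp
  then show ?thesis using assms(2) by (auto simp: differentiable_def)
qed

lemma tcd_derivative:
  assumes "times_cont_diff_on (Suc k) S f"
  shows "x \<in> S \<Longrightarrow> (f has_derivative frechet_derivative f (at x)) (at x)"
    and "times_cont_diff_on k S (\<lambda>x. frechet_derivative f (at x) v)"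
  using assms frechet_derivative_works by auto

lemma tcd_const: "open S \<Longrightarrow> times_cont_diff_on k S (\<lambda>x. c)"
proof (induction k arbitrary: c)
  case (Suc k)
  then show ?case by (intro tcd_SucI[where f' = "\<lambda>v x. 0"]) auto
qed simp

lemma tcd_add:
  assumes "open S" "times_cont_diff_on k S f" "times_cont_diff_on k S g"
  shows "times_cont_diff_on k S (\<lambda>x. f x + g x)"
  using assms(2,3)
proof (induction k arbitrary: f g)
  case (Suc k)
  show ?case
    by (rule tcd_SucI[OF assms(1), where f' = "\<lambda>v x. frechet_derivative f (at x) v + frechet_derivative g (at x) v"])
      (use Suc in \<open>auto intro!: has_derivative_add tcd_derivative\<close>)
qed (auto intro: continuous_intros)

lemma tcd_bounded_linear:
  assumes "open S" "bounded_linear L" "times_cont_diff_on k S f"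
  shows "times_cont_diff_on k S (\<lambda>x. L (f x))"
  using assms(3)
proof (induction k arbitrary: f)
  case 0
  then show ?case using bounded_linear.continuous_on[OF assms(2)] by simp
next
  case (Suc k)
  show ?case
    by (rule tcd_SucI[OF assms(1), where f' = "\<lambda>v x. L (frechet_derivative f (at x) v)"])
      (use Suc in \<open>auto intro!: bounded_linear.has_derivative[OF assms(2)] tcd_derivative\<close>)
qed

lemma tcd_mult:
  fixes f g :: "'a::euclidean_space \<Rightarrow> real"
  assumes "open S" "times_cont_diff_on k S f" "times_cont_diff_on k S g"
  shows "times_cont_diff_on k S (\<lambda>x. f x * g x)"
  using assms(2,3)
proof (induction k arbitrary: f g)
  case (Suc k)
  have "times_cont_diff_on k S f" "times_cont_diff_on k S g" using Suc.prems tcd_SucD by auto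
  then show ?case
    using Suc
    by (intro tcd_SucI[OF assms(1), where f' = "\<lambda>v x. f x * frechet_derivative g (at x) v + frechet_derivative f (at x) v * g x"])
      (auto intro!: has_derivative_mult tcd_derivative tcd_add assms(1))
qed (auto intro: continuous_intros)

lemma tcd_sum:
  assumes "open S" "\<And>i. i \<in> I \<Longrightarrow> times_cont_diff_on k S (f i)"
  shows "times_cont_diff_on k S (\<lambda>x. \<Sum>i\<in>I. f i x)"
  using assms(2)
  by (induction I rule: infinite_finite_induct) (auto intro: tcd_add tcd_const assms(1))

lemma tcd_Union:
  assumes "\<And>U. U \<in> \<U> \<Longrightarrow> open U \<and> times_cont_diff_on k U f"
  shows "times_cont_diff_on k (\<Union>\<U>) f"
  using assms
proof (induction k arbitrary: f)
  case 0
  then show ?case by (auto intro!: continuous_on_open_Union)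
next
  case (Suc k)
  then show ?case by auto
qed

lemma smooth_on_cong: "open S \<Longrightarrow> smooth_on S f \<Longrightarrow> (\<And>x. x \<in> S \<Longrightarrow> f x = g x) \<Longrightarrow> smooth_on S g"
  unfolding smooth_on_def using tcd_cong by blast

lemma smooth_on_const: "open S \<Longrightarrow> smooth_on S (\<lambda>x. c)"
  unfolding smooth_on_def using tcd_const by blast

lemma smooth_on_add: "open S \<Longrightarrow> smooth_on S f \<Longrightarrow> smooth_on S g \<Longrightarrow> smooth_on S (\<lambda>x. f x + g x)"
  unfolding smooth_on_def using tcd_add by blast

lemma smooth_on_mult:
  fixes f g :: "'a::euclidean_space \<Rightarrow> real"
  shows "open S \<Longrightarrow> smooth_on S f \<Longrightarrow> smooth_on S g \<Longrightarrow> smooth_on S (\<lambda>x. f x * g x)"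
  unfolding smooth_on_def using tcd_mult by blast

lemma smooth_on_sum:
  "open S \<Longrightarrow> (\<And>i. i \<in> I \<Longrightarrow> smooth_on S (f i)) \<Longrightarrow> smooth_on S (\<lambda>x. \<Sum>i\<in>I. f i x)"
  unfolding smooth_on_def by (intro allI tcd_sum) auto

lemma smooth_on_bounded_linear:
  "open S \<Longrightarrow> bounded_linear L \<Longrightarrow> smooth_on S f \<Longrightarrow> smooth_on S (\<lambda>x. L (f x))"
  unfolding smooth_on_def using tcd_bounded_linear by blast

lemma smooth_on_Union:
  "(\<And>U. U \<in> \<U> \<Longrightarrow> open U \<and> smooth_on U f) \<Longrightarrow> smooth_on (\<Union>\<U>) f"
  unfolding smooth_on_def by (intro allI tcd_Union) auto

lemma smooth_on_Un:
  "open S \<Longrightarrow> open T \<Longrightarrow> smooth_on S f \<Longrightarrow> smooth_on T f \<Longrightarrow> smooth_on (S \<union> T) f"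
  using smooth_on_Union[of "{S, T}" f] by auto

lemma smooth_on_continuous: "smooth_on S f \<Longrightarrow> continuous_on S f"
  unfolding smooth_on_def by (metis times_cont_diff_on.simps(1))

lemma smooth_on_differentiable: "smooth_on S f \<Longrightarrow> x \<in> S \<Longrightarrow> f differentiable (at x)"
  unfolding smooth_on_def by (metis times_cont_diff_on.simps(2))

lemma smooth_on_continuous_derivative:
  "smooth_on S f \<Longrightarrow> continuous_on S (\<lambda>x. frechet_derivative f (at x) v)"
  unfolding smooth_on_def by (metis times_cont_diff_on.simps)

section \<open>A flat function\<close>

text \<open>
  The functions \<open>t powr (-m) * exp (- 1 / t)\<close>, extended by zero.  The whole family is needed because each
  derivative is a combination of two members; \<open>flat 0\<close> is the function of interest.
\<close>

definition flat :: "nat \<Rightarrow> real \<Rightarrow> real" where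
  "flat m t = (if t > 0 then exp (- inverse t) * inverse t ^ m else 0)"

lemma flat_tendsto_0: "(flat m \<longlongrightarrow> 0) (at 0)"
proof -
  have "((\<lambda>x. flat m (inverse x)) \<longlongrightarrow> 0) at_top"
  proof (rule Lim_transform_eventually)
    show "((\<lambda>x::real. x ^ m / exp x) \<longlongrightarrow> 0) at_top" by (rule tendsto_power_div_exp_0)
    show "\<forall>\<^sub>F x in at_top. x ^ m / exp x = flat m (inverse x)"
      using eventually_gt_at_top[of 0]
      by eventually_elim (auto simp: flat_def exp_minus field_simps)
  qed
  then have "(flat m \<longlongrightarrow> 0) (at_right 0)" by (simp add: filterlim_at_right_to_top)
  moreover have "(flat m \<longlongrightarrow> 0) (at_left 0)"
    by (rule tendsto_eventually) (auto simp: flat_def eventually_at_filter)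
  ultimately show ?thesis by (simp add: filterlim_at_split)
qed

lemma flat_has_derivative:
  "(flat m has_real_derivative flat (m + 2) t - real m * flat (m + 1) t) (at t)"
proof -
  consider "t < 0" | "t = 0" | "t > 0" by linarith
  then show ?thesis
  proof cases
    case 1
    have "((\<lambda>x. 0) has_real_derivative 0) (at t)" by simp
    then have "(flat m has_real_derivative 0) (at t)"
      by (rule has_field_derivative_transform_within_open[of _ _ _ "{..<0}"]) (use 1 in \<open>auto simp: flat_def\<close>)
    then show ?thesis using 1 by (simp add: flat_def)
  next
    case 2
    have "((\<lambda>y. (flat m y - flat m 0) / (y - 0)) \<longlongrightarrow> 0) (at 0)"
      by (rule Lim_transform_eventually[OF flat_tendsto_0[of "m + 1"]])
        (auto simp: flat_def eventually_at_filter field_simps)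
    then show ?thesis using 2 by (simp add: has_field_derivative_iff flat_def)
  next
    case 3
    have "((\<lambda>t. exp (- inverse t) * inverse t ^ m) has_real_derivative flat (m + 2) t - real m * flat (m + 1) t) (at t)"
      using 3 not0_implies_Suc[of m] not0_implies_Suc[of "m - 1"]
      by (cases "m = 0"; cases "m - 1 = 0")
        (auto intro!: derivative_eq_intros simp: flat_def algebra_simps power2_eq_square)
    then show ?thesis
      by (rule has_field_derivative_transform_within_open[of _ _ _ "{0<..}"]) (use 3 in \<open>auto simp: flat_def\<close>)
  qed
qed

text \<open>
  Induction on the order of differentiability, simultaneously for all \<open>m\<close>, by the chain rule.
\<close>

lemma tcd_flat:
  assumes "open S" "times_cont_diff_on k S h"
  shows "times_cont_diff_on k S (\<lambda>x. flat m (h x))"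
  using assms(2)
proof (induction k arbitrary: m)
  case 0
  have "continuous_on UNIV (flat m)"
    using flat_has_derivative DERIV_isCont continuous_at_imp_continuous_on by blast
  then show ?case using 0 continuous_on_compose2[of UNIV "flat m" S h] by simp
next
  case (Suc k)
  have h: "times_cont_diff_on k S h" using Suc.prems tcd_SucD by blast
  show ?case
  proof (rule tcd_SucI[OF assms(1), where f' = "\<lambda>v x. frechet_derivative h (at x) v *
      (flat (m + 2) (h x) + (- real m) * flat (m + 1) (h x))"])
    fix x assume "x \<in> S"
    have "((flat m \<circ> h) has_derivative
        ((\<lambda>v. v * (flat (m + 2) (h x) - real m * flat (m + 1) (h x))) \<circ> frechet_derivative h (at x))) (at x)"
    proof (rule diff_chain_at)
      show "(h has_derivative frechet_derivative h (at x)) (at x)"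
        using tcd_derivative(1)[OF Suc.prems \<open>x \<in> S\<close>] .
      show "(flat m has_derivative (\<lambda>v. v * (flat (m + 2) (h x) - real m * flat (m + 1) (h x)))) (at (h x))"
        using flat_has_derivative[of m "h x"] by (simp add: has_field_derivative_def mult_commute_abs)
    qed
    then show "((\<lambda>x. flat m (h x)) has_derivative (\<lambda>v. frechet_derivative h (at x) v *
      (flat (m + 2) (h x) + (- real m) * flat (m + 1) (h x)))) (at x)"
      by (simp add: o_def)
  next
    fix v
    show "times_cont_diff_on k S (\<lambda>x. frechet_derivative h (at x) v *
      (flat (m + 2) (h x) + (- real m) * flat (m + 1) (h x)))"
      by (intro tcd_mult tcd_add tcd_const assms(1) tcd_derivative(2)[OF Suc.prems] Suc.IH h)
  qed
qed

lemma smooth_on_flat: "open S \<Longrightarrow> smooth_on S h \<Longrightarrow> smooth_on S (\<lambda>x. flat m (h x))"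
  unfolding smooth_on_def using tcd_flat by blast

lemma flat_0: "flat 0 t \<ge> 0" "flat 0 t \<le> 1" "flat 0 t > 0 \<longleftrightarrow> t > 0"
  by (auto simp: flat_def)

section \<open>Manifolds and gradients\<close>

lemma continuous_on_locally:
  fixes M :: "'a::t2_space set" and f :: "'a \<Rightarrow> 'b::topological_space"
  assumes "\<And>p. p \<in> M \<Longrightarrow> \<exists>U. openin (top_of_set M) U \<and> p \<in> U \<and> continuous_on U f"
  shows "continuous_on M f"
  unfolding continuous_on_eq_continuous_within
proof
  fix p assume p: "p \<in> M"
  then obtain U where U: "openin (top_of_set M) U" "p \<in> U" "continuous_on U f" using assms by blast
  then obtain T where T: "open T" "U = M \<inter> T" by (auto simp: openin_open)
  have "at p within M = at p within U"
    by (rule at_within_nhd[of p T]) (use T U in auto)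
  then show "continuous (at p within M) f" using U by (simp add: continuous_on_eq_continuous_within)
qed

lemma inner_transpose_mult: "(transpose A *v x) \<bullet> y = x \<bullet> (A *v (y :: real ^ 'n))" for A :: "real ^ 'n ^ 'm"
  using dot_lmul_matrix[of x A y] vector_transpose_matrix[of x "transpose A"] by simp

lemma matrix_inv_mult:
  fixes G :: "real ^ 'n ^ 'n"
  assumes "\<And>v. G *v v = 0 \<Longrightarrow> v = 0"
  shows "G *v (matrix_inv G *v x) = x" "matrix_inv G *v (G *v x) = x"
proof -
  have "invertible G" using assms by (simp add: invertible_left_inverse matrix_left_invertible_ker)
  then have "G ** matrix_inv G = mat 1 \<and> matrix_inv G ** G = mat 1"
    unfolding matrix_inv_def invertible_def by (rule someI_ex)
  then show "G *v (matrix_inv G *v x) = x" "matrix_inv G *v (G *v x) = x"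
    by (simp_all add: matrix_vector_mul_assoc)
qed

lemma continuous_on_det:
  fixes G :: "'a::topological_space \<Rightarrow> real ^ 'n ^ 'n"
  assumes "\<And>i j. continuous_on S (\<lambda>p. G p $ i $ j)"
  shows "continuous_on S (\<lambda>p. det (G p))"
  unfolding det_def
  by (intro continuous_on_sum continuous_on_mult continuous_on_const continuous_on_prod assms)

text \<open>Cramer's rule makes the inverse continuous.\<close>

lemma continuous_on_matrix_inv_mult:
  fixes G :: "'a::topological_space \<Rightarrow> real ^ 'n ^ 'n"
  assumes G: "continuous_on S G" and \<xi>: "continuous_on S \<xi>"
    and inj: "\<And>p v. p \<in> S \<Longrightarrow> G p *v v = 0 \<Longrightarrow> v = 0"
  shows "continuous_on S (\<lambda>p. matrix_inv (G p) *v \<xi> p)"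
proof -
  have c: "continuous_on S (\<lambda>p. G p $ i $ j)" "continuous_on S (\<lambda>p. \<xi> p $ i)" for i j
    using G \<xi> by (auto intro!: continuous_intros)
  have d: "det (G p) \<noteq> 0" if "p \<in> S" for p
    using inj[OF that] by (simp add: invertible_det_nz[symmetric] invertible_left_inverse matrix_left_invertible_ker)
  let ?C = "\<lambda>k p. det (\<chi> i j. if j = k then \<xi> p $ i else G p $ i $ j) / det (G p)"
  have "continuous_on S (\<lambda>p. \<chi> k. ?C k p)"
  proof (intro continuous_on_vec_lambda continuous_on_divide continuous_on_det c)
    fix k i j
    show "continuous_on S (\<lambda>p. (\<chi> i j. if j = k then \<xi> p $ i else G p $ i $ j) $ i $ j)"
      by (cases "j = k") (auto intro: c)
  qed (use d in auto)
  then show ?thesis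
  proof (rule continuous_on_eq)
    fix p assume p: "p \<in> S"
    have eq: "G p *v (matrix_inv (G p) *v \<xi> p) = \<xi> p"
      by (rule matrix_inv_mult(1)) (rule inj[OF p])
    have "det (\<chi> i j. if j = k then \<xi> p $ i else G p $ i $ j)
      = (matrix_inv (G p) *v \<xi> p) $ k * det (G p)" for k
      using cramer_lemma[of k "G p" "matrix_inv (G p) *v \<xi> p"] unfolding eq .
    then show "(\<chi> k. ?C k p) = matrix_inv (G p) *v \<xi> p"
      using d[OF p] by (simp add: vec_eq_iff)
  qed
qed

locale riemannian_manifold =
  fixes M :: "'m::t2_space set"
    and A :: "('m, 'n::finite) chart set"
    and g :: "('m, 'n) chart \<Rightarrow> 'm \<Rightarrow> real ^ 'n ^ 'n"
  assumes manifold: "compact_connected_riemannian_manifold M A g"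
begin

lemma compact_M: "compact M" and atlas: "smooth_atlas M A" and metric: "riemannian_metric A g"
  using manifold by (auto simp: compact_connected_riemannian_manifold_def)

lemma dom_open: "c \<in> A \<Longrightarrow> openin (top_of_set M) (chart_dom c)"
  and img_open: "c \<in> A \<Longrightarrow> open (chart_img c)"
  and homeo: "c \<in> A \<Longrightarrow> homeomorphism (chart_dom c) (chart_img c) (chart_map c) (chart_inv c)"
  and M_eq: "M = (\<Union>c\<in>A. chart_dom c)"
  and transition_smooth: "c \<in> A \<Longrightarrow> d \<in> A \<Longrightarrow>
    smooth_on (chart_map c ` (chart_dom c \<inter> chart_dom d)) (transition c d)"
  using atlas unfolding smooth_atlas_def by auto

lemma dom_subset: "c \<in> A \<Longrightarrow> chart_dom c \<subseteq> M"
  using M_eq by auto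

lemma chart_ex: "p \<in> M \<Longrightarrow> \<exists>c\<in>A. p \<in> chart_dom c"
  using M_eq by auto

lemma inv_map: "c \<in> A \<Longrightarrow> p \<in> chart_dom c \<Longrightarrow> chart_inv c (chart_map c p) = p"
  and map_inv: "c \<in> A \<Longrightarrow> x \<in> chart_img c \<Longrightarrow> chart_map c (chart_inv c x) = x"
  and inv_dom: "c \<in> A \<Longrightarrow> x \<in> chart_img c \<Longrightarrow> chart_inv c x \<in> chart_dom c"
  and map_img: "c \<in> A \<Longrightarrow> p \<in> chart_dom c \<Longrightarrow> chart_map c p \<in> chart_img c"
  and map_cont: "c \<in> A \<Longrightarrow> continuous_on (chart_dom c) (chart_map c)"
  and inv_cont: "c \<in> A \<Longrightarrow> continuous_on (chart_img c) (chart_inv c)"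
  using homeo[of c] unfolding homeomorphism_def by auto

lemma open_map_image:
  assumes "c \<in> A" "openin (top_of_set M) U"
  shows "open (chart_map c ` (chart_dom c \<inter> U))"
proof -
  have "openin (top_of_set (chart_dom c)) (chart_dom c \<inter> U)"
    using assms dom_subset[OF assms(1)] by (auto simp: openin_open)
  then have "openin (top_of_set (chart_img c)) (chart_map c ` (chart_dom c \<inter> U))"
    using homeomorphism_imp_open_map[OF homeo] assms by blast
  then show ?thesis using img_open[OF assms(1)] openin_open_trans by blast
qed

lemma open_inv_image:
  assumes "c \<in> A" "open U"
  shows "openin (top_of_set M) (chart_inv c ` (chart_img c \<inter> U))"
proof -
  have "openin (top_of_set (chart_img c)) (chart_img c \<inter> U)" using assms by auto
  then have "openin (top_of_set (chart_dom c)) (chart_inv c ` (chart_img c \<inter> U))"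
    using homeomorphism_imp_open_map homeomorphism_symD[OF homeo] assms by blast
  then show ?thesis using dom_open[OF assms(1)] openin_trans by blast
qed

lemma smooth_differentiable:
  "f \<in> smooth_functions A \<Longrightarrow> c \<in> A \<Longrightarrow> p \<in> chart_dom c \<Longrightarrow>
    (f \<circ> chart_inv c) differentiable (at (chart_map c p))"
  unfolding smooth_functions_def using smooth_on_differentiable map_img by blast

lemma smooth_const: "(\<lambda>p. k) \<in> smooth_functions A"
  unfolding smooth_functions_def by (auto simp: o_def intro!: smooth_on_const img_open)

lemma smooth_add: "f \<in> smooth_functions A \<Longrightarrow> h \<in> smooth_functions A \<Longrightarrow> (\<lambda>p. f p + h p) \<in> smooth_functions A"
  unfolding smooth_functions_def by (auto simp: o_def intro!: smooth_on_add img_open)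

lemma smooth_mult: "f \<in> smooth_functions A \<Longrightarrow> h \<in> smooth_functions A \<Longrightarrow> (\<lambda>p. f p * h p) \<in> smooth_functions A"
  unfolding smooth_functions_def by (auto simp: o_def intro!: smooth_on_mult img_open)

lemma smooth_scale: "f \<in> smooth_functions A \<Longrightarrow> (\<lambda>p. k * f p) \<in> smooth_functions A"
  using smooth_mult[OF smooth_const] by blast

lemma smooth_power: "f \<in> smooth_functions A \<Longrightarrow> (\<lambda>p. f p ^ k) \<in> smooth_functions A"
  by (induction k) (auto intro: smooth_const smooth_mult)

lemma smooth_continuous:
  assumes f: "f \<in> smooth_functions A"
  shows "continuous_on M f"
proof (rule continuous_on_locally)
  fix p assume "p \<in> M"
  then obtain c where c: "c \<in> A" "p \<in> chart_dom c" using chart_ex by blast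
  have "continuous_on (chart_img c) (f \<circ> chart_inv c)"
    using f c unfolding smooth_functions_def by (intro smooth_on_continuous) blast
  then have "continuous_on (chart_dom c) ((f \<circ> chart_inv c) \<circ> chart_map c)"
    unfolding chart_img_def by (rule continuous_on_compose[OF map_cont[OF c(1)]])
  then have "continuous_on (chart_dom c) f"
    by (rule continuous_on_eq) (use inv_map c in auto)
  then show "\<exists>U. openin (top_of_set M) U \<and> p \<in> U \<and> continuous_on U f"
    using c dom_open by blast
qed

lemma metric_sym: "c \<in> A \<Longrightarrow> p \<in> chart_dom c \<Longrightarrow> transpose (g c p) = g c p"
  and metric_pos: "c \<in> A \<Longrightarrow> p \<in> chart_dom c \<Longrightarrow> v \<noteq> 0 \<Longrightarrow> v \<bullet> (g c p *v v) > 0"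
  and metric_trans: "c \<in> A \<Longrightarrow> d \<in> A \<Longrightarrow> p \<in> chart_dom c \<inter> chart_dom d \<Longrightarrow>
    g c p = transpose (jacobian (transition c d) (at (chart_map c p))) ** g d p **
      jacobian (transition c d) (at (chart_map c p))"
  using metric unfolding riemannian_metric_def Let_def by blast+

lemma metric_cont: "c \<in> A \<Longrightarrow> continuous_on (chart_img c) (\<lambda>x. g c (chart_inv c x))"
  using metric unfolding riemannian_metric_def o_def by (intro smooth_on_continuous) blast

lemma metric_inj: "c \<in> A \<Longrightarrow> p \<in> chart_dom c \<Longrightarrow> g c p *v v = 0 \<Longrightarrow> v = 0"
  using metric_pos[of c p v] by fastforce

lemma metric_inv:
  assumes "c \<in> A" "p \<in> chart_dom c"
  shows "g c p *v (matrix_inv (g c p) *v x) = x" "matrix_inv (g c p) *v (g c p *v x) = x"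
  using matrix_inv_mult[of "g c p" x] metric_inj[OF assms] by auto

text \<open>
  Here \<open>matrix_inv (g c p)\<close> is the metric on covectors; this form of the inner product of the gradients
  needs only one inverse.
\<close>

definition chart_grad_inner :: "('m, 'n) chart \<Rightarrow> ('m \<Rightarrow> real) \<Rightarrow> ('m \<Rightarrow> real) \<Rightarrow> 'm \<Rightarrow> real" where
  "chart_grad_inner c f h p = (matrix_inv (g c p) *v coord_partials c f p) \<bullet> coord_partials c h p"

lemma chart_grad_inner_eq:
  "c \<in> A \<Longrightarrow> p \<in> chart_dom c \<Longrightarrow> grad g c f p \<bullet> (g c p *v grad g c h p) = chart_grad_inner c f h p"
  by (simp add: chart_grad_inner_def grad_def metric_inv)

lemma coord_partials_inner:
  assumes "f \<in> smooth_functions A" "c \<in> A" "p \<in> chart_dom c"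
  shows "frechet_derivative (f \<circ> chart_inv c) (at (chart_map c p)) v = coord_partials c f p \<bullet> v"
proof -
  have d: "((f \<circ> chart_inv c) has_derivative frechet_derivative (f \<circ> chart_inv c) (at (chart_map c p)))
      (at (chart_map c p))"
    using smooth_differentiable[OF assms] frechet_derivative_works by blast
  then have l: "linear (frechet_derivative (f \<circ> chart_inv c) (at (chart_map c p)))"
    using has_derivative_linear by blast
  have "frechet_derivative (f \<circ> chart_inv c) (at (chart_map c p)) v =
      frechet_derivative (f \<circ> chart_inv c) (at (chart_map c p)) (\<Sum>i\<in>UNIV. (v $ i) *\<^sub>R axis i 1)"
    using basis_expansion[of v] by (simp add: scalar_mult_eq_scaleR)
  also have "\<dots> = (\<Sum>i\<in>UNIV. v $ i * coord_partials c f p $ i)"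
    using l by (simp add: linear_sum linear_scale coord_partials_def)
  finally show ?thesis by (simp add: inner_vec_def mult.commute)
qed

lemma coord_partials_transition:
  assumes f: "f \<in> smooth_functions A" and c: "c \<in> A" and d: "d \<in> A"
    and p: "p \<in> chart_dom c \<inter> chart_dom d"
  shows "coord_partials c f p =
    transpose (jacobian (transition c d) (at (chart_map c p))) *v coord_partials d f p"
proof -
  let ?x = "chart_map c p" and ?y = "chart_map d p"
  let ?J = "jacobian (transition c d) (at ?x)"
  let ?O = "chart_map c ` (chart_dom c \<inter> chart_dom d)"
  have O: "open ?O" using open_map_image[OF c dom_open[OF d]] .
  have x: "?x \<in> ?O" using p by blast
  have y: "transition c d ?x = ?y" using p c by (simp add: transition_def inv_map)
  have T: "(transition c d has_derivative (\<lambda>h. ?J *v h)) (at ?x)"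
    using smooth_on_differentiable[OF transition_smooth[OF c d] x] jacobian_works by blast
  have F: "((f \<circ> chart_inv d) has_derivative (\<lambda>v. coord_partials d f p \<bullet> v)) (at (transition c d ?x))"
  proof -
    have "((f \<circ> chart_inv d) has_derivative frechet_derivative (f \<circ> chart_inv d) (at ?y)) (at ?y)"
      using smooth_differentiable[OF f d] p frechet_derivative_works by blast
    moreover have "frechet_derivative (f \<circ> chart_inv d) (at ?y) = (\<lambda>v. coord_partials d f p \<bullet> v)"
      using coord_partials_inner[OF f d] p by auto
    ultimately show ?thesis unfolding y by simp
  qed
  have "(((f \<circ> chart_inv d) \<circ> transition c d) has_derivative
      ((\<lambda>v. coord_partials d f p \<bullet> v) \<circ> (\<lambda>h. ?J *v h))) (at ?x)"
    by (rule diff_chain_at[OF T F])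
  then have "((f \<circ> chart_inv c) has_derivative ((\<lambda>v. coord_partials d f p \<bullet> v) \<circ> (\<lambda>h. ?J *v h))) (at ?x)"
  proof (rule has_derivative_transform_within_open[OF _ O x])
    fix z assume "z \<in> ?O"
    then show "((f \<circ> chart_inv d) \<circ> transition c d) z = (f \<circ> chart_inv c) z"
      using c d by (auto simp: transition_def inv_map)
  qed
  then have "frechet_derivative (f \<circ> chart_inv c) (at ?x) = ((\<lambda>v. coord_partials d f p \<bullet> v) \<circ> (\<lambda>h. ?J *v h))"
    using frechet_derivative_at by metis
  then have "coord_partials c f p \<bullet> v = (transpose ?J *v coord_partials d f p) \<bullet> v" for v
    using coord_partials_inner[OF f c, of p v] p by (simp add: dot_lmul_matrix)
  then show ?thesis by (metis vector_eq_rdot)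
qed

text \<open>
  With \<open>J\<close> the Jacobian of the transition map, coordinate derivatives are transformed by the transpose of
  \<open>J\<close> and the metric by \<open>G \<mapsto> transpose J ** G ** J\<close>, so \<open>J\<close> cancels.
\<close>

lemma chart_grad_inner_transition:
  assumes f: "f \<in> smooth_functions A" and h: "h \<in> smooth_functions A" and c: "c \<in> A" and d: "d \<in> A"
    and p: "p \<in> chart_dom c \<inter> chart_dom d"
  shows "chart_grad_inner c f h p = chart_grad_inner d f h p"
proof -
  define J where "J = jacobian (transition c d) (at (chart_map c p))"
  have pc: "p \<in> chart_dom c" and pd: "p \<in> chart_dom d" using p by auto
  have G: "g c p = transpose J ** g d p ** J" unfolding J_def by (rule metric_trans[OF c d p])
  have ker: "v = 0" if "J *v v = 0" for v
  proof -
    have "g c p *v v = 0" unfolding G by (simp add: matrix_vector_mul_assoc[symmetric] that)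
    then show ?thesis by (rule metric_inj[OF c pc])
  qed
  have kerT: "v = 0" if "transpose J *v v = 0" for v
  proof -
    have "invertible J" using ker by (simp add: invertible_left_inverse matrix_left_invertible_ker)
    then have "invertible (transpose J)" by (rule transpose_invertible)
    then show ?thesis using that by (simp add: invertible_left_inverse matrix_left_invertible_ker)
  qed
  have cf: "coord_partials c f p = transpose J *v coord_partials d f p"
    and ch: "coord_partials c h p = transpose J *v coord_partials d h p"
    unfolding J_def by (rule coord_partials_transition[OF _ c d p], fact)+
  define a where "a = matrix_inv (g c p) *v coord_partials c f p"
  have "transpose J *v (g d p *v (J *v a)) = transpose J *v coord_partials d f p"
    using metric_inv(1)[OF c pc, of "coord_partials c f p"]
    unfolding a_def[symmetric] cf[symmetric] by (simp add: G matrix_vector_mul_assoc[symmetric])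
  then have "g d p *v (J *v a) = coord_partials d f p"
    using kerT[of "g d p *v (J *v a) - coord_partials d f p"] by (simp add: matrix_vector_mult_diff_distrib)
  then have Ja: "J *v a = matrix_inv (g d p) *v coord_partials d f p"
    using metric_inv(2)[OF d pd, of "J *v a"] by simp
  have "chart_grad_inner c f h p = a \<bullet> (transpose J *v coord_partials d h p)"
    by (simp add: chart_grad_inner_def a_def ch)
  also have "\<dots> = (J *v a) \<bullet> coord_partials d h p"
    by (metis inner_commute inner_transpose_mult)
  finally show ?thesis by (simp add: Ja chart_grad_inner_def)
qed

lemma grad_inner_chart:
  assumes f: "f \<in> smooth_functions A" and h: "h \<in> smooth_functions A" and c: "c \<in> A" and p: "p \<in> chart_dom c"
  shows "grad_inner A g f h p = chart_grad_inner c f h p"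
proof -
  define d where "d = (SOME c. c \<in> A \<and> p \<in> chart_dom c)"
  have d: "d \<in> A \<and> p \<in> chart_dom d" unfolding d_def by (rule someI[of _ c]) (use c p in auto)
  have "grad_inner A g f h p = chart_grad_inner d f h p"
    unfolding grad_inner_def Let_def d_def[symmetric] using d chart_grad_inner_eq by blast
  also have "\<dots> = chart_grad_inner c f h p" using d c p by (intro chart_grad_inner_transition f h) auto
  finally show ?thesis .
qed

lemma coord_partials_add:
  assumes "f \<in> smooth_functions A" "h \<in> smooth_functions A" "c \<in> A" "p \<in> chart_dom c"
  shows "coord_partials c (\<lambda>x. f x + h x) p = coord_partials c f p + coord_partials c h p"
proof -
  have "((f \<circ> chart_inv c) has_derivative frechet_derivative (f \<circ> chart_inv c) (at (chart_map c p))) (at (chart_map c p))"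
    "((h \<circ> chart_inv c) has_derivative frechet_derivative (h \<circ> chart_inv c) (at (chart_map c p))) (at (chart_map c p))"
    using smooth_differentiable assms frechet_derivative_works by blast+
  from frechet_derivative_at[OF has_derivative_add[OF this]]
  show ?thesis by (simp add: coord_partials_def vec_eq_iff o_def) (metis (no_types, lifting))
qed

lemma coord_partials_scale:
  assumes "f \<in> smooth_functions A" "c \<in> A" "p \<in> chart_dom c"
  shows "coord_partials c (\<lambda>x. k * f x) p = k *\<^sub>R coord_partials c f p"
proof -
  have "((f \<circ> chart_inv c) has_derivative frechet_derivative (f \<circ> chart_inv c) (at (chart_map c p))) (at (chart_map c p))"
    using smooth_differentiable assms frechet_derivative_works by blast
  from frechet_derivative_at[OF has_derivative_mult_right[OF this, of k]]
  show ?thesis by (simp add: coord_partials_def vec_eq_iff o_def) (metis (no_types, lifting))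
qed

lemma grad_inner_add:
  assumes "f \<in> smooth_functions A" "f' \<in> smooth_functions A" "h \<in> smooth_functions A" "p \<in> M"
  shows "grad_inner A g (\<lambda>x. f x + f' x) h p = grad_inner A g f h p + grad_inner A g f' h p"
proof -
  obtain c where c: "c \<in> A" "p \<in> chart_dom c" using chart_ex assms by blast
  show ?thesis using assms c
    by (simp add: grad_inner_chart[OF _ _ c] smooth_add chart_grad_inner_def coord_partials_add
        matrix_vector_right_distrib inner_add_left)
qed

lemma grad_inner_scale:
  assumes "f \<in> smooth_functions A" "h \<in> smooth_functions A" "p \<in> M"
  shows "grad_inner A g (\<lambda>x. k * f x) h p = k * grad_inner A g f h p"
proof -
  obtain c where c: "c \<in> A" "p \<in> chart_dom c" using chart_ex assms by blast
  show ?thesis using assms c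
    by (simp add: grad_inner_chart[OF _ _ c] smooth_scale chart_grad_inner_def coord_partials_scale
        matrix_vector_mult_scaleR)
qed

lemma grad_inner_sym:
  assumes "f \<in> smooth_functions A" "h \<in> smooth_functions A" "p \<in> M"
  shows "grad_inner A g f h p = grad_inner A g h f p"
proof -
  obtain c where c: "c \<in> A" "p \<in> chart_dom c" using chart_ex assms by blast
  have "grad g c f p \<bullet> (g c p *v grad g c h p) = grad g c h p \<bullet> (g c p *v grad g c f p)"
    using inner_transpose_mult[of "g c p" "grad g c f p" "grad g c h p"] metric_sym[OF c]
    by (simp add: inner_commute)
  then show ?thesis using assms by (simp add: grad_inner_chart[OF _ _ c] chart_grad_inner_eq[OF c])
qed

lemma grad_inner_nonneg:
  assumes "f \<in> smooth_functions A" "p \<in> M"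
  shows "grad_inner A g f f p \<ge> 0"
proof -
  obtain c where c: "c \<in> A" "p \<in> chart_dom c" using chart_ex assms by blast
  have "grad g c f p \<bullet> (g c p *v grad g c f p) \<ge> 0"
    using metric_pos[OF c, of "grad g c f p"] by (cases "grad g c f p = 0") auto
  then show ?thesis using assms by (simp add: grad_inner_chart[OF _ _ c] chart_grad_inner_eq[OF c])
qed

lemma coord_partials_cont:
  assumes f: "f \<in> smooth_functions A" and c: "c \<in> A"
  shows "continuous_on (chart_img c) (\<lambda>x. coord_partials c f (chart_inv c x))"
proof -
  have "smooth_on (chart_img c) (f \<circ> chart_inv c)" using f c by (auto simp: smooth_functions_def)
  then have "continuous_on (chart_img c)
      (\<lambda>x. \<chi> i. frechet_derivative (f \<circ> chart_inv c) (at x) (axis i 1))"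
    by (intro continuous_on_vec_lambda smooth_on_continuous_derivative)
  then show ?thesis
    by (rule continuous_on_eq) (simp add: coord_partials_def map_inv c)
qed

lemma chart_grad_inner_cont:
  assumes "f \<in> smooth_functions A" "h \<in> smooth_functions A" "c \<in> A"
  shows "continuous_on (chart_img c) (\<lambda>x. chart_grad_inner c f h (chart_inv c x))"
  unfolding chart_grad_inner_def
  by (intro continuous_on_inner continuous_on_matrix_inv_mult coord_partials_cont metric_cont assms)
    (rule metric_inj[OF assms(3) inv_dom[OF assms(3)]])

lemma grad_inner_cont:
  assumes f: "f \<in> smooth_functions A" "h \<in> smooth_functions A"
  shows "continuous_on M (grad_inner A g f h)"
proof (rule continuous_on_locally)
  fix p assume "p \<in> M"
  then obtain c where c: "c \<in> A" "p \<in> chart_dom c" using chart_ex by blast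
  have "continuous_on (chart_dom c) ((\<lambda>x. chart_grad_inner c f h (chart_inv c x)) \<circ> chart_map c)"
    using chart_grad_inner_cont[OF f c(1)] unfolding chart_img_def
    by (rule continuous_on_compose[OF map_cont[OF c(1)]])
  then have "continuous_on (chart_dom c) (grad_inner A g f h)"
    by (rule continuous_on_eq) (use inv_map c f in \<open>auto simp: grad_inner_chart\<close>)
  then show "\<exists>U. openin (top_of_set M) U \<and> p \<in> U \<and> continuous_on U (grad_inner A g f h)"
    using c dom_open by blast
qed

end

section \<open>The Poincare inequality on convex sets\<close>

lemma nn_integral_lborel_affine:
  fixes F :: "'a::euclidean_space \<Rightarrow> ennreal"
  assumes [measurable]: "F \<in> borel_measurable borel" and t: "t \<noteq> 0"
  shows "ennreal (\<bar>t\<bar> ^ DIM('a)) * (\<integral>\<^sup>+x. F (a + t *\<^sub>R x) \<partial>lborel) = (\<integral>\<^sup>+x. F x \<partial>lborel)"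
proof -
  have "(\<integral>\<^sup>+x. F x \<partial>lborel) =
      (\<integral>\<^sup>+x. F x \<partial>(density (distr lborel borel (\<lambda>x. a + t *\<^sub>R x)) (\<lambda>_. ennreal (\<bar>t\<bar> ^ DIM('a)))))"
    using lborel_affine[OF t, of a] by simp
  also have "\<dots> = ennreal (\<bar>t\<bar> ^ DIM('a)) * (\<integral>\<^sup>+x. F (a + t *\<^sub>R x) \<partial>lborel)"
    by (simp add: nn_integral_density nn_integral_distr nn_integral_cmult)
  finally show ?thesis by simp
qed

lemma nn_integral_lborel_affine_le:
  fixes F :: "'a::euclidean_space \<Rightarrow> ennreal"
  assumes [measurable]: "F \<in> borel_measurable borel" and t: "t \<ge> 1 / 2"
  shows "(\<integral>\<^sup>+x. F (a + t *\<^sub>R x) \<partial>lborel) \<le> 2 ^ DIM('a) * (\<integral>\<^sup>+x. F x \<partial>lborel)"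
proof -
  have "1 \<le> (2 * t) ^ DIM('a)" using t by (intro one_le_power) auto
  then have "(1::ennreal) \<le> ennreal ((2 * t) ^ DIM('a))" by simp
  then have "1 * (\<integral>\<^sup>+x. F (a + t *\<^sub>R x) \<partial>lborel) \<le>
      ennreal ((2 * t) ^ DIM('a)) * (\<integral>\<^sup>+x. F (a + t *\<^sub>R x) \<partial>lborel)"
    by (rule mult_right_mono) simp
  also have "ennreal ((2 * t) ^ DIM('a)) = 2 ^ DIM('a) * ennreal (\<bar>t\<bar> ^ DIM('a))"
    using t by (simp add: power_mult_distrib ennreal_mult'' ennreal_power[symmetric] flip: ennreal_numeral)
  also have "2 ^ DIM('a) * ennreal (\<bar>t\<bar> ^ DIM('a)) * (\<integral>\<^sup>+x. F (a + t *\<^sub>R x) \<partial>lborel) =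
      2 ^ DIM('a) * (\<integral>\<^sup>+x. F x \<partial>lborel)"
    using nn_integral_lborel_affine[of F t a] t by (simp add: mult.assoc)
  finally show ?thesis by simp
qed

text \<open>
  Substitute \<open>z = y + t (x - y)\<close> for \<open>x\<close> if \<open>t \<ge> 1 / 2\<close> and for \<open>y\<close> if \<open>t \<le> 1 / 2\<close>: the Jacobian is then at
  least \<open>(1 / 2) ^ DIM('a)\<close>.  For \<open>x\<close> alone the factor \<open>t powr (- DIM('a))\<close> would not be
  integrable at \<open>t = 0\<close>.
\<close>

lemma nn_integral_segments_le:
  fixes F :: "'a::euclidean_space \<Rightarrow> ennreal"
  assumes F[measurable]: "F \<in> borel_measurable borel" and Q[measurable]: "Q \<in> sets borel"
  shows "(\<integral>\<^sup>+x. \<integral>\<^sup>+y. indicator Q x * indicator Q y *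
      (\<integral>\<^sup>+t. indicator {0..1} t * F (y + t *\<^sub>R (x - y)) \<partial>lborel) \<partial>lborel \<partial>lborel)
    \<le> 2 ^ DIM('a) * emeasure lborel Q * (\<integral>\<^sup>+z. F z \<partial>lborel)" (is "?L \<le> ?R")
proof -
  let ?f = "\<lambda>(x::'a) y (t::real). indicator Q x * indicator Q y * (indicator {0..1} t * F (y + t *\<^sub>R (x - y)))"
  have bd: "(\<integral>\<^sup>+x. \<integral>\<^sup>+y. ?f x y t \<partial>lborel \<partial>lborel) \<le> ?R * indicator {0..1} t" for t
  proof (cases "t \<in> {0..1}")
    case False
    then show ?thesis by simp
  next
    case True
    show ?thesis
    proof (cases "t \<ge> 1 / 2")
      case t: True
      have "(\<integral>\<^sup>+x. \<integral>\<^sup>+y. ?f x y t \<partial>lborel \<partial>lborel) = (\<integral>\<^sup>+y. \<integral>\<^sup>+x. ?f x y t \<partial>lborel \<partial>lborel)"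
        by (rule lborel_pair.Fubini') measurable
      also have "\<dots> \<le> (\<integral>\<^sup>+y. indicator Q y * (2 ^ DIM('a) * (\<integral>\<^sup>+z. F z \<partial>lborel)) \<partial>lborel)"
      proof (rule nn_integral_mono)
        fix y :: 'a
        have "(\<integral>\<^sup>+x. ?f x y t \<partial>lborel) \<le> (\<integral>\<^sup>+x. indicator Q y * F ((1 - t) *\<^sub>R y + t *\<^sub>R x) \<partial>lborel)"
          by (rule nn_integral_mono) (auto simp: indicator_def algebra_simps)
        also have "\<dots> = indicator Q y * (\<integral>\<^sup>+x. F ((1 - t) *\<^sub>R y + t *\<^sub>R x) \<partial>lborel)"
          by (rule nn_integral_cmult) measurable
        also have "\<dots> \<le> indicator Q y * (2 ^ DIM('a) * (\<integral>\<^sup>+z. F z \<partial>lborel))"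
          using t by (intro mult_left_mono nn_integral_lborel_affine_le) auto
        finally show "(\<integral>\<^sup>+x. ?f x y t \<partial>lborel) \<le> indicator Q y * (2 ^ DIM('a) * (\<integral>\<^sup>+z. F z \<partial>lborel))" .
      qed
      also have "\<dots> = ?R" by (subst nn_integral_multc) (auto simp: mult_ac)
      finally show ?thesis using True by simp
    next
      case False
      then have t: "1 - t \<ge> 1 / 2" by simp
      have "(\<integral>\<^sup>+x. \<integral>\<^sup>+y. ?f x y t \<partial>lborel \<partial>lborel)
          \<le> (\<integral>\<^sup>+x. indicator Q x * (2 ^ DIM('a) * (\<integral>\<^sup>+z. F z \<partial>lborel)) \<partial>lborel)"
      proof (rule nn_integral_mono)
        fix x :: 'a
        have "(\<integral>\<^sup>+y. ?f x y t \<partial>lborel) \<le> (\<integral>\<^sup>+y. indicator Q x * F (t *\<^sub>R x + (1 - t) *\<^sub>R y) \<partial>lborel)"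
          by (rule nn_integral_mono) (auto simp: indicator_def algebra_simps)
        also have "\<dots> = indicator Q x * (\<integral>\<^sup>+y. F (t *\<^sub>R x + (1 - t) *\<^sub>R y) \<partial>lborel)"
          by (rule nn_integral_cmult) measurable
        also have "\<dots> \<le> indicator Q x * (2 ^ DIM('a) * (\<integral>\<^sup>+z. F z \<partial>lborel))"
          using t by (intro mult_left_mono nn_integral_lborel_affine_le) auto
        finally show "(\<integral>\<^sup>+y. ?f x y t \<partial>lborel) \<le> indicator Q x * (2 ^ DIM('a) * (\<integral>\<^sup>+z. F z \<partial>lborel))" .
      qed
      also have "\<dots> = ?R" by (subst nn_integral_multc) (auto simp: mult_ac)
      finally show ?thesis using True by simp
    qed
  qed
  have "?L = (\<integral>\<^sup>+x. \<integral>\<^sup>+y. \<integral>\<^sup>+t. ?f x y t \<partial>lborel \<partial>lborel \<partial>lborel)"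
    by (intro nn_integral_cong) (subst nn_integral_cmult, auto)
  also have "\<dots> = (\<integral>\<^sup>+x. \<integral>\<^sup>+t. \<integral>\<^sup>+y. ?f x y t \<partial>lborel \<partial>lborel \<partial>lborel)"
    by (intro nn_integral_cong lborel_pair.Fubini') measurable
  also have "\<dots> = (\<integral>\<^sup>+t. \<integral>\<^sup>+x. \<integral>\<^sup>+y. ?f x y t \<partial>lborel \<partial>lborel \<partial>lborel)"
    by (intro lborel_pair.Fubini') measurable
  also have "\<dots> \<le> (\<integral>\<^sup>+t. ?R * indicator {0..1::real} t \<partial>lborel)"
    by (intro nn_integral_mono bd)
  also have "\<dots> = ?R" by (subst nn_integral_cmult) auto
  finally show ?thesis .
qed

text \<open>
  The fundamental theorem of calculus on the segment from \<open>y\<close> to \<open>x\<close>, and the Cauchy--Schwarz inequality.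
\<close>

lemma segment_energy:
  fixes u :: "'a::euclidean_space \<Rightarrow> real" and G :: "'a \<Rightarrow> 'a"
  assumes convex: "convex Q" and G: "continuous_on Q G"
    and deriv: "\<And>x. x \<in> Q \<Longrightarrow> (u has_derivative (\<lambda>v. G x \<bullet> v)) (at x)"
    and x: "x \<in> Q" and y: "y \<in> Q" and \<delta>: "norm (x - y) \<le> \<delta>"
  shows "ennreal ((u x - u y)\<^sup>2) \<le> ennreal (\<delta>\<^sup>2) *
    (\<integral>\<^sup>+t. indicator {0..1} t * ennreal ((norm (G (y + t *\<^sub>R (x - y))))\<^sup>2) \<partial>lborel)"
proof -
  define q where "q t = y + t *\<^sub>R (x - y)" for t
  define f where "f t = G (q t) \<bullet> (x - y)" for t
  have qQ: "q t \<in> Q" if "t \<in> {0..1}" for t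
    using convexD_alt[OF convex y x, of t] that by (simp add: q_def algebra_simps)
  have qc: "continuous_on {0..1} q" unfolding q_def by (intro continuous_intros)
  have Gc: "continuous_on {0..1} (\<lambda>t. G (q t))"
    by (rule continuous_on_compose2[OF G qc]) (use qQ in auto)
  have fc: "continuous_on {0..1} f" unfolding f_def by (intro continuous_intros Gc)
  have "((\<lambda>t. u (q t)) has_vector_derivative f t) (at t within {0..1})" if t: "t \<in> {0..1}" for t
  proof -
    have qd: "(q has_derivative (\<lambda>h. h *\<^sub>R (x - y))) (at t)"
      unfolding q_def by (auto intro!: derivative_eq_intros)
    have "((u \<circ> q) has_derivative ((\<lambda>v. G (q t) \<bullet> v) \<circ> (\<lambda>h. h *\<^sub>R (x - y)))) (at t)"
      by (rule diff_chain_at[OF qd deriv[OF qQ[OF t]]])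
    then show ?thesis
      by (auto simp: has_vector_derivative_def o_def f_def intro: has_derivative_at_withinI)
  qed
  then have FTC: "(\<integral>t. indicator {0..1} t *\<^sub>R f t \<partial>lborel) = u (q 1) - u (q 0)"
    by (intro integral_FTC_Icc[of 0 1 "\<lambda>t. u (q t)" f] fc) auto
  define m where "m = u x - u y"
  have m: "(\<integral>t. indicator {0..1} t *\<^sub>R f t \<partial>lborel) = m" using FTC by (simp add: q_def m_def)
  have i1: "integrable lborel (\<lambda>t. indicator {0..1} t *\<^sub>R f t)"
    and i2: "integrable lborel (\<lambda>t. indicator {0..1} t *\<^sub>R (f t)\<^sup>2)"
    and i3: "integrable lborel (\<lambda>t. indicator {0..1} t *\<^sub>R (\<delta>\<^sup>2 * (norm (G (q t)))\<^sup>2))"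
    by (intro borel_integrable_compact continuous_intros fc Gc compact_Icc)+
  have i0: "integrable lborel (\<lambda>t. indicator {0..1::real} t *\<^sub>R m\<^sup>2)"
    by (intro borel_integrable_compact continuous_intros compact_Icc)
  have "0 \<le> (\<integral>t. indicator {0..1} t *\<^sub>R (f t)\<^sup>2 - 2 * m * (indicator {0..1} t *\<^sub>R f t) + indicator {0..1} t *\<^sub>R m\<^sup>2 \<partial>lborel)"
  proof (rule Bochner_Integration.integral_nonneg)
    fix t :: real
    have "(f t)\<^sup>2 - 2 * m * f t + m\<^sup>2 = (f t - m)\<^sup>2" by (simp add: power2_eq_square algebra_simps)
    then have "0 \<le> (f t)\<^sup>2 - 2 * m * f t + m\<^sup>2" by simp
    then show "0 \<le> indicator {0..1} t *\<^sub>R (f t)\<^sup>2 - 2 * m * (indicator {0..1} t *\<^sub>R f t) + indicator {0..1} t *\<^sub>R m\<^sup>2"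
      by (auto simp: indicator_def)
  qed
  also have "\<dots> = (\<integral>t. indicator {0..1} t *\<^sub>R (f t)\<^sup>2 \<partial>lborel) - 2 * m * m + m\<^sup>2"
    using i0 i1 i2 m by simp
  finally have "m\<^sup>2 \<le> (\<integral>t. indicator {0..1} t *\<^sub>R (f t)\<^sup>2 \<partial>lborel)" by (simp add: power2_eq_square)
  also have "\<dots> \<le> (\<integral>t. indicator {0..1} t *\<^sub>R (\<delta>\<^sup>2 * (norm (G (q t)))\<^sup>2) \<partial>lborel)"
  proof (intro integral_mono i2 i3)
    fix t
    have "\<bar>f t\<bar> \<le> norm (G (q t)) * norm (x - y)" unfolding f_def by (rule Cauchy_Schwarz_ineq2)
    also have "\<dots> \<le> norm (G (q t)) * \<delta>" using \<delta> by (intro mult_left_mono) auto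
    finally have "\<bar>f t\<bar>\<^sup>2 \<le> (norm (G (q t)) * \<delta>)\<^sup>2" by (intro power_mono) auto
    then show "indicator {0..1} t *\<^sub>R (f t)\<^sup>2 \<le> indicator {0..1} t *\<^sub>R (\<delta>\<^sup>2 * (norm (G (q t)))\<^sup>2)"
      by (auto simp: indicator_def power_mult_distrib mult.commute)
  qed
  finally have "ennreal (m\<^sup>2) \<le> ennreal (\<integral>t. indicator {0..1} t *\<^sub>R (\<delta>\<^sup>2 * (norm (G (q t)))\<^sup>2) \<partial>lborel)"
    by (rule ennreal_leI)
  also have "\<dots> = (\<integral>\<^sup>+t. ennreal (indicator {0..1} t *\<^sub>R (\<delta>\<^sup>2 * (norm (G (q t)))\<^sup>2)) \<partial>lborel)"
    by (rule nn_integral_eq_integral[symmetric]) (use i3 in auto)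
  also have "\<dots> = (\<integral>\<^sup>+t. ennreal (\<delta>\<^sup>2) * ennreal (indicator {0..1} t * (norm (G (q t)))\<^sup>2) \<partial>lborel)"
    by (intro nn_integral_cong) (auto simp: indicator_def ennreal_mult)
  also have "\<dots> = ennreal (\<delta>\<^sup>2) * (\<integral>\<^sup>+t. ennreal (indicator {0..1} t * (norm (G (q t)))\<^sup>2) \<partial>lborel)"
  proof (rule nn_integral_cmult)
    have "(\<lambda>t. indicator {0..1} t *\<^sub>R ((norm (G (q t)))\<^sup>2)) \<in> borel_measurable borel"
      by (intro borel_measurable_continuous_on_indicator continuous_intros Gc) auto
    then show "(\<lambda>t. ennreal (indicator {0..1} t * (norm (G (q t)))\<^sup>2)) \<in> borel_measurable lborel" by simp
  qed
  also have "(\<integral>\<^sup>+t. ennreal (indicator {0..1} t * (norm (G (q t)))\<^sup>2) \<partial>lborel) =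
      (\<integral>\<^sup>+t. indicator {0..1} t * ennreal ((norm (G (q t)))\<^sup>2) \<partial>lborel)"
    by (intro nn_integral_cong) (auto simp: indicator_def)
  finally show ?thesis by (simp add: m_def q_def)
qed

text \<open>
  The double integral of \<open>(u x - u y)\<^sup>2\<close> over \<open>Q\<close> equals \<open>2 * (q * s - m\<^sup>2)\<close>, where \<open>q\<close> is the measure of
  \<open>Q\<close> and \<open>m\<close>, \<open>s\<close> are the integrals of \<open>u\<close>, \<open>u\<^sup>2\<close>.  On the other hand \<open>u x - u y\<close> is an integral of the
  gradient over a segment in \<open>Q\<close>.
\<close>

theorem poincare_inequality_convex:
  fixes u :: "'a::euclidean_space \<Rightarrow> real" and G :: "'a \<Rightarrow> 'a"
  assumes Q[measurable]: "Q \<in> sets borel" and convex: "convex Q" and K: "compact K" "Q \<subseteq> K"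
    and u: "continuous_on K u" and G: "continuous_on K G"
    and deriv: "\<And>x. x \<in> Q \<Longrightarrow> (u has_derivative (\<lambda>v. G x \<bullet> v)) (at x)"
    and \<delta>: "\<And>x y. x \<in> Q \<Longrightarrow> y \<in> Q \<Longrightarrow> norm (x - y) \<le> \<delta>"
  shows "(LINT x|lborel. indicator Q x * (u x)\<^sup>2) \<le>
    (LINT x|lborel. indicator Q x * u x)\<^sup>2 / measure lborel Q +
    2 ^ DIM('a) * \<delta>\<^sup>2 * (LINT x|lborel. indicator Q x * (norm (G x))\<^sup>2)"
proof -
  have int: "integrable lborel (\<lambda>x. indicator Q x * h x)" if h: "continuous_on K h" for h :: "'a \<Rightarrow> real"
  proof -
    have "integrable lborel (\<lambda>x. indicator K x *\<^sub>R h x)" using K h by (intro borel_integrable_compact)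
    then have "integrable lborel (\<lambda>x. indicator Q x *\<^sub>R (indicator K x *\<^sub>R h x))"
      by (rule integrable_mult_indicator[rotated]) simp
    moreover have "(\<lambda>x. indicator Q x *\<^sub>R (indicator K x *\<^sub>R h x)) = (\<lambda>x. indicator Q x * h x)"
      using K by (auto simp: indicator_def fun_eq_iff)
    ultimately show ?thesis by simp
  qed
  define \<Phi> where "\<Phi> = (LINT x|lborel. indicator Q x * (norm (G x))\<^sup>2)"
  define s where "s = (LINT x|lborel. indicator Q x * (u x)\<^sup>2)"
  define m where "m = (LINT x|lborel. indicator Q x * u x)"
  define q where "q = measure lborel Q"
  have iu: "integrable lborel (\<lambda>x. indicator Q x * u x)" and iu2: "integrable lborel (\<lambda>x. indicator Q x * (u x)\<^sup>2)"
    and iG: "integrable lborel (\<lambda>x. indicator Q x * (norm (G x))\<^sup>2)"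
    by (intro int continuous_intros u G)+
  have i1: "integrable lborel (\<lambda>x. indicator Q x :: real)" using int[of "\<lambda>_. 1"] by simp
  have fin: "emeasure lborel Q < \<infinity>"
    using K emeasure_mono[OF K(2), of lborel] emeasure_bounded_finite[OF compact_imp_bounded[OF K(1)]]
    by (auto simp: compact_imp_closed)
  then have emQ: "emeasure lborel Q = ennreal q" by (simp add: q_def emeasure_eq_ennreal_measure)
  have q1: "(LINT x|lborel. indicator Q x :: real) = q" by (simp add: q_def)
  have q0: "q \<ge> 0" by (simp add: q_def)
  have \<Phi>0: "\<Phi> \<ge> 0" unfolding \<Phi>_def by (intro Bochner_Integration.integral_nonneg) auto
  have s0: "s \<ge> 0" unfolding s_def by (intro Bochner_Integration.integral_nonneg) auto
  have ex: "(LINT y|lborel. a * indicator Q y - b * (indicator Q y * u y) + indicator Q y * (u y)\<^sup>2) =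
      a * q - b * m + s" for a b
    using iu iu2 i1 q1 by (simp add: s_def m_def)
  define D where "D x = indicator Q x * (q * (u x)\<^sup>2 - 2 * m * u x + s)" for x
  have inner: "(\<integral>\<^sup>+y. indicator Q x * indicator Q y * ennreal ((u x - u y)\<^sup>2) \<partial>lborel) = ennreal (D x)" for x
  proof -
    have eq: "indicator Q x * (indicator Q y * (u x - u y)\<^sup>2) =
        indicator Q x * ((u x)\<^sup>2 * indicator Q y - 2 * u x * (indicator Q y * u y) + indicator Q y * (u y)\<^sup>2)" for y
      by (auto simp: indicator_def power2_eq_square algebra_simps)
    have i: "integrable lborel (\<lambda>y. indicator Q x * (indicator Q y * (u x - u y)\<^sup>2))"
      unfolding eq using iu iu2 i1 by (intro integrable_mult_right Bochner_Integration.integrable_add Bochner_Integration.integrable_diff) auto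
    have "(\<integral>\<^sup>+y. indicator Q x * indicator Q y * ennreal ((u x - u y)\<^sup>2) \<partial>lborel) =
        (\<integral>\<^sup>+y. ennreal (indicator Q x * (indicator Q y * (u x - u y)\<^sup>2)) \<partial>lborel)"
      by (intro nn_integral_cong) (auto simp: indicator_def)
    also have "\<dots> = ennreal (\<integral>y. indicator Q x * (indicator Q y * (u x - u y)\<^sup>2) \<partial>lborel)"
      by (rule nn_integral_eq_integral[OF i]) auto
    also have "(\<integral>y. indicator Q x * (indicator Q y * (u x - u y)\<^sup>2) \<partial>lborel) = D x"
      by (simp only: eq integral_mult_right_zero ex) (simp add: D_def mult.commute)
    finally show ?thesis .
  qed
  have eqD: "D x = q * (indicator Q x * (u x)\<^sup>2) - 2 * m * (indicator Q x * u x) + s * indicator Q x" for x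
    by (simp add: D_def algebra_simps)
  have iD: "integrable lborel D"
    unfolding eqD using iu iu2 i1
    by (intro integrable_mult_right Bochner_Integration.integrable_add Bochner_Integration.integrable_diff) auto
  have D0: "D x \<ge> 0" for x
  proof (cases "x \<in> Q")
    case True
    have "D x = (\<integral>y. indicator Q y * (u x - u y)\<^sup>2 \<partial>lborel)"
    proof -
      have eq: "indicator Q y * (u x - u y)\<^sup>2 =
        (u x)\<^sup>2 * indicator Q y - 2 * u x * (indicator Q y * u y) + indicator Q y * (u y)\<^sup>2" for y
        by (auto simp: indicator_def power2_eq_square algebra_simps)
      show ?thesis using True by (simp only: eq ex) (simp add: D_def mult.commute)
    qed
    also have "\<dots> \<ge> 0" by (intro Bochner_Integration.integral_nonneg) auto
    finally show ?thesis .
  qed (simp add: D_def)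
  have "integral\<^sup>L lborel D = q * s - 2 * m * m + s * q"
    unfolding eqD using iu iu2 i1 q1 by (simp add: s_def[symmetric] m_def[symmetric])
  then have ID: "integral\<^sup>L lborel D = 2 * (q * s - m\<^sup>2)" by (simp add: power2_eq_square)
  define F where "F z = ennreal (indicator Q z * (norm (G z))\<^sup>2)" for z
  have Fm[measurable]: "F \<in> borel_measurable borel"
    unfolding F_def using borel_measurable_integrable[OF iG] by simp
  have IF: "(\<integral>\<^sup>+z. F z \<partial>lborel) = ennreal \<Phi>"
    unfolding F_def \<Phi>_def by (rule nn_integral_eq_integral[OF iG]) auto
  have "ennreal (integral\<^sup>L lborel D) = (\<integral>\<^sup>+x. ennreal (D x) \<partial>lborel)"
    by (rule nn_integral_eq_integral[symmetric, OF iD]) (use D0 in auto)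
  also have "\<dots> = (\<integral>\<^sup>+x. \<integral>\<^sup>+y. indicator Q x * indicator Q y * ennreal ((u x - u y)\<^sup>2) \<partial>lborel \<partial>lborel)"
    by (simp only: inner)
  also have "\<dots> \<le> (\<integral>\<^sup>+x. \<integral>\<^sup>+y. ennreal (\<delta>\<^sup>2) * (indicator Q x * indicator Q y *
      (\<integral>\<^sup>+t. indicator {0..1} t * F (y + t *\<^sub>R (x - y)) \<partial>lborel)) \<partial>lborel \<partial>lborel)"
  proof (intro nn_integral_mono)
    fix x y
    show "indicator Q x * indicator Q y * ennreal ((u x - u y)\<^sup>2) \<le> ennreal (\<delta>\<^sup>2) * (indicator Q x * indicator Q y *
      (\<integral>\<^sup>+t. indicator {0..1} t * F (y + t *\<^sub>R (x - y)) \<partial>lborel))"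
    proof (cases "x \<in> Q \<and> y \<in> Q")
      case True
      then have xy: "x \<in> Q" "y \<in> Q" by auto
      have "ennreal ((u x - u y)\<^sup>2) \<le> ennreal (\<delta>\<^sup>2) *
          (\<integral>\<^sup>+t. indicator {0..1} t * ennreal ((norm (G (y + t *\<^sub>R (x - y))))\<^sup>2) \<partial>lborel)"
        using continuous_on_subset[OF G K(2)] deriv \<delta> xy by (intro segment_energy[OF convex]) auto
      also have "(\<integral>\<^sup>+t. indicator {0..1} t * ennreal ((norm (G (y + t *\<^sub>R (x - y))))\<^sup>2) \<partial>lborel) =
          (\<integral>\<^sup>+t. indicator {0..1} t * F (y + t *\<^sub>R (x - y)) \<partial>lborel)"
      proof (rule nn_integral_cong)
        fix t :: real
        have "y + t *\<^sub>R (x - y) \<in> Q" if "t \<in> {0..1}"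
          using convexD_alt[OF convex xy(2) xy(1), of t] that by (simp add: algebra_simps)
        then show "indicator {0..1} t * ennreal ((norm (G (y + t *\<^sub>R (x - y))))\<^sup>2) =
            indicator {0..1} t * F (y + t *\<^sub>R (x - y))"
          by (auto simp: F_def indicator_def)
      qed
      finally show ?thesis using xy by simp
    qed auto
  qed
  also have "\<dots> = ennreal (\<delta>\<^sup>2) * (\<integral>\<^sup>+x. \<integral>\<^sup>+y. (indicator Q x * indicator Q y *
      (\<integral>\<^sup>+t. indicator {0..1} t * F (y + t *\<^sub>R (x - y)) \<partial>lborel)) \<partial>lborel \<partial>lborel)"
    by (simp add: nn_integral_cmult)
  also have "\<dots> \<le> ennreal (\<delta>\<^sup>2) * (2 ^ DIM('a) * emeasure lborel Q * (\<integral>\<^sup>+z. F z \<partial>lborel))"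
    by (intro mult_left_mono nn_integral_segments_le) auto
  also have "\<dots> = ennreal (\<delta>\<^sup>2 * (2 ^ DIM('a) * q * \<Phi>))"
    unfolding IF emQ using q0 \<Phi>0
    by (simp add: ennreal_mult ennreal_power[symmetric] flip: ennreal_numeral)
  finally have main: "2 * (q * s - m\<^sup>2) \<le> \<delta>\<^sup>2 * (2 ^ DIM('a) * q * \<Phi>)"
    unfolding ID using q0 \<Phi>0 by (subst (asm) ennreal_le_iff) auto
  have R: "2 ^ DIM('a) * \<delta>\<^sup>2 * \<Phi> \<ge> 0" using \<Phi>0 by simp
  show ?thesis unfolding s_def[symmetric] m_def[symmetric] q_def[symmetric] \<Phi>_def[symmetric]
  proof (cases "q = 0")
    case True
    then have "emeasure lborel Q = 0" using emQ by simp
    then have ae: "AE x in lborel. x \<notin> Q" by (intro AE_not_in) (auto simp: null_sets_def)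
    have "s = (LINT x::'a|lborel. (0::real))" unfolding s_def
    proof (rule Bochner_Integration.integral_cong_AE)
      show "AE x in lborel. indicator Q x * (u x)\<^sup>2 = 0" using ae by eventually_elim simp
    qed (use borel_measurable_integrable[OF iu2] in auto)
    then show "s \<le> m\<^sup>2 / q + 2 ^ DIM('a) * \<delta>\<^sup>2 * \<Phi>" using True R by simp
  next
    case False
    then have q: "q > 0" using q0 by simp
    define Y where "Y = 2 ^ DIM('a) * \<delta>\<^sup>2 * \<Phi>"
    have "2 * (q * s - m\<^sup>2) \<le> q * Y" using main by (simp add: Y_def mult_ac)
    moreover have "q * Y \<ge> 0" using q R by (simp add: Y_def)
    ultimately have "2 * (q * s - m\<^sup>2) \<le> 2 * (q * Y)" by argo
    then have "q * s - m\<^sup>2 \<le> q * Y" by simp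
    then have "q * s \<le> m\<^sup>2 + q * Y" by (simp add: diff_le_eq add.commute)
    then have "s \<le> (m\<^sup>2 + q * Y) / q" using q by (simp add: pos_le_divide_eq mult.commute)
    also have "\<dots> = m\<^sup>2 / q + Y" using q by (simp add: add_divide_distrib)
    finally show "s \<le> m\<^sup>2 / q + 2 ^ DIM('a) * \<delta>\<^sup>2 * \<Phi>" by (simp add: Y_def)
  qed
qed

text \<open>
  Cut \<open>K\<close> by the half-open cubes of a grid.  Intersections with half-spaces keep the cells convex and
  Borel.
\<close>

lemma convex_cells_exist:
  fixes K :: "'a::euclidean_space set"
  assumes K: "compact K" "convex K" and \<delta>: "\<delta> > 0"
  obtains \<Q> where "finite \<Q>" "disjoint \<Q>" "\<Union>\<Q> = K"
    "\<And>Q. Q \<in> \<Q> \<Longrightarrow> Q \<in> sets borel \<and> convex Q" 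
    "\<And>Q x y. Q \<in> \<Q> \<Longrightarrow> x \<in> Q \<Longrightarrow> y \<in> Q \<Longrightarrow> norm (x - y) \<le> \<delta>"
proof -
  define m where "m = real DIM('a) / \<delta>"
  have m: "m > 0" using \<delta> by (simp add: m_def)
  define key where "key x = (\<lambda>i\<in>Basis. \<lfloor>m * (x \<bullet> i)\<rfloor>)" for x :: 'a
  define cell where "cell k = {x\<in>K. key x = k}" for k
  obtain C where C: "\<And>x. x \<in> K \<Longrightarrow> norm x \<le> C" using compact_imp_bounded[OF K(1)] by (auto simp: bounded_iff)
  have "key x \<in> PiE Basis (\<lambda>_. {\<lfloor>- (m * C)\<rfloor>..\<lfloor>m * C\<rfloor>})" if "x \<in> K" for x
  proof -
    have "\<bar>m * (x \<bullet> i)\<bar> \<le> m * C" if "i \<in> Basis" for i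
      using Basis_le_norm[OF that, of x] C[OF \<open>x \<in> K\<close>] m by (simp add: abs_mult)
    then have "- (m * C) \<le> m * (x \<bullet> i) \<and> m * (x \<bullet> i) \<le> m * C" if "i \<in> Basis" for i
      using that by (fastforce simp: abs_le_iff)
    then show ?thesis by (auto simp: key_def intro!: floor_mono)
  qed
  then have fin: "finite (key ` K)"
    by (intro finite_subset[of "key ` K" "PiE Basis (\<lambda>_. {\<lfloor>- (m * C)\<rfloor>..\<lfloor>m * C\<rfloor>})"] finite_PiE) auto
  have cell_eq: "cell (key z) = K \<inter> (\<Inter>i\<in>Basis. {x. (m *\<^sub>R i) \<bullet> x \<ge> \<lfloor>m * (z \<bullet> i)\<rfloor>} \<inter> {x. (m *\<^sub>R i) \<bullet> x < \<lfloor>m * (z \<bullet> i)\<rfloor> + 1})" for z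
  proof -
    have "key x = key z \<longleftrightarrow> (\<forall>i\<in>Basis. \<lfloor>m * (x \<bullet> i)\<rfloor> = \<lfloor>m * (z \<bullet> i)\<rfloor>)" for x
      by (auto simp: key_def restrict_def fun_eq_iff)
    also have "\<dots> x \<longleftrightarrow> (\<forall>i\<in>Basis. of_int \<lfloor>m * (z \<bullet> i)\<rfloor> \<le> (m *\<^sub>R i) \<bullet> x \<and> (m *\<^sub>R i) \<bullet> x < of_int \<lfloor>m * (z \<bullet> i)\<rfloor> + 1)" for x
      by (simp add: floor_eq_iff inner_commute)
    finally show ?thesis by (auto simp: cell_def)
  qed
  show ?thesis
  proof (rule that[of "cell ` key ` K"])
    show "finite (cell ` key ` K)" using fin by simp
    show "disjoint (cell ` key ` K)" by (auto simp: disjoint_def cell_def)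
    show "\<Union> (cell ` key ` K) = K" by (auto simp: cell_def)
    fix Q assume "Q \<in> cell ` key ` K"
    then obtain z where Q: "Q = cell (key z)" by auto
    have "convex Q" unfolding Q cell_eq
      by (intro convex_Int K convex_INT convex_halfspace_ge convex_halfspace_lt)
    moreover have "Q \<in> sets borel" unfolding Q cell_eq
      by (intro sets.Int sets.finite_INT borel_compact[OF K(1)] closed_halfspace_ge[THEN borel_closed]
          open_halfspace_lt[THEN borel_open] finite_Basis nonempty_Basis)
    ultimately show "Q \<in> sets borel \<and> convex Q" by simp
    fix x y assume xy: "x \<in> Q" "y \<in> Q"
    have "\<bar>(x - y) \<bullet> i\<bar> \<le> 1 / m" if i: "i \<in> Basis" for i
    proof -
      have "of_int \<lfloor>m * (z \<bullet> i)\<rfloor> \<le> m * (i \<bullet> x)" "m * (i \<bullet> x) < of_int \<lfloor>m * (z \<bullet> i)\<rfloor> + 1"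
        "of_int \<lfloor>m * (z \<bullet> i)\<rfloor> \<le> m * (i \<bullet> y)" "m * (i \<bullet> y) < of_int \<lfloor>m * (z \<bullet> i)\<rfloor> + 1"
        using xy i unfolding Q cell_eq by auto
      then have "\<bar>m * (i \<bullet> x) - m * (i \<bullet> y)\<bar> \<le> 1" by linarith
      then have "m * \<bar>(x - y) \<bullet> i\<bar> \<le> 1"
        using m by (simp add: abs_mult[symmetric] inner_commute algebra_simps abs_if split: if_splits)
      then show ?thesis using m by (simp add: field_simps)
    qed
    then have "(\<Sum>i\<in>Basis. \<bar>(x - y) \<bullet> i\<bar>) \<le> real DIM('a) * (1 / m)"
      by (rule sum_bounded_above)
    moreover have "norm (x - y) \<le> (\<Sum>i\<in>Basis. \<bar>(x - y) \<bullet> i\<bar>)" by (rule norm_le_l1)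
    ultimately show "norm (x - y) \<le> \<delta>" using \<delta> by (simp add: m_def)
  qed
qed

lemma integral_finite_partition:
  fixes h :: "'a::euclidean_space \<Rightarrow> real"
  assumes K: "compact K" and h: "continuous_on K h"
    and \<Q>: "finite \<Q>" "disjoint \<Q>" "\<Union>\<Q> = K" "\<And>Q. Q \<in> \<Q> \<Longrightarrow> Q \<in> sets borel"
  shows "(LINT x|lborel. indicator K x * h x) = (\<Sum>Q\<in>\<Q>. LINT x|lborel. indicator Q x * h x)"
proof -
  have iK: "integrable lborel (\<lambda>x. indicator K x *\<^sub>R h x)" using K h by (intro borel_integrable_compact)
  have "integrable lborel (\<lambda>x. indicator Q x * h x)" if Q: "Q \<in> \<Q>" for Q
  proof -
    have "integrable lborel (\<lambda>x. indicator Q x *\<^sub>R (indicator K x *\<^sub>R h x))"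
      by (rule integrable_mult_indicator[OF _ iK]) (use \<Q>(4)[OF Q] in simp)
    moreover have "(\<lambda>x. indicator Q x *\<^sub>R (indicator K x *\<^sub>R h x)) = (\<lambda>x. indicator Q x * h x)"
      using \<Q>(3) Q by (auto simp: indicator_def fun_eq_iff)
    ultimately show ?thesis by simp
  qed
  moreover have "indicator K x * h x = (\<Sum>Q\<in>\<Q>. indicator Q x * h x)" for x
  proof -
    have "indicator (\<Union>Q\<in>\<Q>. Q) x = (\<Sum>Q\<in>\<Q>. indicator Q x :: real)"
      using \<Q>(1,2) by (intro indicator_UN_disjoint) (auto simp: disjoint_family_on_def disjoint_def)
    then show ?thesis using \<Q>(3) by (simp add: sum_distrib_right)
  qed
  ultimately show ?thesis by simp
qed

text \<open>
  The list \<open>Qs\<close> of cells depends on \<open>e\<close> but not on \<open>u\<close>.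
\<close>

theorem rellich_inequality:
  fixes K :: "'a::euclidean_space set"
  assumes K: "compact K" "convex K" and e: "e > 0"
  shows "\<exists>Qs. (\<forall>Q\<in>set Qs. Q \<in> sets borel \<and> Q \<subseteq> K) \<and>
    (\<forall>u G. continuous_on K u \<longrightarrow> continuous_on K G \<longrightarrow>
      (\<forall>x\<in>K. (u has_derivative (\<lambda>v. G x \<bullet> v)) (at x)) \<longrightarrow>
      (LINT x|lborel. indicator K x * (u x)\<^sup>2) \<le>
      e * (LINT x|lborel. indicator K x * (norm (G x))\<^sup>2) +
      (\<Sum>Q\<leftarrow>Qs. (LINT x|lborel. indicator Q x * u x)\<^sup>2 / measure lborel Q))"
proof -
  define \<delta> where "\<delta> = sqrt (e / 2 ^ DIM('a))"
  have \<delta>: "\<delta> > 0" using e by (simp add: \<delta>_def)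
  have \<delta>2: "2 ^ DIM('a) * \<delta>\<^sup>2 = e" using e by (simp add: \<delta>_def)
  obtain \<Q> where \<Q>: "finite \<Q>" "disjoint \<Q>" "\<Union>\<Q> = K" "\<And>Q. Q \<in> \<Q> \<Longrightarrow> Q \<in> sets borel \<and> convex Q"
    "\<And>Q x y. Q \<in> \<Q> \<Longrightarrow> x \<in> Q \<Longrightarrow> y \<in> Q \<Longrightarrow> norm (x - y) \<le> \<delta>"
    using convex_cells_exist[OF K \<delta>] by metis
  obtain Qs where Qs: "set Qs = \<Q>" "distinct Qs" using finite_distinct_list[OF \<Q>(1)] by blast
  show ?thesis
  proof (intro exI[of _ Qs] conjI ballI allI impI)
    show "Q \<in> sets borel" "Q \<subseteq> K" if "Q \<in> set Qs" for Q using that \<Q> Qs by auto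
    fix u :: "'a \<Rightarrow> real" and G :: "'a \<Rightarrow> 'a"
    assume u: "continuous_on K u" and G: "continuous_on K G"
      and d: "\<forall>x\<in>K. (u has_derivative (\<lambda>v. G x \<bullet> v)) (at x)"
    have part: "(LINT x|lborel. indicator K x * h x) = (\<Sum>Q\<in>\<Q>. LINT x|lborel. indicator Q x * h x)"
      if "continuous_on K h" for h :: "'a \<Rightarrow> real"
      using \<Q>(4) by (intro integral_finite_partition K(1) that \<Q>(1-3)) auto
    have "(LINT x|lborel. indicator K x * (u x)\<^sup>2) = (\<Sum>Q\<in>\<Q>. LINT x|lborel. indicator Q x * (u x)\<^sup>2)"
      by (intro part continuous_intros u)
    also have "\<dots> \<le> (\<Sum>Q\<in>\<Q>. (LINT x|lborel. indicator Q x * u x)\<^sup>2 / measure lborel Q +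
        e * (LINT x|lborel. indicator Q x * (norm (G x))\<^sup>2))"
    proof (rule sum_mono)
      fix Q assume Q: "Q \<in> \<Q>"
      show "(LINT x|lborel. indicator Q x * (u x)\<^sup>2) \<le> (LINT x|lborel. indicator Q x * u x)\<^sup>2 / measure lborel Q +
        e * (LINT x|lborel. indicator Q x * (norm (G x))\<^sup>2)"
        unfolding \<delta>2[symmetric]
        by (rule poincare_inequality_convex[of Q K]) (use \<Q> Q u G d K in blast)+
    qed
    also have "\<dots> = (\<Sum>Q\<in>\<Q>. (LINT x|lborel. indicator Q x * u x)\<^sup>2 / measure lborel Q) +
        e * (LINT x|lborel. indicator K x * (norm (G x))\<^sup>2)"
      by (subst part) (auto simp: sum.distrib sum_distrib_left intro!: continuous_intros G)
    also have "(\<Sum>Q\<in>\<Q>. (LINT x|lborel. indicator Q x * u x)\<^sup>2 / measure lborel Q) =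
        (\<Sum>Q\<leftarrow>Qs. (LINT x|lborel. indicator Q x * u x)\<^sup>2 / measure lborel Q)"
      using Qs by (simp add: sum_list_distinct_conv_sum_set)
    finally show "(LINT x|lborel. indicator K x * (u x)\<^sup>2) \<le>
      e * (LINT x|lborel. indicator K x * (norm (G x))\<^sup>2) +
      (\<Sum>Q\<leftarrow>Qs. (LINT x|lborel. indicator Q x * u x)\<^sup>2 / measure lborel Q)"
      by (simp add: add.commute)
  qed
qed

section \<open>The Riemannian volume\<close>

text \<open>
  The determinant has no zero on the segment from the identity to \<open>G\<close>.
\<close>

lemma det_positive_definite:
  fixes G :: "real ^ 'n ^ 'n"
  assumes pos: "\<And>v. v \<noteq> 0 \<Longrightarrow> v \<bullet> (G *v v) > 0"
  shows "det G > 0"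
proof (rule ccontr)
  assume neg: "\<not> det G > 0"
  define H where "H t = (1 - t) *\<^sub>R mat 1 + t *\<^sub>R G" for t
  have H_nz: "det (H t) \<noteq> 0" if t: "0 \<le> t" "t \<le> 1" for t
  proof -
    have "v = 0" if v: "H t *v v = 0" for v
    proof (rule ccontr)
      assume v0: "v \<noteq> 0"
      have "v \<bullet> (H t *v v) = (1 - t) * (v \<bullet> v) + t * (v \<bullet> (G *v v))"
        by (simp add: H_def matrix_vector_mult_add_rdistrib scaleR_matrix_vector_assoc[symmetric] inner_add_right)
      moreover have "(1 - t) * (v \<bullet> v) + t * (v \<bullet> (G *v v)) > 0"
      proof (cases "t = 0")
        case False
        then show ?thesis using t pos[OF v0] by (intro add_nonneg_pos mult_nonneg_nonneg mult_pos_pos) auto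
      qed (use v0 in auto)
      ultimately show False using v by simp
    qed
    then show ?thesis
      by (simp add: invertible_det_nz[symmetric] invertible_left_inverse matrix_left_invertible_ker)
  qed
  have "\<exists>t. 0 \<le> t \<and> t \<le> 1 \<and> det (H t) = 0"
  proof (rule IVT2')
    show "det (H 1) \<le> 0" using neg by (simp add: H_def)
    show "0 \<le> det (H 0)" by (simp add: H_def det_I)
    show "continuous_on {0..1} (\<lambda>t. det (H t))"
      by (intro continuous_on_det) (auto simp: H_def intro!: continuous_intros)
  qed auto
  then show False using H_nz by blast
qed

locale riemannian_measure = riemannian_manifold M A g
  for M :: "'m::t2_space set"
    and A :: "('m, 'n::finite) chart set"
    and g :: "('m, 'n) chart \<Rightarrow> 'm \<Rightarrow> real ^ 'n ^ 'n" +
  fixes vol :: "'m measure"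
  assumes volume: "riemannian_volume M A g vol"
begin

lemma sets_vol [measurable_cong]: "sets vol = sets (restrict_space borel M)"
  using volume by (simp add: riemannian_volume_def)

lemma space_vol [simp]: "space vol = M"
  using sets_eq_imp_space_eq[OF sets_vol] by (simp add: space_restrict_space)

lemma M_borel: "M \<in> sets borel"
  by (intro borel_closed compact_imp_closed compact_M)

lemma sets_vol_iff: "B \<in> sets vol \<longleftrightarrow> B \<subseteq> M \<and> B \<in> sets borel"
  using M_borel by (auto simp: sets_vol sets_restrict_space_iff)

lemma openin_sets: "openin (top_of_set M) U \<Longrightarrow> U \<in> sets vol"
  using M_borel by (auto simp: openin_open sets_vol_iff)

lemma dom_sets: "c \<in> A \<Longrightarrow> chart_dom c \<in> sets vol"
  by (intro openin_sets dom_open)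

lemma continuous_measurable:
  fixes f :: "'m \<Rightarrow> 'b::topological_space"
  shows "continuous_on M f \<Longrightarrow> f \<in> borel_measurable vol"
  using borel_measurable_continuous_on_restrict measurable_cong_sets[OF sets_vol refl] by blast

text \<open>
  The density of the volume in the coordinates of \<open>c\<close>.
\<close>

definition dens :: "('m, 'n) chart \<Rightarrow> real ^ 'n \<Rightarrow> real" where
  "dens c x = (if x \<in> chart_img c then sqrt (det (g c (chart_inv c x))) else 0)"

lemma dens_pos: "c \<in> A \<Longrightarrow> x \<in> chart_img c \<Longrightarrow> dens c x > 0"
  using det_positive_definite[of "g c (chart_inv c x)"] metric_pos inv_dom by (simp add: dens_def)

lemma dens_nonneg: "c \<in> A \<Longrightarrow> dens c x \<ge> 0"
  using dens_pos[of c x] by (cases "x \<in> chart_img c") (auto simp: dens_def)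

lemma dens_cont: "c \<in> A \<Longrightarrow> continuous_on (chart_img c) (dens c)"
proof -
  assume c: "c \<in> A"
  have "continuous_on (chart_img c) (\<lambda>x. sqrt (det (g c (chart_inv c x))))"
    by (intro continuous_on_real_sqrt continuous_on_det continuous_on_component metric_cont c)
  then show ?thesis by (rule continuous_on_eq) (simp add: dens_def)
qed

lemma dens_measurable [measurable]: "c \<in> A \<Longrightarrow> dens c \<in> borel_measurable borel"
proof -
  assume c: "c \<in> A"
  have "(\<lambda>x. if x \<in> chart_img c then dens c x else 0) \<in> borel_measurable borel"
    by (intro borel_measurable_continuous_on_if borel_open img_open c dens_cont continuous_intros)
  then show ?thesis by (rule measurable_cong[THEN iffD1, rotated]) (simp add: dens_def)
qed

lemma inv_image_sets:
  assumes c: "c \<in> A" and B: "B \<in> sets borel" "B \<subseteq> chart_img c"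
  shows "chart_inv c ` B \<in> sets vol"
proof -
  have "chart_map c \<in> borel_measurable (restrict_space borel (chart_dom c))"
    by (intro borel_measurable_continuous_on_restrict map_cont c)
  then have "chart_map c -` B \<inter> space (restrict_space borel (chart_dom c)) \<in> sets (restrict_space borel (chart_dom c))"
    using B(1) by (rule measurable_sets)
  moreover have "chart_map c -` B \<inter> chart_dom c = chart_inv c ` B"
    using B(2) c by (auto simp: inv_map map_inv inv_dom image_iff) (metis inv_map)
  moreover have "chart_dom c \<in> sets borel" using dom_sets[OF c] by (simp add: sets_vol_iff)
  ultimately show ?thesis using dom_subset[OF c] by (auto simp: sets_vol_iff sets_restrict_space_iff)
qed

lemma emeasure_chart:
  assumes c: "c \<in> A" and B: "B \<in> sets vol" "B \<subseteq> chart_dom c"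
  shows "emeasure vol B = (\<integral>\<^sup>+x. ennreal (dens c x) * indicator (chart_map c ` B) x \<partial>lborel)"
proof -
  have "emeasure vol B = (\<integral>\<^sup>+x\<in>chart_map c ` B. ennreal (sqrt (det (g c (chart_inv c x)))) \<partial>lborel)"
    using volume c B by (simp add: riemannian_volume_def)
  also have "\<dots> = (\<integral>\<^sup>+x. ennreal (dens c x) * indicator (chart_map c ` B) x \<partial>lborel)"
    using B(2) c by (intro nn_integral_cong) (auto simp: dens_def indicator_def map_img)
  finally show ?thesis .
qed

text \<open>A total inverse of the chart, so that it can be a measurable map on the whole space.\<close>

definition einv :: "('m, 'n) chart \<Rightarrow> real ^ 'n \<Rightarrow> 'm" where
  "einv c x = (if x \<in> chart_img c then chart_inv c x else (SOME p. p \<in> M))"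

lemma base_point: "(SOME p. p \<in> M) \<in> M"
  using manifold by (auto simp: compact_connected_riemannian_manifold_def some_in_eq)

lemma einv_measurable [measurable]: "c \<in> A \<Longrightarrow> einv c \<in> measurable borel vol"
proof -
  assume c: "c \<in> A"
  have "einv c \<in> measurable borel borel" unfolding einv_def
    by (intro borel_measurable_continuous_on_if borel_open img_open c inv_cont continuous_intros)
  then have "einv c \<in> measurable borel (restrict_space borel M)"
    using subsetD[OF dom_subset[OF c] inv_dom[OF c]] base_point
    by (intro measurable_restrict_space2) (auto simp: einv_def)
  then show ?thesis using measurable_cong_sets[OF refl sets_vol] by blast
qed

lemma chart_measure:
  assumes c: "c \<in> A"
  shows "distr (density lborel (\<lambda>x. ennreal (dens c x))) vol (einv c) = density vol (indicator (chart_dom c))"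
proof (rule measure_eqI)
  fix B assume "B \<in> sets (distr (density lborel (\<lambda>x. ennreal (dens c x))) vol (einv c))"
  then have B: "B \<in> sets vol" by simp
  note [measurable] = c B dom_sets[OF c] dens_measurable[OF c] einv_measurable[OF c]
  let ?B = "B \<inter> chart_dom c"
  have "emeasure (distr (density lborel (\<lambda>x. ennreal (dens c x))) vol (einv c)) B =
      (\<integral>\<^sup>+x. ennreal (dens c x) * indicator (einv c -` B \<inter> space borel) x \<partial>lborel)"
    using measurable_sets[OF einv_measurable[OF c] B] by (subst emeasure_distr, simp_all, subst emeasure_density) auto
  also have "\<dots> = (\<integral>\<^sup>+x. ennreal (dens c x) * indicator (chart_map c ` ?B) x \<partial>lborel)"
  proof (intro nn_integral_cong)
    fix x
    have "einv c x \<in> B \<longleftrightarrow> x \<in> chart_map c ` ?B" if x: "x \<in> chart_img c"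
    proof
      assume "einv c x \<in> B"
      then have "chart_inv c x \<in> ?B" using x inv_dom[OF c x] by (simp add: einv_def)
      then have "chart_map c (chart_inv c x) \<in> chart_map c ` ?B" by (rule imageI)
      then show "x \<in> chart_map c ` ?B" using map_inv[OF c x] by simp
    next
      assume "x \<in> chart_map c ` ?B"
      then obtain p where "p \<in> ?B" "x = chart_map c p" by blast
      then show "einv c x \<in> B" using x inv_map[OF c, of p] by (simp add: einv_def)
    qed
    then show "ennreal (dens c x) * indicator (einv c -` B \<inter> space borel) x =
        ennreal (dens c x) * indicator (chart_map c ` ?B) x"
      by (cases "x \<in> chart_img c") (auto simp: dens_def indicator_def)
  qed
  also have "\<dots> = emeasure vol ?B"
    using B dom_sets[OF c] by (intro emeasure_chart[symmetric] c) auto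
  also have "\<dots> = emeasure (density vol (indicator (chart_dom c))) B"
  proof -
    have "emeasure vol ?B = (\<integral>\<^sup>+p. indicator ?B p \<partial>vol)" using B dom_sets[OF c] by simp
    also have "\<dots> = (\<integral>\<^sup>+p. indicator (chart_dom c) p * indicator B p \<partial>vol)"
      by (intro nn_integral_cong) (auto simp: indicator_def)
    finally show ?thesis using B dom_sets[OF c] by (subst emeasure_density) auto
  qed
  finally show "emeasure (distr (density lborel (\<lambda>x. ennreal (dens c x))) vol (einv c)) B =
    emeasure (density vol (indicator (chart_dom c))) B" .
qed simp

lemma chart_integral:
  fixes h :: "'m \<Rightarrow> real"
  assumes c: "c \<in> A" and h[measurable]: "h \<in> borel_measurable vol"
  shows "(LINT p|vol. indicator (chart_dom c) p * h p) = (LINT x|lborel. dens c x * h (einv c x))"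
proof -
  note [measurable] = c dom_sets[OF c] dens_measurable[OF c] einv_measurable[OF c]
  have "(LINT p|vol. indicator (chart_dom c) p * h p) = (LINT p|density vol (\<lambda>p. ennreal (indicator (chart_dom c) p)). h p)"
    by (subst integral_density) auto
  also have "\<dots> = (LINT p|distr (density lborel (\<lambda>x. ennreal (dens c x))) vol (einv c). h p)"
    by (simp add: chart_measure[OF c] ennreal_indicator)
  also have "\<dots> = (LINT x|density lborel (\<lambda>x. ennreal (dens c x)). h (einv c x))"
    by (subst integral_distr) auto
  also have "\<dots> = (LINT x|lborel. dens c x * h (einv c x))"
    using dens_nonneg[OF c] by (subst integral_density) auto
  finally show ?thesis .
qed

text \<open>
  The open balls already cover \<open>M\<close>; the closed ones are stated because they are compact, so that
  continuous functions are bounded on them.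
\<close>

lemma ball_cover:
  obtains I :: "(('m, 'n) chart \<times> (real ^ 'n) \<times> real) set" where "finite I"
    "I \<subseteq> {(c, a, r). c \<in> A \<and> r > 0 \<and> cball a r \<subseteq> chart_img c}"
    "M \<subseteq> (\<Union>(c, a, r)\<in>I. chart_inv c ` cball a r)"
proof -
  define J :: "(('m, 'n) chart \<times> (real ^ 'n) \<times> real) set" where "J = {(c, a, r). c \<in> A \<and> r > 0 \<and> cball a r \<subseteq> chart_img c}"
  define U :: "('m, 'n) chart \<times> (real ^ 'n) \<times> real \<Rightarrow> 'm set"
    where "U = (\<lambda>(c, a, r). chart_inv c ` (chart_img c \<inter> ball a r))"
  have "\<exists>i\<in>J. p \<in> U i" if p: "p \<in> M" for p
  proof -
    obtain c where c: "c \<in> A" "p \<in> chart_dom c" using chart_ex p by blast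
    obtain r where r: "r > 0" "cball (chart_map c p) r \<subseteq> chart_img c"
      using open_contains_cball[of "chart_img c"] img_open[OF c(1)] map_img[OF c] by blast
    have "p \<in> chart_inv c ` (chart_img c \<inter> ball (chart_map c p) r)"
      using map_img[OF c] inv_map[OF c] r by (intro image_eqI[of _ _ "chart_map c p"]) auto
    then show ?thesis using c r by (intro bexI[of _ "(c, chart_map c p, r)"]) (auto simp: U_def J_def)
  qed
  then have cov: "M \<subseteq> (\<Union>i\<in>J. U i)" by blast
  have "openin (top_of_set M) (U i)" if "i \<in> J" for i
    using that by (auto simp: U_def J_def intro!: open_inv_image)
  then have "\<forall>i\<in>J. \<exists>T. open T \<and> U i = M \<inter> T" by (simp only: openin_open) blast
  then obtain T where T: "\<forall>i\<in>J. open (T i) \<and> U i = M \<inter> T i"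
    using bchoice[of J "\<lambda>i T. open T \<and> U i = M \<inter> T"] by blast
  have "M \<subseteq> (\<Union>i\<in>J. T i)" using cov T by blast
  moreover have "open (T i)" if "i \<in> J" for i using T that by blast
  ultimately obtain I where I: "I \<subseteq> J" "finite I" "M \<subseteq> (\<Union>i\<in>I. T i)"
    using compactE_image[OF compact_M, of J T] by blast
  show ?thesis
  proof (rule that[OF I(2)])
    show "I \<subseteq> {(c, a, r). c \<in> A \<and> r > 0 \<and> cball a r \<subseteq> chart_img c}"
      using I(1) by (simp add: J_def)
    show "M \<subseteq> (\<Union>(c, a, r)\<in>I. chart_inv c ` cball a r)"
    proof
      fix p assume p: "p \<in> M"
      then obtain i where i: "i \<in> I" "p \<in> M \<inter> T i" using I(3) by blast
      then have "p \<in> U i" using T I(1) by blast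
      moreover obtain c a r where car: "i = (c, a, r)" by (cases i)
      ultimately have "p \<in> chart_inv c ` cball a r" by (auto simp: U_def)
      then show "p \<in> (\<Union>(c, a, r)\<in>I. chart_inv c ` cball a r)" using i(1) car by blast
    qed
  qed
qed

lemma compact_image_finite:
  assumes c: "c \<in> A" and K: "compact K" "K \<subseteq> chart_img c"
  shows "emeasure vol (chart_inv c ` K) < \<infinity>"
proof -
  have wK: "continuous_on K (dens c)" using dens_cont[OF c] K continuous_on_subset by blast
  have "bounded (dens c ` K)" using compact_continuous_image[OF wK K(1)] compact_imp_bounded by blast
  then obtain C where "\<forall>x\<in>K. norm (dens c x) \<le> C" by (auto simp: bounded_iff)
  then have C: "\<And>x. x \<in> K \<Longrightarrow> dens c x \<le> C" by (auto simp: abs_le_iff)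
  have KB: "K \<in> sets borel" using K by (simp add: borel_compact)
  have im: "chart_map c ` chart_inv c ` K = K" using K(2) map_inv[OF c] by (force simp: image_image)
  have "emeasure vol (chart_inv c ` K) = (\<integral>\<^sup>+x. ennreal (dens c x) * indicator K x \<partial>lborel)"
    using emeasure_chart[OF c inv_image_sets[OF c KB K(2)]] inv_dom[OF c] K(2) im by auto
  also have "\<dots> \<le> (\<integral>\<^sup>+x. ennreal C * indicator K x \<partial>lborel)"
    by (intro nn_integral_mono) (auto simp: indicator_def intro!: ennreal_leI C)
  also have "\<dots> = ennreal C * emeasure lborel K" using KB by (simp add: nn_integral_cmult)
  also have "\<dots> < \<infinity>"
    using emeasure_bounded_finite[OF compact_imp_bounded[OF K(1)]] by (simp add: ennreal_mult_less_top)
  finally show ?thesis .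
qed

lemma volume_finite: "emeasure vol M < \<infinity>"
proof -
  obtain I :: "(('m, 'n) chart \<times> (real ^ 'n) \<times> real) set" where I: "finite I"
    "I \<subseteq> {(c, a, r). c \<in> A \<and> r > 0 \<and> cball a r \<subseteq> chart_img c}"
    "M \<subseteq> (\<Union>(c, a, r)\<in>I. chart_inv c ` cball a r)" by (rule ball_cover)
  let ?U = "\<lambda>(c, a, r). chart_inv c ` cball a r"
  have s: "?U i \<in> sets vol" if "i \<in> I" for i
    using subsetD[OF I(2) that] by (auto intro!: inv_image_sets split: prod.splits)
  have "emeasure vol M \<le> emeasure vol (\<Union>i\<in>I. ?U i)"
    using I(1,3) s by (intro emeasure_mono) auto
  also have "\<dots> \<le> (\<Sum>i\<in>I. emeasure vol (?U i))"
    using I(1) s by (intro emeasure_subadditive_finite) auto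
  also have "\<dots> < \<infinity>"
  proof -
    have "emeasure vol (?U i) < \<infinity>" if "i \<in> I" for i
      using subsetD[OF I(2) that] compact_image_finite[OF _ compact_cball] by auto
    then show ?thesis using I(1) by simp
  qed
  finally show ?thesis .
qed

lemma volume_pos: "emeasure vol M > 0"
proof -
  obtain p where "p \<in> M" using base_point by blast
  then obtain c where c: "c \<in> A" "p \<in> chart_dom c" using chart_ex by blast
  have ne: "chart_img c \<noteq> {}" using map_img[OF c] by blast
  have "emeasure vol (chart_dom c) \<noteq> 0"
  proof
    assume 0: "emeasure vol (chart_dom c) = 0"
    have "emeasure vol (chart_dom c) = (\<integral>\<^sup>+x. ennreal (dens c x) * indicator (chart_img c) x \<partial>lborel)"
      using emeasure_chart[OF c(1) dom_sets[OF c(1)]] by (simp add: chart_img_def)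
    then have "(\<integral>\<^sup>+x. ennreal (dens c x) * indicator (chart_img c) x \<partial>lborel) = 0" using 0 by simp
    then have "AE x in lborel. ennreal (dens c x) * indicator (chart_img c) x = 0"
      using dens_measurable[OF c(1)] img_open[OF c(1)] by (subst (asm) nn_integral_0_iff_AE) auto
    then have "AE x in lborel. x \<notin> chart_img c"
    proof eventually_elim
      case (elim x)
      then show ?case using dens_pos[OF c(1), of x] by (cases "x \<in> chart_img c") auto
    qed
    then have "chart_img c \<in> null_sets lborel"
      using img_open[OF c(1)] AE_iff_null_sets[of "chart_img c" lborel] by simp
    then have "negligible (chart_img c)" by (simp add: negligible_iff_null_sets null_sets_completionI)
    then show False using open_not_negligible[OF img_open[OF c(1)] ne] by blast
  qed
  then show ?thesis using emeasure_mono[OF dom_subset[OF c(1)], of vol] sets.top[of vol]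
    by (metis zero_less_iff_neq_zero le_zero_eq space_vol)
qed

definition nu :: "'m measure" where "nu = uniform_measure vol M"

definition mass :: real where "mass = measure vol M"

lemma mass: "mass > 0" "emeasure vol M = ennreal mass"
  using volume_finite volume_pos
  by (auto simp: mass_def emeasure_eq_ennreal_measure[symmetric] measure_def enn2real_positive_iff less_top[symmetric])

lemma sets_nu [simp, measurable_cong]: "sets nu = sets vol" and space_nu [simp]: "space nu = M"
  by (simp_all add: nu_def uniform_measure_def)

lemma nu_density: "nu = density vol (\<lambda>p. ennreal (1 / mass))"
  unfolding nu_def uniform_measure_def
proof (rule density_cong)
  show "AE p in vol. indicator M p / emeasure vol M = ennreal (1 / mass)"
    using mass by (intro AE_I2) (simp add: divide_ennreal[symmetric])
qed (use sets.top[of vol] in auto)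

lemma measurable_nu [simp]: "borel_measurable nu = borel_measurable vol"
  by (intro measurable_cong_sets) auto

lemma nu_integral:
  fixes h :: "'m \<Rightarrow> real"
  shows "h \<in> borel_measurable vol \<Longrightarrow> (LINT p|nu. h p) = (LINT p|vol. h p) / mass"
  unfolding nu_density using mass by (subst integral_density) auto

lemma nu_integrable:
  fixes h :: "'m \<Rightarrow> real"
  assumes h: "h \<in> borel_measurable vol"
  shows "integrable nu h \<longleftrightarrow> integrable vol h"
proof -
  have "integrable nu h \<longleftrightarrow> integrable vol (\<lambda>p. (1 / mass) *\<^sub>R h p)"
    unfolding nu_density using mass h by (intro integrable_density) auto
  also have "\<dots> \<longleftrightarrow> integrable vol h"
  proof
    assume "integrable vol (\<lambda>p. (1 / mass) *\<^sub>R h p)"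
    then have "integrable vol (\<lambda>p. mass *\<^sub>R ((1 / mass) *\<^sub>R h p))" by (rule integrable_scaleR_right)
    then show "integrable vol h" using mass by simp
  qed (rule integrable_scaleR_right)
  finally show ?thesis .
qed

lemma finite_measure_vol: "finite_measure vol"
  using volume_finite by (intro finite_measureI) auto

lemma finite_measure_nu: "finite_measure nu"
proof (rule finite_measureI)
  have "emeasure nu (space nu) = (\<integral>\<^sup>+p. ennreal (1 / mass) * indicator M p \<partial>vol)"
    unfolding space_nu nu_density using sets.top[of vol] by (subst emeasure_density) auto
  also have "\<dots> = ennreal (1 / mass) * emeasure vol M"
    using sets.top[of vol] by (subst nn_integral_cmult_indicator) auto
  finally show "emeasure nu (space nu) \<noteq> \<infinity>" using volume_finite by (auto simp: ennreal_mult_eq_top_iff)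
qed

lemma continuous_bounded:
  assumes "continuous_on M (f :: 'm \<Rightarrow> real)"
  obtains C where "\<And>p. p \<in> M \<Longrightarrow> \<bar>f p\<bar> \<le> C"
  using compact_imp_bounded[OF compact_continuous_image[OF assms compact_M]] by (auto simp: bounded_iff)

lemma continuous_integrable_vol:
  assumes f: "continuous_on M (f :: 'm \<Rightarrow> real)"
  shows "integrable vol f"
proof -
  interpret finite_measure vol by (rule finite_measure_vol)
  obtain C where C: "\<And>p. p \<in> M \<Longrightarrow> \<bar>f p\<bar> \<le> C" using continuous_bounded[OF f] by blast
  show ?thesis
    by (rule integrable_const_bound[of _ C]) (use C continuous_measurable[OF f] in auto)
qed

lemma continuous_integrable_nu: "continuous_on M (f :: 'm \<Rightarrow> real) \<Longrightarrow> integrable nu f"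
  using nu_integrable[OF continuous_measurable] continuous_integrable_vol by blast

lemma continuous_L2: "continuous_on M f \<Longrightarrow> f \<in> L2 nu"
  unfolding L2_def by (auto intro!: continuous_integrable_nu continuous_measurable continuous_intros)

end

section \<open>The space of square-integrable functions\<close>

instantiation "fun" :: (type, real_vector) real_vector
begin

definition "scaleR r f = (\<lambda>x. r *\<^sub>R f x)"

instance
  by standard (auto simp: scaleR_fun_def fun_eq_iff scaleR_add_right scaleR_add_left)

end

lemma fun_minus_apply: "f - h = (\<lambda>x. f x - (h x :: real))"
  by (simp add: fun_eq_iff)

lemma fun_scaleR_real: "c *\<^sub>R f = (\<lambda>x. c * (f x :: real))"
  by (simp add: scaleR_fun_def)

lemma fun_sum_apply: "sum f S x = (\<Sum>j\<in>S. f j x)" for f :: "'b \<Rightarrow> 'a \<Rightarrow> real"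
  by (induction S rule: infinite_finite_induct) auto

lemma L2_product_integrable:
  assumes "f \<in> L2 \<nu>" "h \<in> L2 \<nu>"
  shows "integrable \<nu> (\<lambda>x. f x * h x)"
proof (rule Bochner_Integration.integrable_bound)
  show "integrable \<nu> (\<lambda>x. (f x)\<^sup>2 + (h x)\<^sup>2)" using assms by (auto simp: L2_def)
  show "(\<lambda>x. f x * h x) \<in> borel_measurable \<nu>" using assms by (auto simp: L2_def)
  show "AE x in \<nu>. norm (f x * h x) \<le> norm ((f x)\<^sup>2 + (h x)\<^sup>2)"
  proof (intro AE_I2)
    fix x
    have "2 * (\<bar>f x\<bar> * \<bar>h x\<bar>) \<le> (f x)\<^sup>2 + (h x)\<^sup>2"
      using sum_squares_bound[of "\<bar>f x\<bar>" "\<bar>h x\<bar>"] by simp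
    moreover have "\<bar>f x\<bar> * \<bar>h x\<bar> \<ge> 0" by simp
    ultimately have "\<bar>f x\<bar> * \<bar>h x\<bar> \<le> (f x)\<^sup>2 + (h x)\<^sup>2" by linarith
    then show "norm (f x * h x) \<le> norm ((f x)\<^sup>2 + (h x)\<^sup>2)" by (simp add: abs_mult)
  qed
qed

lemma L2_semi_inner: "semi_inner (L2 \<nu>) (l2_inner \<nu>)"
proof
  show "subspace (L2 \<nu>)" unfolding subspace_def
  proof (intro conjI ballI allI)
    show "0 \<in> L2 \<nu>" by (simp add: L2_def zero_fun_def)
    fix f h assume f: "f \<in> L2 \<nu>" and h: "h \<in> L2 \<nu>"
    have "integrable \<nu> (\<lambda>x. (f x)\<^sup>2 + 2 * (f x * h x) + (h x)\<^sup>2)"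
      using f h L2_product_integrable[OF f h] by (auto simp: L2_def)
    then have "integrable \<nu> (\<lambda>x. (f x + h x)\<^sup>2)"
      by (simp add: power2_sum algebra_simps)
    then show "f + h \<in> L2 \<nu>" using f h by (auto simp: L2_def plus_fun_def)
  next
    fix c f assume "f \<in> L2 \<nu>"
    then show "c *\<^sub>R f \<in> L2 \<nu>" by (auto simp: L2_def fun_scaleR_real power_mult_distrib)
  qed
  fix f h k assume f: "f \<in> L2 \<nu>" and h: "h \<in> L2 \<nu>"
  show "l2_inner \<nu> f h = l2_inner \<nu> h f" by (simp add: l2_inner_def mult.commute)
  show "l2_inner \<nu> (c *\<^sub>R f) h = c * l2_inner \<nu> f h" for c
    by (simp add: l2_inner_def fun_scaleR_real mult.assoc)
  show "l2_inner \<nu> f f \<ge> 0" by (simp add: l2_inner_def)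
  assume k: "k \<in> L2 \<nu>"
  show "l2_inner \<nu> (f + h) k = l2_inner \<nu> f k + l2_inner \<nu> h k"
    using L2_product_integrable[OF f k] L2_product_integrable[OF h k]
    by (simp add: l2_inner_def distrib_right)
qed

text \<open>
  The measure is finite, so a Cauchy sequence is also one in \<open>L\<^sup>1\<close> and has a subsequence that converges
  almost everywhere.  By Fatou's lemma its limit is the \<open>L\<^sup>2\<close> limit of the sequence.
\<close>

theorem L2_complete:
  assumes fin: "finite_measure \<nu>" and s: "\<And>k::nat. s k \<in> L2 \<nu>" and c: "semi_inner.cauchy (l2_inner \<nu>) s"
  shows "\<exists>u\<in>L2 \<nu>. semi_inner.converges (l2_inner \<nu>) s u"
proof -
  interpret finite_measure \<nu> by (rule fin)
  interpret semi_inner "L2 \<nu>" "l2_inner \<nu>" by (rule L2_semi_inner)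
  have meas[measurable]: "s k \<in> borel_measurable \<nu>" for k using s[of k] by (simp add: L2_def)
  have one: "(\<lambda>x. 1) \<in> L2 \<nu>" by (simp add: L2_def)
  have int1: "integrable \<nu> f" if "f \<in> L2 \<nu>" for f
    using L2_product_integrable[OF that one] by simp
  have L1: "(LINT x|\<nu>. norm (f x)) \<le> sqrt (l2_inner \<nu> f f * measure \<nu> (space \<nu>))" if f: "f \<in> L2 \<nu>" for f
  proof (rule real_le_rsqrt)
    have af: "(\<lambda>x. \<bar>f x\<bar>) \<in> L2 \<nu>" using f by (auto simp: L2_def)
    have "(l2_inner \<nu> (\<lambda>x. \<bar>f x\<bar>) (\<lambda>x. 1))\<^sup>2 \<le>
        l2_inner \<nu> (\<lambda>x. \<bar>f x\<bar>) (\<lambda>x. \<bar>f x\<bar>) * l2_inner \<nu> (\<lambda>x. 1) (\<lambda>x. 1)"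
      by (rule Cauchy_Schwarz[OF af one])
    then show "(LINT x|\<nu>. norm (f x))\<^sup>2 \<le> l2_inner \<nu> f f * measure \<nu> (space \<nu>)"
      by (simp add: l2_inner_def)
  qed
  have L1c: "\<exists>N. \<forall>i\<ge>N. \<forall>j\<ge>N. (LINT x|\<nu>. norm (s i x - s j x)) < e" if e: "e > 0" for e
  proof -
    define V where "V = measure \<nu> (space \<nu>) + 1"
    have V: "V > 0" using measure_nonneg[of \<nu> "space \<nu>"] by (simp add: V_def add_nonneg_pos)
    obtain N where N: "\<And>i j. i \<ge> N \<Longrightarrow> j \<ge> N \<Longrightarrow> l2_inner \<nu> (s i - s j) (s i - s j) < e\<^sup>2 / V"
      using c e V unfolding cauchy_def by (meson divide_pos_pos zero_less_power)
    have "(LINT x|\<nu>. norm (s i x - s j x)) < e" if "i \<ge> N" "j \<ge> N" for i j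
    proof -
      have d: "s i - s j \<in> L2 \<nu>" using s by auto
      have "(LINT x|\<nu>. norm ((s i - s j) x)) \<le> sqrt (l2_inner \<nu> (s i - s j) (s i - s j) * measure \<nu> (space \<nu>))"
        by (rule L1[OF d])
      also have "\<dots> \<le> sqrt (l2_inner \<nu> (s i - s j) (s i - s j) * V)"
        using nonneg[OF d] by (intro real_sqrt_le_mono mult_left_mono) (auto simp: V_def)
      also have "\<dots> < sqrt (e\<^sup>2 / V * V)"
        using N[OF that] V by (intro real_sqrt_less_mono mult_strict_right_mono)
      also have "\<dots> = e" using V e by simp
      finally show ?thesis by simp
    qed
    then show ?thesis by blast
  qed
  obtain r where r: "strict_mono r" "AE x in \<nu>. Cauchy (\<lambda>i. s (r i) x)"
    using cauchy_L1_AE_cauchy_subseq[of \<nu> s] int1[OF s] L1c by metis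
  define u where "u x = lim (\<lambda>i. s (r i) x)" for x
  have um[measurable]: "u \<in> borel_measurable \<nu>" unfolding u_def by (intro borel_measurable_lim_metric) auto
  have lim: "AE x in \<nu>. (\<lambda>i. s (r i) x) \<longlonglongrightarrow> u x"
    using r(2) by eventually_elim (simp add: u_def Cauchy_convergent_iff convergent_LIMSEQ_iff)
  have ennint: "ennreal (l2_inner \<nu> f f) = (\<integral>\<^sup>+x. ennreal ((f x)\<^sup>2) \<partial>\<nu>)" if "f \<in> L2 \<nu>" for f
    using that by (simp add: l2_inner_def L2_def nn_integral_eq_integral power2_eq_square)
  have fatou: "(\<integral>\<^sup>+x. ennreal ((s k x - u x)\<^sup>2) \<partial>\<nu>) \<le> ennreal e"
    if N: "\<And>l. l \<ge> N \<Longrightarrow> l2_inner \<nu> (s k - s l) (s k - s l) \<le> e" for k N e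
  proof -
    have "(\<integral>\<^sup>+x. ennreal ((s k x - u x)\<^sup>2) \<partial>\<nu>) = (\<integral>\<^sup>+x. liminf (\<lambda>i. ennreal ((s k x - s (r i) x)\<^sup>2)) \<partial>\<nu>)"
    proof (rule nn_integral_cong_AE)
      show "AE x in \<nu>. ennreal ((s k x - u x)\<^sup>2) = liminf (\<lambda>i. ennreal ((s k x - s (r i) x)\<^sup>2))"
        using lim
      proof eventually_elim
        case (elim x)
        have "(\<lambda>i. ennreal ((s k x - s (r i) x)\<^sup>2)) \<longlonglongrightarrow> ennreal ((s k x - u x)\<^sup>2)"
          using elim by (intro tendsto_ennrealI tendsto_intros)
        then show ?case by (rule lim_imp_Liminf[OF trivial_limit_sequentially, symmetric])
      qed
    qed
    also have "\<dots> \<le> liminf (\<lambda>i. \<integral>\<^sup>+x. ennreal ((s k x - s (r i) x)\<^sup>2) \<partial>\<nu>)"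
      by (rule nn_integral_liminf) measurable
    also have "\<dots> \<le> liminf (\<lambda>i. ennreal e)"
    proof (rule Liminf_mono)
      show "\<forall>\<^sub>F i in sequentially. (\<integral>\<^sup>+x. ennreal ((s k x - s (r i) x)\<^sup>2) \<partial>\<nu>) \<le> ennreal e"
        using eventually_ge_at_top[of N]
      proof eventually_elim
        case (elim i)
        have "r i \<ge> N" using elim seq_suble[OF r(1), of i] by linarith
        then have "ennreal (l2_inner \<nu> (s k - s (r i)) (s k - s (r i))) \<le> ennreal e" by (intro ennreal_leI N)
        then show ?case using ennint[of "s k - s (r i)"] s by simp
      qed
    qed
    also have "\<dots> = ennreal e" by (simp add: Liminf_const)
    finally show ?thesis .
  qed
  have sq: "s k - u \<in> L2 \<nu>" "l2_inner \<nu> (s k - u) (s k - u) \<le> e"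
    if N: "\<And>l. l \<ge> N \<Longrightarrow> l2_inner \<nu> (s k - s l) (s k - s l) \<le> e" and e: "e \<ge> 0" for k N e
  proof -
    have F: "(\<integral>\<^sup>+x. ennreal ((s k x - u x)\<^sup>2) \<partial>\<nu>) \<le> ennreal e" by (rule fatou[of N]) (rule N)
    then have "(\<integral>\<^sup>+x. ennreal ((s k x - u x)\<^sup>2) \<partial>\<nu>) < \<infinity>" by (rule le_less_trans) simp
    then have i: "integrable \<nu> (\<lambda>x. (s k x - u x)\<^sup>2)" by (intro integrableI_bounded) auto
    then show m: "s k - u \<in> L2 \<nu>" by (simp add: L2_def fun_minus_apply)
    have "ennreal (l2_inner \<nu> (s k - u) (s k - u)) \<le> ennreal e"
      using F ennint[OF m] by simp
    then show "l2_inner \<nu> (s k - u) (s k - u) \<le> e" using e by simp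
  qed
  have bound: "\<exists>N. \<forall>k\<ge>N. \<forall>l\<ge>N. l2_inner \<nu> (s k - s l) (s k - s l) \<le> e" if "e > 0" for e
    using c that unfolding cauchy_def by (meson less_imp_le)
  obtain N1 where "\<forall>k\<ge>N1. \<forall>l\<ge>N1. l2_inner \<nu> (s k - s l) (s k - s l) \<le> 1" using bound[of 1] by auto
  then have "s N1 - u \<in> L2 \<nu>" by (intro sq(1)[of N1 N1 1]) auto
  then have "s N1 - (s N1 - u) \<in> L2 \<nu>" by (rule mem(3)[OF s])
  then have u: "u \<in> L2 \<nu>" by simp
  have "converges s u" unfolding converges_def
  proof (rule LIMSEQ_I)
    fix e :: real assume e: "e > 0"
    then obtain N where N: "\<forall>k\<ge>N. \<forall>l\<ge>N. l2_inner \<nu> (s k - s l) (s k - s l) \<le> e / 2"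
      using bound[of "e / 2"] by auto
    have "norm (l2_inner \<nu> (s k - u) (s k - u) - 0) < e" if "k \<ge> N" for k
    proof -
      have "l2_inner \<nu> (s k - u) (s k - u) \<le> e / 2" using N that e by (intro sq(2)[of N]) auto
      moreover have "l2_inner \<nu> (s k - u) (s k - u) \<ge> 0" using s u by (intro nonneg) auto
      ultimately show ?thesis using e by simp
    qed
    then show "\<exists>N. \<forall>k\<ge>N. norm (l2_inner \<nu> (s k - u) (s k - u) - 0) < e" by blast
  qed
  with u show ?thesis by blast
qed

section \<open>Compactness of the embedding of the form domain\<close>

context riemannian_manifold begin

lemma smooth_subspace: "subspace (smooth_functions A)"
  unfolding subspace_def using smooth_const[of 0] smooth_add smooth_scale
  by (auto simp: zero_fun_def plus_fun_def fun_scaleR_real)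

text \<open>
  The quadratic form of the inverse metric attains a positive minimum on \<open>K\<close> times the unit sphere.
\<close>

lemma gradient_bound:
  assumes c: "c \<in> A" and K: "compact K" "K \<subseteq> chart_img c"
  obtains \<Lambda> where "\<Lambda> > 0"
    "\<And>x (f :: 'm \<Rightarrow> real). x \<in> K \<Longrightarrow> (norm (coord_partials c f (chart_inv c x)))\<^sup>2 \<le> \<Lambda> * chart_grad_inner c f f (chart_inv c x)"
proof (cases "K = {}")
  case True
  then show ?thesis using that[of 1] by simp
next
  case False
  let ?S = "K \<times> sphere (0 :: real ^ 'n) 1"
  let ?F = "\<lambda>z. (matrix_inv (g c (chart_inv c (fst z))) *v snd z) \<bullet> snd z"
  have cG: "continuous_on ?S (\<lambda>z. g c (chart_inv c (fst z)))"
    by (rule continuous_on_compose2[OF metric_cont[OF c] continuous_on_fst[OF continuous_on_id]]) (use K in auto)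
  have "continuous_on ?S ?F"
  proof (intro continuous_on_inner continuous_on_matrix_inv_mult cG continuous_on_snd continuous_on_id)
    fix z and v :: "real ^ 'n" assume "z \<in> ?S" "g c (chart_inv c (fst z)) *v v = 0"
    then show "v = 0" using metric_inj[OF c inv_dom[OF c]] K by auto
  qed
  moreover have "compact ?S" using K by (intro compact_Times compact_sphere)
  moreover obtain i :: 'n where True by blast
  have "axis i 1 \<in> sphere (0 :: real ^ 'n) 1" by simp
  then have "?S \<noteq> {}" using False by blast
  ultimately obtain z where z: "z \<in> ?S" "\<And>y. y \<in> ?S \<Longrightarrow> ?F z \<le> ?F y"
    using continuous_attains_inf[of ?S ?F] by blast
  have pos: "(matrix_inv (g c (chart_inv c x)) *v v) \<bullet> v > 0" if x: "x \<in> K" and v: "v \<noteq> 0" for x v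
  proof -
    have p: "chart_inv c x \<in> chart_dom c" using inv_dom[OF c] K x by blast
    define b where "b = matrix_inv (g c (chart_inv c x)) *v v"
    have gb: "g c (chart_inv c x) *v b = v" unfolding b_def by (rule metric_inv(1)[OF c p])
    then have "b \<noteq> 0" using v by auto
    from metric_pos[OF c p this] show ?thesis unfolding gb by (simp add: b_def)
  qed
  define m where "m = ?F z"
  have m: "m > 0" unfolding m_def using z(1) by (intro pos) auto
  show ?thesis
  proof (rule that[of "1 / m"])
    show "1 / m > 0" using m by simp
    fix x and f :: "'m \<Rightarrow> real" assume x: "x \<in> K"
    define \<xi> where "\<xi> = coord_partials c f (chart_inv c x)"
    let ?G = "matrix_inv (g c (chart_inv c x))"
    have "m * (norm \<xi>)\<^sup>2 \<le> (?G *v \<xi>) \<bullet> \<xi>"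
    proof (cases "\<xi> = 0")
      case False
      define v where "v = (1 / norm \<xi>) *\<^sub>R \<xi>"
      have \<xi>v: "\<xi> = norm \<xi> *\<^sub>R v" using False by (simp add: v_def)
      have "norm v = 1" using False by (simp add: v_def)
      then have "(x, v) \<in> ?S" using x by simp
      from z(2)[OF this] have mv: "m \<le> (?G *v v) \<bullet> v" by (simp add: m_def)
      have "(?G *v \<xi>) \<bullet> \<xi> = (norm \<xi>)\<^sup>2 * ((?G *v v) \<bullet> v)"
        by (subst (1 2) \<xi>v) (simp add: matrix_vector_mult_scaleR power2_eq_square)
      moreover have "(norm \<xi>)\<^sup>2 * m \<le> (norm \<xi>)\<^sup>2 * ((?G *v v) \<bullet> v)" using mv by (intro mult_left_mono) auto
      ultimately show ?thesis by (simp add: mult.commute)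
    qed simp
    then have "(norm \<xi>)\<^sup>2 \<le> ((?G *v \<xi>) \<bullet> \<xi>) / m" using m by (simp add: pos_le_divide_eq mult.commute)
    then show "(norm (coord_partials c f (chart_inv c x)))\<^sup>2 \<le> 1 / m * chart_grad_inner c f f (chart_inv c x)"
      by (simp add: \<xi>_def chart_grad_inner_def)
  qed
qed

end

context riemannian_measure begin

lemma dirichlet_semi_inner: "semi_inner (smooth_functions A) (dirichlet_form A g nu)"
proof
  show "subspace (smooth_functions A)" by (rule smooth_subspace)
  fix f h k assume f: "f \<in> smooth_functions A" and h: "h \<in> smooth_functions A"
  have int: "integrable nu (grad_inner A g f h)" if "f \<in> smooth_functions A" "h \<in> smooth_functions A" for f h
    by (intro continuous_integrable_nu grad_inner_cont that)
  show "dirichlet_form A g nu f h = dirichlet_form A g nu h f"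
    unfolding dirichlet_form_def by (intro Bochner_Integration.integral_cong) (auto simp: grad_inner_sym f h)
  show "dirichlet_form A g nu (a *\<^sub>R f) h = a * dirichlet_form A g nu f h" for a
  proof -
    have "dirichlet_form A g nu (a *\<^sub>R f) h = (LINT p|nu. a * grad_inner A g f h p)"
      unfolding dirichlet_form_def fun_scaleR_real
      by (intro Bochner_Integration.integral_cong) (auto simp: grad_inner_scale f h)
    then show ?thesis by (simp add: dirichlet_form_def)
  qed
  show "dirichlet_form A g nu f f \<ge> 0"
    unfolding dirichlet_form_def
    by (rule integral_nonneg_AE) (auto intro!: AE_I2 grad_inner_nonneg f)
  assume k: "k \<in> smooth_functions A"
  have "dirichlet_form A g nu (f + h) k = (LINT p|nu. grad_inner A g f k p + grad_inner A g h k p)"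
    unfolding dirichlet_form_def plus_fun_def
    by (intro Bochner_Integration.integral_cong) (auto simp: grad_inner_add f h k)
  then show "dirichlet_form A g nu (f + h) k = dirichlet_form A g nu f k + dirichlet_form A g nu h k"
    using int[OF f k] int[OF h k] by (simp add: dirichlet_form_def)
qed

lemma chart_integral_on:
  fixes h :: "'m \<Rightarrow> real"
  assumes c: "c \<in> A" and B: "B \<in> sets borel" "B \<subseteq> chart_img c" and h: "h \<in> borel_measurable vol"
  shows "(LINT p|vol. indicator (chart_inv c ` B) p * h p) = (LINT x|lborel. indicator B x * (dens c x * h (chart_inv c x)))"
proof -
  have S: "chart_inv c ` B \<in> sets vol" by (rule inv_image_sets[OF c B])
  have "(LINT p|vol. indicator (chart_inv c ` B) p * h p) =
      (LINT p|vol. indicator (chart_dom c) p * (indicator (chart_inv c ` B) p * h p))"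
    using inv_dom[OF c] B(2) by (intro Bochner_Integration.integral_cong) (auto simp: indicator_def)
  also have "\<dots> = (LINT x|lborel. dens c x * (indicator (chart_inv c ` B) (einv c x) * h (einv c x)))"
    using S h by (intro chart_integral c) auto
  also have "\<dots> = (LINT x|lborel. indicator B x * (dens c x * h (chart_inv c x)))"
  proof (intro Bochner_Integration.integral_cong refl)
    fix x
    show "dens c x * (indicator (chart_inv c ` B) (einv c x) * h (einv c x)) = indicator B x * (dens c x * h (chart_inv c x))"
    proof (cases "x \<in> chart_img c")
      case True
      have "chart_inv c x \<in> chart_inv c ` B \<longleftrightarrow> x \<in> B"
      proof
        assume "chart_inv c x \<in> chart_inv c ` B"
        then obtain y where y: "y \<in> B" "chart_inv c x = chart_inv c y" by blast
        then have "chart_map c (chart_inv c x) = chart_map c (chart_inv c y)" by simp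
        then show "x \<in> B" using map_inv[OF c True] map_inv[OF c subsetD[OF B(2) y(1)]] y(1) by simp
      qed simp
      then show ?thesis using True by (simp add: einv_def indicator_def)
    next
      case False
      then show ?thesis using B(2) by (auto simp: dens_def indicator_def)
    qed
  qed
  finally show ?thesis .
qed

text \<open>The reciprocal density, by which Lebesgue integrals in a chart become integrals over \<open>M\<close>.\<close>

definition inv_dens :: "('m, 'n) chart \<Rightarrow> 'm \<Rightarrow> real" where
  "inv_dens c p = (if p \<in> chart_dom c then 1 / dens c (chart_map c p) else 0)"

lemma inv_dens_measurable: "c \<in> A \<Longrightarrow> inv_dens c \<in> borel_measurable vol"
proof -
  assume c: "c \<in> A"
  have "continuous_on (chart_dom c) (\<lambda>p. dens c (chart_map c p))"
    by (rule continuous_on_compose2[OF dens_cont[OF c] map_cont[OF c]]) (auto simp: chart_img_def)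
  then have "continuous_on (chart_dom c) (\<lambda>p. 1 / dens c (chart_map c p))"
    using dens_pos[OF c] map_img[OF c] by (intro continuous_on_divide continuous_on_const) fastforce+
  moreover have "chart_dom c \<in> sets borel" using dom_sets[OF c] by (simp add: sets_vol_iff)
  ultimately have "inv_dens c \<in> borel_measurable borel"
    unfolding inv_dens_def by (intro borel_measurable_continuous_on_if continuous_on_const)
  then have "inv_dens c \<in> borel_measurable (restrict_space borel M)" by (rule measurable_restrict_space1)
  then show ?thesis using measurable_cong_sets[OF sets_vol refl] by blast
qed

text \<open>
  On the ball the density lies between positive constants \<open>\<alpha>\<close> and \<open>\<beta>\<close> and the Euclidean length of the
  gradient is at most \<open>\<Lambda>\<close> times the Riemannian one (all squared), so \<open>rellich_inequality\<close> carries over to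
  \<open>M\<close>.  Its functionals are integrals over cells with respect to Lebesgue measure; multiplying by the
  reciprocal density turns them into inner products with bounded functions on \<open>M\<close>.
\<close>

lemma chart_ball_inequality:
  assumes c: "c \<in> A" and r: "r > 0" and K: "cball a r \<subseteq> chart_img c" and e: "e > 0"
  shows "\<exists>ws. set ws \<subseteq> L2 nu \<and> (\<forall>\<phi>\<in>smooth_functions A.
    (LINT p|nu. indicator (chart_inv c ` cball a r) p * (\<phi> p)\<^sup>2) \<le>
      e * dirichlet_form A g nu \<phi> \<phi> + (\<Sum>w\<leftarrow>ws. (l2_inner nu w \<phi>)\<^sup>2))"
proof -
  let ?K = "cball a r"
  have ck: "compact ?K" by simp
  have KB: "?K \<in> sets borel" by simp
  have wK: "continuous_on ?K (dens c)" using dens_cont[OF c] K continuous_on_subset by blast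
  have ne: "?K \<noteq> {}" using r by simp
  obtain x0 where x0: "x0 \<in> ?K" "\<And>x. x \<in> ?K \<Longrightarrow> dens c x0 \<le> dens c x"
    using continuous_attains_inf[OF ck ne wK] by blast
  obtain x1 where x1: "x1 \<in> ?K" "\<And>x. x \<in> ?K \<Longrightarrow> dens c x \<le> dens c x1"
    using continuous_attains_sup[OF ck ne wK] by blast
  define \<alpha> \<beta> where "\<alpha> = dens c x0" and "\<beta> = dens c x1"
  have \<alpha>: "\<alpha> > 0" and \<beta>: "\<beta> > 0" using dens_pos[OF c] x0(1) x1(1) K by (auto simp: \<alpha>_def \<beta>_def)
  have \<alpha>w: "\<alpha> \<le> dens c x" "dens c x \<le> \<beta>" if "x \<in> ?K" for x using x0 x1 that by (auto simp: \<alpha>_def \<beta>_def)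
  obtain \<Lambda> where \<Lambda>: "\<Lambda> > 0"
    "\<And>x (f :: 'm \<Rightarrow> real). x \<in> ?K \<Longrightarrow> (norm (coord_partials c f (chart_inv c x)))\<^sup>2 \<le> \<Lambda> * chart_grad_inner c f f (chart_inv c x)"
    using gradient_bound[OF c ck K] by metis
  \<comment> \<open>absorbs the constants of both comparisons\<close>
  define e' where "e' = e * \<alpha> / (\<beta> * \<Lambda>)"
  have e': "e' > 0" using e \<alpha> \<beta> \<Lambda>(1) by (simp add: e'_def)
  obtain Qs where Qs': "\<forall>Q\<in>set Qs. Q \<in> sets borel \<and> Q \<subseteq> ?K"
    and rellich: "\<forall>u G. continuous_on ?K u \<longrightarrow> continuous_on ?K G \<longrightarrow>
      (\<forall>x\<in>?K. (u has_derivative (\<lambda>v. G x \<bullet> v)) (at x)) \<longrightarrow>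
      (LINT x|lborel. indicator ?K x * (u x)\<^sup>2) \<le>
      e' * (LINT x|lborel. indicator ?K x * (norm (G x))\<^sup>2) +
      (\<Sum>Q\<leftarrow>Qs. (LINT x|lborel. indicator Q x * u x)\<^sup>2 / measure lborel Q)"
    using rellich_inequality[OF ck convex_cball e'] by (elim exE conjE) (rule that)
  have Qs: "Q \<in> sets borel \<and> Q \<subseteq> ?K" if "Q \<in> set Qs" for Q using Qs' that by blast
  define \<omega> where "\<omega> Q p = indicator (chart_inv c ` Q) p * inv_dens c p" for Q p
  \<comment> \<open>a null cell gets the factor 0, and its summand in \<open>rellich\<close> is 0 as well\<close>
  define k where "k Q = sqrt (\<beta> * mass / measure lborel Q)" for Q :: "(real ^ 'n) set"
  define ws where "ws = map (\<lambda>Q. k Q *\<^sub>R \<omega> Q) Qs"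
  have k2: "(k Q)\<^sup>2 = \<beta> * mass / measure lborel Q" for Q
    using \<beta> mass by (simp add: k_def)
  have \<omega>m: "\<omega> Q \<in> borel_measurable vol" if "Q \<in> set Qs" for Q
    unfolding \<omega>_def using inv_image_sets[OF c, of Q] Qs[OF that] K inv_dens_measurable[OF c] by auto
  interpret nu: finite_measure nu by (rule finite_measure_nu)
  interpret L: semi_inner "L2 nu" "l2_inner nu" by (rule L2_semi_inner)
  have \<omega>L: "\<omega> Q \<in> L2 nu" if Q: "Q \<in> set Qs" for Q
  proof -
    have "\<bar>\<omega> Q p\<bar> \<le> 1 / \<alpha>" for p
    proof (cases "p \<in> chart_inv c ` Q")
      case True
      then obtain x where x: "x \<in> Q" "p = chart_inv c x" by blast
      then have xK: "x \<in> ?K" using Qs[OF Q] by blast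
      then have "chart_map c p = x" "p \<in> chart_dom c" using x K map_inv[OF c] inv_dom[OF c] by auto
      then have "\<omega> Q p = 1 / dens c x" using True by (simp add: \<omega>_def inv_dens_def)
      then show ?thesis using \<alpha>w(1)[OF xK] \<alpha> by (simp add: frac_le)
    qed (use \<alpha> in \<open>simp add: \<omega>_def\<close>)
    then have "(\<omega> Q p)\<^sup>2 \<le> (1 / \<alpha>)\<^sup>2" for p by (metis power2_abs abs_ge_zero power_mono)
    then have "integrable nu (\<lambda>p. (\<omega> Q p)\<^sup>2)"
      using \<omega>m[OF Q] by (intro nu.integrable_const_bound[of _ "(1 / \<alpha>)\<^sup>2"]) auto
    then show ?thesis using \<omega>m[OF Q] by (simp add: L2_def)
  qed
  have "set ws \<subseteq> L2 nu" using \<omega>L by (auto simp: ws_def)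
  moreover have "(LINT p|nu. indicator (chart_inv c ` ?K) p * (\<phi> p)\<^sup>2) \<le>
      e * dirichlet_form A g nu \<phi> \<phi> + (\<Sum>w\<leftarrow>ws. (l2_inner nu w \<phi>)\<^sup>2)" if \<phi>: "\<phi> \<in> smooth_functions A" for \<phi>
  proof -
    define u where "u x = \<phi> (chart_inv c x)" for x
    define G where "G x = coord_partials c \<phi> (chart_inv c x)" for x
    let ?gi = "grad_inner A g \<phi> \<phi>"
    have \<phi>c: "continuous_on M \<phi>" by (rule smooth_continuous[OF \<phi>])
    have \<phi>m: "\<phi> \<in> borel_measurable vol" by (rule continuous_measurable[OF \<phi>c])
    have gim: "?gi \<in> borel_measurable vol" by (intro continuous_measurable grad_inner_cont \<phi>)
    have uc: "continuous_on ?K u"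
      using smooth_on_continuous[of "chart_img c" "\<phi> \<circ> chart_inv c"] \<phi> c K
      unfolding u_def smooth_functions_def o_def by (auto intro: continuous_on_subset)
    have Gc: "continuous_on ?K G"
      unfolding G_def by (rule continuous_on_subset[OF coord_partials_cont[OF \<phi> c] K])
    have cgc: "continuous_on ?K (\<lambda>x. dens c x * chart_grad_inner c \<phi> \<phi> (chart_inv c x))"
      by (intro continuous_on_mult wK continuous_on_subset[OF chart_grad_inner_cont[OF \<phi> \<phi> c] K])
    have der: "(u has_derivative (\<lambda>v. G x \<bullet> v)) (at x)" if x: "x \<in> ?K" for x
    proof -
      have xi: "x \<in> chart_img c" using x K by blast
      have p: "chart_inv c x \<in> chart_dom c" by (rule inv_dom[OF c xi])
      have "((\<phi> \<circ> chart_inv c) has_derivative frechet_derivative (\<phi> \<circ> chart_inv c) (at x)) (at x)"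
        using smooth_differentiable[OF \<phi> c p] frechet_derivative_works map_inv[OF c xi] by metis
      moreover have "frechet_derivative (\<phi> \<circ> chart_inv c) (at x) = (\<lambda>v. G x \<bullet> v)"
        using coord_partials_inner[OF \<phi> c p] map_inv[OF c xi] by (simp add: G_def fun_eq_iff)
      ultimately show ?thesis by (simp add: u_def[abs_def] o_def)
    qed
    have int: "integrable lborel (\<lambda>x. indicator ?K x * h x)" if "continuous_on ?K h" for h :: "real ^ 'n \<Rightarrow> real"
      using borel_integrable_compact[OF ck that] by simp
    have "(LINT p|vol. indicator (chart_inv c ` ?K) p * (\<phi> p)\<^sup>2) =
        (LINT x|lborel. indicator ?K x * (dens c x * (u x)\<^sup>2))"
      using \<phi>m unfolding u_def by (intro chart_integral_on c KB K) auto
    also have "\<dots> \<le> (LINT x|lborel. \<beta> * (indicator ?K x * (u x)\<^sup>2))"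
    proof (intro integral_mono integrable_mult_right int continuous_intros uc wK)
      show "indicator ?K x * (dens c x * (u x)\<^sup>2) \<le> \<beta> * (indicator ?K x * (u x)\<^sup>2)" for x
        using \<alpha>w(2)[of x] by (auto simp: indicator_def intro!: mult_right_mono)
    qed
    also have "\<dots> = \<beta> * (LINT x|lborel. indicator ?K x * (u x)\<^sup>2)" by simp
    finally have 1: "(LINT p|vol. indicator (chart_inv c ` ?K) p * (\<phi> p)\<^sup>2) \<le>
        \<beta> * (LINT x|lborel. indicator ?K x * (u x)\<^sup>2)" .
    have "(LINT x|lborel. indicator ?K x * (norm (G x))\<^sup>2) \<le>
        (LINT x|lborel. \<Lambda> / \<alpha> * (indicator ?K x * (dens c x * chart_grad_inner c \<phi> \<phi> (chart_inv c x))))"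
    proof (intro integral_mono integrable_mult_right int cgc continuous_intros Gc)
      fix x
      show "indicator ?K x * (norm (G x))\<^sup>2 \<le>
        \<Lambda> / \<alpha> * (indicator ?K x * (dens c x * chart_grad_inner c \<phi> \<phi> (chart_inv c x)))"
      proof (cases "x \<in> ?K")
        case True
        let ?q = "chart_grad_inner c \<phi> \<phi> (chart_inv c x)"
        have le: "(norm (G x))\<^sup>2 \<le> \<Lambda> * ?q" unfolding G_def by (rule \<Lambda>(2)[OF True])
        then have "\<Lambda> * ?q \<ge> 0" using zero_le_power2 order_trans by blast
        then have q0: "?q \<ge> 0" using \<Lambda>(1) by (simp add: zero_le_mult_iff)
        have "\<alpha> * ?q \<le> dens c x * ?q" using \<alpha>w(1)[OF True] q0 by (intro mult_right_mono)
        then have "\<Lambda> / \<alpha> * (\<alpha> * ?q) \<le> \<Lambda> / \<alpha> * (dens c x * ?q)" using \<Lambda>(1) \<alpha> by (intro mult_left_mono) auto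
        moreover have "\<Lambda> / \<alpha> * (\<alpha> * ?q) = \<Lambda> * ?q" using \<alpha> by simp
        ultimately show ?thesis using le True by simp
      qed simp
    qed
    also have "\<dots> = \<Lambda> / \<alpha> * (LINT x|lborel. indicator ?K x * (dens c x * chart_grad_inner c \<phi> \<phi> (chart_inv c x)))"
      by simp
    also have "(LINT x|lborel. indicator ?K x * (dens c x * chart_grad_inner c \<phi> \<phi> (chart_inv c x))) =
        (LINT x|lborel. indicator ?K x * (dens c x * ?gi (chart_inv c x)))"
    proof (intro Bochner_Integration.integral_cong refl)
      fix x
      have "?gi (chart_inv c x) = chart_grad_inner c \<phi> \<phi> (chart_inv c x)" if "x \<in> ?K"
        using that K inv_dom[OF c] by (intro grad_inner_chart \<phi> c) auto
      then show "indicator ?K x * (dens c x * chart_grad_inner c \<phi> \<phi> (chart_inv c x)) =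
          indicator ?K x * (dens c x * ?gi (chart_inv c x))" by (auto simp: indicator_def)
    qed
    also have "\<dots> = (LINT p|vol. indicator (chart_inv c ` ?K) p * ?gi p)"
      by (intro chart_integral_on[symmetric] c KB K gim)
    also have "\<Lambda> / \<alpha> * (LINT p|vol. indicator (chart_inv c ` ?K) p * ?gi p) \<le> \<Lambda> / \<alpha> * (LINT p|vol. ?gi p)"
    proof (intro mult_left_mono integral_mono)
      have gi: "integrable vol ?gi" by (intro continuous_integrable_vol grad_inner_cont \<phi>)
      then show "integrable vol ?gi" .
      show "integrable vol (\<lambda>p. indicator (chart_inv c ` ?K) p * ?gi p)"
        using integrable_mult_indicator[OF inv_image_sets[OF c KB K] gi] by simp
      show "indicator (chart_inv c ` ?K) p * ?gi p \<le> ?gi p" if "p \<in> space vol" for p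
        using grad_inner_nonneg[OF \<phi>] that by (auto simp: indicator_def)
    qed (use \<Lambda>(1) \<alpha> in auto)
    also have "(LINT p|vol. ?gi p) = mass * dirichlet_form A g nu \<phi> \<phi>"
      using nu_integral[OF gim] mass by (simp add: dirichlet_form_def)
    finally have 2: "(LINT x|lborel. indicator ?K x * (norm (G x))\<^sup>2) \<le>
        \<Lambda> / \<alpha> * (mass * dirichlet_form A g nu \<phi> \<phi>)" .
    have 3: "(LINT x|lborel. indicator Q x * u x) = mass * l2_inner nu (\<omega> Q) \<phi>" if Q: "Q \<in> set Qs" for Q
    proof -
      have QK: "Q \<in> sets borel" "Q \<subseteq> ?K" "Q \<subseteq> chart_img c" using Qs[OF Q] K by auto
      have "l2_inner nu (\<omega> Q) \<phi> = (LINT p|vol. \<omega> Q p * \<phi> p) / mass"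
        unfolding l2_inner_def using \<omega>m[OF Q] \<phi>m by (intro nu_integral) auto
      also have "(LINT p|vol. \<omega> Q p * \<phi> p) = (LINT p|vol. indicator (chart_inv c ` Q) p * (inv_dens c p * \<phi> p))"
        by (simp add: \<omega>_def mult.assoc)
      also have "\<dots> = (LINT x|lborel. indicator Q x * (dens c x * (inv_dens c (chart_inv c x) * \<phi> (chart_inv c x))))"
        using inv_dens_measurable[OF c] \<phi>m by (intro chart_integral_on c QK) auto
      also have "\<dots> = (LINT x|lborel. indicator Q x * u x)"
      proof (intro Bochner_Integration.integral_cong refl)
        fix x
        show "indicator Q x * (dens c x * (inv_dens c (chart_inv c x) * \<phi> (chart_inv c x))) = indicator Q x * u x"
        proof (cases "x \<in> Q")
          case True
          then have xi: "x \<in> chart_img c" using QK by blast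
          then show ?thesis using dens_pos[OF c xi] inv_dom[OF c xi] map_inv[OF c xi] True
            by (simp add: inv_dens_def u_def)
        qed simp
      qed
      finally show ?thesis using mass by simp
    qed
    have "(LINT p|nu. indicator (chart_inv c ` ?K) p * (\<phi> p)\<^sup>2) =
        (LINT p|vol. indicator (chart_inv c ` ?K) p * (\<phi> p)\<^sup>2) / mass"
      using inv_image_sets[OF c KB K] \<phi>m by (intro nu_integral) auto
    also have "\<dots> \<le> \<beta> * (LINT x|lborel. indicator ?K x * (u x)\<^sup>2) / mass"
      using 1 mass by (intro divide_right_mono) auto
    also have "\<dots> \<le> \<beta> * (e' * (LINT x|lborel. indicator ?K x * (norm (G x))\<^sup>2) +
        (\<Sum>Q\<leftarrow>Qs. (LINT x|lborel. indicator Q x * u x)\<^sup>2 / measure lborel Q)) / mass"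
      using rellich[rule_format, OF uc Gc der] \<beta> mass by (intro divide_right_mono mult_left_mono) auto
    also have "\<dots> \<le> \<beta> * (e' * (\<Lambda> / \<alpha> * (mass * dirichlet_form A g nu \<phi> \<phi>)) +
        (\<Sum>Q\<leftarrow>Qs. (LINT x|lborel. indicator Q x * u x)\<^sup>2 / measure lborel Q)) / mass"
      using 2 \<beta> mass e' by (intro divide_right_mono mult_left_mono add_right_mono) auto
    also have "\<dots> = e * dirichlet_form A g nu \<phi> \<phi> +
        \<beta> / mass * (\<Sum>Q\<leftarrow>Qs. (LINT x|lborel. indicator Q x * u x)\<^sup>2 / measure lborel Q)"
      using \<beta> mass \<Lambda>(1) \<alpha> by (simp add: e'_def field_simps)
    also have "\<beta> / mass * (\<Sum>Q\<leftarrow>Qs. (LINT x|lborel. indicator Q x * u x)\<^sup>2 / measure lborel Q) =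
        (\<Sum>Q\<leftarrow>Qs. \<beta> / mass * ((LINT x|lborel. indicator Q x * u x)\<^sup>2 / measure lborel Q))"
      by (rule sum_list_const_mult[symmetric])
    also have "\<dots> = (\<Sum>Q\<leftarrow>Qs. (l2_inner nu (k Q *\<^sub>R \<omega> Q) \<phi>)\<^sup>2)"
    proof (intro arg_cong[where f = sum_list] map_cong refl)
      fix Q assume Q: "Q \<in> set Qs"
      have "(l2_inner nu (k Q *\<^sub>R \<omega> Q) \<phi>)\<^sup>2 = (k Q)\<^sup>2 * (l2_inner nu (\<omega> Q) \<phi>)\<^sup>2"
        using L.scale_left[OF \<omega>L[OF Q] continuous_L2[OF \<phi>c]] by (simp add: power_mult_distrib)
      also have "\<dots> = \<beta> * mass / measure lborel Q * (l2_inner nu (\<omega> Q) \<phi>)\<^sup>2" by (simp only: k2)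
      also have "\<dots> = \<beta> / mass * ((mass * l2_inner nu (\<omega> Q) \<phi>)\<^sup>2 / measure lborel Q)"
        using mass by (simp add: power2_eq_square)
      finally show "\<beta> / mass * ((LINT x|lborel. indicator Q x * u x)\<^sup>2 / measure lborel Q) =
          (l2_inner nu (k Q *\<^sub>R \<omega> Q) \<phi>)\<^sup>2"
        by (simp only: 3[OF Q])
    qed
    also have "\<dots> = (\<Sum>w\<leftarrow>ws. (l2_inner nu w \<phi>)\<^sup>2)" by (simp add: ws_def o_def)
    finally show ?thesis .
  qed
  ultimately show ?thesis by blast
qed

text \<open>
  Add the inequalities for finitely many coordinate balls that cover \<open>M\<close>; the energy is counted once for
  every ball.
\<close>

theorem form_domain_precompact:
  assumes e: "e > 0"
  shows "\<exists>ws. set ws \<subseteq> L2 nu \<and> (\<forall>\<phi>\<in>smooth_functions A.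
    l2_inner nu \<phi> \<phi> \<le> e * dirichlet_form A g nu \<phi> \<phi> + (\<Sum>w\<leftarrow>ws. (l2_inner nu w \<phi>)\<^sup>2))"
proof -
  obtain I :: "(('m, 'n) chart \<times> (real ^ 'n) \<times> real) set" where I: "finite I"
    "I \<subseteq> {(c, a, r). c \<in> A \<and> r > 0 \<and> cball a r \<subseteq> chart_img c}"
    "M \<subseteq> (\<Union>(c, a, r)\<in>I. chart_inv c ` cball a r)" by (rule ball_cover)
  define U :: "('m, 'n) chart \<times> (real ^ 'n) \<times> real \<Rightarrow> 'm set"
    where "U = (\<lambda>(c, a, r). chart_inv c ` cball a r)"
  have U: "M \<subseteq> (\<Union>i\<in>I. U i)" using I(3) by (simp add: U_def)
  have Us: "U i \<in> sets vol" if "i \<in> I" for i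
    using subsetD[OF I(2) that] by (auto simp: U_def intro!: inv_image_sets)
  define e' where "e' = e / (real (card I) + 1)"
  have e': "e' > 0" using e by (simp add: e'_def add_nonneg_pos)
  have "\<forall>i\<in>I. \<exists>ws. set ws \<subseteq> L2 nu \<and> (\<forall>\<phi>\<in>smooth_functions A.
    (LINT p|nu. indicator (U i) p * (\<phi> p)\<^sup>2) \<le>
      e' * dirichlet_form A g nu \<phi> \<phi> + (\<Sum>w\<leftarrow>ws. (l2_inner nu w \<phi>)\<^sup>2))"
  proof
    fix i assume "i \<in> I"
    then obtain c a r where car: "i = (c, a, r)" "c \<in> A" "r > 0" "cball a r \<subseteq> chart_img c" using I(2) by auto
    show "\<exists>ws. set ws \<subseteq> L2 nu \<and> (\<forall>\<phi>\<in>smooth_functions A.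
    (LINT p|nu. indicator (U i) p * (\<phi> p)\<^sup>2) \<le>
      e' * dirichlet_form A g nu \<phi> \<phi> + (\<Sum>w\<leftarrow>ws. (l2_inner nu w \<phi>)\<^sup>2))"
      using chart_ball_inequality[OF car(2-4) e'] by (simp add: U_def car(1))
  qed
  from bchoice[OF this] obtain W where W: "\<forall>i\<in>I. set (W i) \<subseteq> L2 nu \<and> (\<forall>\<phi>\<in>smooth_functions A.
    (LINT p|nu. indicator (U i) p * (\<phi> p)\<^sup>2) \<le>
      e' * dirichlet_form A g nu \<phi> \<phi> + (\<Sum>w\<leftarrow>W i. (l2_inner nu w \<phi>)\<^sup>2))" by (elim exE)
  obtain xs where xs: "set xs = I" "distinct xs" using finite_distinct_list[OF I(1)] by blast
  have concat: "(\<Sum>w\<leftarrow>concat (map W ys). f w) = (\<Sum>i\<leftarrow>ys. \<Sum>w\<leftarrow>W i. f w)" for ys and f :: "('m \<Rightarrow> real) \<Rightarrow> real"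
    by (induction ys) auto
  interpret D: semi_inner "smooth_functions A" "dirichlet_form A g nu" by (rule dirichlet_semi_inner)
  show ?thesis
  proof (intro exI[of _ "concat (map W xs)"] conjI ballI)
    show "set (concat (map W xs)) \<subseteq> L2 nu" using W xs by auto
    fix \<phi> assume \<phi>: "\<phi> \<in> smooth_functions A"
    have \<phi>c: "continuous_on M \<phi>" by (rule smooth_continuous[OF \<phi>])
    have i2: "integrable nu (\<lambda>p. (\<phi> p)\<^sup>2)" by (intro continuous_integrable_nu continuous_intros \<phi>c)
    have iU: "integrable nu (\<lambda>p. indicator (U i) p * (\<phi> p)\<^sup>2)" if "i \<in> I" for i
      using integrable_mult_indicator[OF _ i2, of "U i"] Us[OF that] by simp
    have "l2_inner nu \<phi> \<phi> = (LINT p|nu. (\<phi> p)\<^sup>2)" by (simp add: l2_inner_def power2_eq_square)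
    also have "\<dots> \<le> (LINT p|nu. (\<Sum>i\<in>I. indicator (U i) p * (\<phi> p)\<^sup>2))"
    proof (intro integral_mono i2 Bochner_Integration.integrable_sum iU)
      fix p assume "p \<in> space nu"
      then have "p \<in> M" by simp
      then obtain i where i: "i \<in> I" "p \<in> U i" using U by blast
      have "(\<phi> p)\<^sup>2 = indicator (U i) p * (\<phi> p)\<^sup>2" using i by simp
      also have "\<dots> \<le> (\<Sum>i\<in>I. indicator (U i) p * (\<phi> p)\<^sup>2)"
        using i(1) I(1) by (intro member_le_sum) auto
      finally show "(\<phi> p)\<^sup>2 \<le> (\<Sum>i\<in>I. indicator (U i) p * (\<phi> p)\<^sup>2)" .
    qed
    also have "\<dots> = (\<Sum>i\<in>I. (LINT p|nu. indicator (U i) p * (\<phi> p)\<^sup>2))"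
      by (intro Bochner_Integration.integral_sum iU)
    also have "\<dots> \<le> (\<Sum>i\<in>I. e' * dirichlet_form A g nu \<phi> \<phi> + (\<Sum>w\<leftarrow>W i. (l2_inner nu w \<phi>)\<^sup>2))"
      using W \<phi> by (intro sum_mono) blast
    also have "\<dots> = real (card I) * e' * dirichlet_form A g nu \<phi> \<phi> + (\<Sum>i\<in>I. \<Sum>w\<leftarrow>W i. (l2_inner nu w \<phi>)\<^sup>2)"
      by (simp add: sum.distrib)
    also have "(\<Sum>i\<in>I. \<Sum>w\<leftarrow>W i. (l2_inner nu w \<phi>)\<^sup>2) = (\<Sum>w\<leftarrow>concat (map W xs). (l2_inner nu w \<phi>)\<^sup>2)"
      unfolding concat using xs by (simp add: sum_list_distinct_conv_sum_set)
    also have "real (card I) * e' * dirichlet_form A g nu \<phi> \<phi> \<le> e * dirichlet_form A g nu \<phi> \<phi>"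
    proof (rule mult_right_mono)
      show "real (card I) * e' \<le> e" using e by (simp add: e'_def field_simps)
    qed (rule D.nonneg[OF \<phi>])
    finally show "l2_inner nu \<phi> \<phi> \<le> e * dirichlet_form A g nu \<phi> \<phi> + (\<Sum>w\<leftarrow>concat (map W xs). (l2_inner nu w \<phi>)\<^sup>2)"
      by simp
  qed
qed

end

section \<open>Density of the smooth functions\<close>

context riemannian_manifold begin

definition bump :: "('m, 'n) chart \<Rightarrow> real ^ 'n \<Rightarrow> real \<Rightarrow> 'm \<Rightarrow> real" where
  "bump c a r p = (if p \<in> chart_dom c then flat 0 (r\<^sup>2 - (norm (chart_map c p - a))\<^sup>2) else 0)"

lemma bump_range: "0 \<le> bump c a r p" "bump c a r p \<le> 1"
  by (auto simp: bump_def flat_0)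

lemma bump_pos: "r > 0 \<Longrightarrow> bump c a r p > 0 \<longleftrightarrow> p \<in> chart_dom c \<and> chart_map c p \<in> ball a r"
proof -
  assume r: "r > 0"
  have "(norm y)\<^sup>2 < r\<^sup>2 \<longleftrightarrow> norm y < r" for y :: "real ^ 'n"
    using r power2_less_imp_less[of "norm y" r] power_strict_mono[of "norm y" r 2] by auto
  then show ?thesis by (auto simp: bump_def flat_0 dist_norm norm_minus_commute)
qed

text \<open>
  In another chart, the bump is smooth on the overlap with the domain of \<open>c\<close>, and it vanishes on the
  complement of the image of the closed ball.  That image is compact, hence closed in \<open>M\<close>, so the two
  sets are open and cover.
\<close>

lemma bump_smooth:
  assumes c: "c \<in> A" and r: "r > 0" and K: "cball a r \<subseteq> chart_img c"
  shows "bump c a r \<in> smooth_functions A"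
  unfolding smooth_functions_def
proof (intro CollectI ballI)
  fix d assume d: "d \<in> A"
  define C where "C = chart_inv c ` cball a r"
  have "compact C" unfolding C_def
    by (intro compact_continuous_image continuous_on_subset[OF inv_cont[OF c] K] compact_cball)
  then have "closed C" by (rule compact_imp_closed)
  then have opC: "openin (top_of_set M) (M - C)" by (auto simp: openin_open intro!: exI[of _ "- C"])
  define S1 where "S1 = chart_map d ` (chart_dom d \<inter> chart_dom c)"
  define S2 where "S2 = chart_map d ` (chart_dom d \<inter> (M - C))"
  have o1: "open S1" unfolding S1_def by (rule open_map_image[OF d dom_open[OF c]])
  have o2: "open S2" unfolding S2_def by (rule open_map_image[OF d opC])
  have "C \<subseteq> chart_dom c" using inv_dom[OF c] K by (auto simp: C_def)
  then have un: "S1 \<union> S2 = chart_img d"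
    using dom_subset[OF d] by (auto simp: S1_def S2_def chart_img_def)
  have s1: "smooth_on S1 (bump c a r \<circ> chart_inv d)"
  proof (rule smooth_on_cong[OF o1])
    let ?D = "\<lambda>i x. transition d c x $ i + (- a $ i)"
    have "smooth_on S1 (\<lambda>x. transition d c x $ i)" for i
      using transition_smooth[OF d c] unfolding S1_def[symmetric]
      by (rule smooth_on_bounded_linear[OF o1 bounded_linear_vec_nth])
    then show "smooth_on S1 (\<lambda>x. flat 0 (r\<^sup>2 + (- 1) * (\<Sum>i\<in>UNIV. ?D i x * ?D i x)))"
      by (intro smooth_on_flat smooth_on_add smooth_on_mult smooth_on_sum smooth_on_const o1)
    fix x assume "x \<in> S1"
    then obtain p where p: "p \<in> chart_dom d" "p \<in> chart_dom c" "x = chart_map d p" by (auto simp: S1_def)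
    have "chart_inv d x = p" using p inv_map[OF d] by simp
    moreover have "(\<Sum>i\<in>UNIV. ?D i x * ?D i x) = (norm (chart_map c p - a))\<^sup>2"
      unfolding power2_norm_eq_inner inner_vec_def using \<open>chart_inv d x = p\<close>
      by (simp add: transition_def)
    ultimately show "flat 0 (r\<^sup>2 + (- 1) * (\<Sum>i\<in>UNIV. ?D i x * ?D i x)) = (bump c a r \<circ> chart_inv d) x"
      using p by (simp add: bump_def)
  qed
  have s2: "smooth_on S2 (bump c a r \<circ> chart_inv d)"
  proof (rule smooth_on_cong[OF o2 smooth_on_const[OF o2]])
    fix x assume "x \<in> S2"
    then obtain p where p: "p \<in> chart_dom d" "p \<notin> C" "x = chart_map d p" by (auto simp: S2_def)
    have inv: "chart_inv d x = p" using p inv_map[OF d] by simp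
    have "\<not> bump c a r p > 0"
    proof
      assume "bump c a r p > 0"
      then have "p \<in> chart_dom c" "chart_map c p \<in> cball a r" using bump_pos[OF r] by auto
      then have "p \<in> C" unfolding C_def using inv_map[OF c] by (metis imageI)
      then show False using p by blast
    qed
    then show "0 = (bump c a r \<circ> chart_inv d) x" using bump_range(1)[of c a r p] inv by simp
  qed
  show "smooth_on (chart_img d) (bump c a r \<circ> chart_inv d)"
    unfolding un[symmetric] by (rule smooth_on_Un[OF o1 o2 s1 s2])
qed

text \<open>
  This family is closed under intersections, since \<open>{b1 * b2 > 0} = {b1 > 0} \<inter> {b2 > 0}\<close>; it contains
  the coordinate balls, hence generates the Borel sets; and the indicator of each member is the limit of
  the smooth functions \<open>1 - (1 - b) ^ k\<close>.
\<close>

definition positivity_sets :: "'m set set" where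
  "positivity_sets = {U. \<exists>b\<in>smooth_functions A. (\<forall>p\<in>M. 0 \<le> b p \<and> b p \<le> 1) \<and> U = {p\<in>M. b p > 0}}"

lemma positivity_setsI:
  "b \<in> smooth_functions A \<Longrightarrow> (\<And>p. p \<in> M \<Longrightarrow> 0 \<le> b p \<and> b p \<le> 1) \<Longrightarrow> U = {p\<in>M. b p > 0} \<Longrightarrow>
    U \<in> positivity_sets"
  unfolding positivity_sets_def by blast

lemma positivity_sets_Int: "Int_stable positivity_sets"
proof (rule Int_stableI)
  fix U V assume "U \<in> positivity_sets" "V \<in> positivity_sets"
  then obtain b1 b2 where b: "b1 \<in> smooth_functions A" "b2 \<in> smooth_functions A"
    "\<forall>p\<in>M. 0 \<le> b1 p \<and> b1 p \<le> 1" "\<forall>p\<in>M. 0 \<le> b2 p \<and> b2 p \<le> 1"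
    "U = {p\<in>M. b1 p > 0}" "V = {p\<in>M. b2 p > 0}" by (auto simp: positivity_sets_def)
  have "U \<inter> V = {p\<in>M. b1 p * b2 p > 0}"
    using b by (auto simp: zero_less_mult_iff)
  moreover have "\<forall>p\<in>M. 0 \<le> b1 p * b2 p \<and> b1 p * b2 p \<le> 1" using b by (auto intro: mult_le_one)
  ultimately show "U \<inter> V \<in> positivity_sets"
    by (intro positivity_setsI[OF smooth_mult[OF b(1,2)]]) auto
qed

lemma chart_ball_positivity:
  assumes "c \<in> A" "r > 0" "cball a r \<subseteq> chart_img c"
  shows "chart_inv c ` ball a r \<in> positivity_sets"
proof -
  have "chart_inv c ` ball a r = {p\<in>M. bump c a r p > 0}"
  proof (intro set_eqI iffI)
    fix p assume "p \<in> chart_inv c ` ball a r"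
    then obtain x where x: "x \<in> ball a r" "p = chart_inv c x" by blast
    then have "x \<in> chart_img c" using assms(3) by auto
    then show "p \<in> {p\<in>M. bump c a r p > 0}"
      using x inv_dom[OF assms(1)] map_inv[OF assms(1)] dom_subset[OF assms(1)] bump_pos[OF assms(2)] by auto
  next
    fix p assume "p \<in> {p\<in>M. bump c a r p > 0}"
    then have "p \<in> chart_dom c" "chart_map c p \<in> ball a r" using bump_pos[OF assms(2)] by auto
    then show "p \<in> chart_inv c ` ball a r" using inv_map[OF assms(1)] by (metis imageI)
  qed
  then show ?thesis by (intro positivity_setsI[OF bump_smooth[OF assms]] conjI bump_range)
qed

end

context riemannian_measure begin

text \<open>
  Coordinate balls form a countable base in every chart, by the Lindelof property of \<open>real ^ 'n\<close>, and
  finitely many charts cover \<open>M\<close>.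
\<close>

lemma sets_vol_positivity: "sets vol \<subseteq> sigma_sets M positivity_sets"
proof -
  interpret S: sigma_algebra M "sigma_sets M positivity_sets"
    by (rule sigma_algebra_sigma_sets) (auto simp: positivity_sets_def)
  have dom: "chart_dom c \<inter> T \<in> sigma_sets M positivity_sets" if c: "c \<in> A" and T: "open T" for c T
  proof -
    define V where "V = chart_map c ` (chart_dom c \<inter> (M \<inter> T))"
    have V: "open V" unfolding V_def using T by (intro open_map_image c) auto
    define \<B> where "\<B> = {B. \<exists>a r. r > 0 \<and> cball a r \<subseteq> V \<and> B = ball a r}"
    have "\<Union>\<B> = V"
    proof
      show "\<Union>\<B> \<subseteq> V" using ball_subset_cball by (fastforce simp: \<B>_def)
      show "V \<subseteq> \<Union>\<B>"
      proof
        fix x assume "x \<in> V"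
        then obtain r where "r > 0" "cball x r \<subseteq> V" using V open_contains_cball by blast
        then have "ball x r \<in> \<B>" "x \<in> ball x r" by (auto simp: \<B>_def)
        then show "x \<in> \<Union>\<B>" by blast
      qed
    qed
    moreover obtain \<B>' where B': "\<B>' \<subseteq> \<B>" "countable \<B>'" "\<Union>\<B>' = \<Union>\<B>"
      using Lindelof[of \<B>] by (auto simp: \<B>_def)
    ultimately have UV: "\<Union>\<B>' = V" by simp
    have "chart_inv c ` V = chart_dom c \<inter> T"
      using inv_map[OF c] dom_subset[OF c] by (force simp: V_def image_image)
    then have "chart_dom c \<inter> T = (\<Union>B\<in>\<B>'. chart_inv c ` B)" using UV by blast
    moreover have "chart_inv c ` B \<in> sigma_sets M positivity_sets" if "B \<in> \<B>'" for B
    proof -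
      obtain a r where ar: "r > 0" "cball a r \<subseteq> V" "B = ball a r" using \<open>B \<in> \<B>'\<close> B'(1) by (auto simp: \<B>_def)
      have "V \<subseteq> chart_img c" by (auto simp: V_def chart_img_def)
      then show ?thesis using chart_ball_positivity[OF c ar(1)] ar by (intro sigma_sets.Basic) auto
    qed
    ultimately show ?thesis using S.countable_UN'[OF B'(2)] by (metis image_subsetI)
  qed
  have "M \<inter> T \<in> sigma_sets M positivity_sets" if T: "open T" for T
  proof -
    obtain I :: "(('m, 'n) chart \<times> (real ^ 'n) \<times> real) set" where I: "finite I"
      "I \<subseteq> {(c, a, r). c \<in> A \<and> r > 0 \<and> cball a r \<subseteq> chart_img c}"
      "M \<subseteq> (\<Union>(c, a, r)\<in>I. chart_inv c ` cball a r)" by (rule ball_cover)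
    have "M \<inter> T = (\<Union>i\<in>I. chart_dom (fst i) \<inter> T)"
    proof
      show "M \<inter> T \<subseteq> (\<Union>i\<in>I. chart_dom (fst i) \<inter> T)"
      proof
        fix p assume p: "p \<in> M \<inter> T"
        then obtain c a r x where "(c, a, r) \<in> I" "x \<in> cball a r" "p = chart_inv c x" using I(3) by fastforce
        moreover from this have "p \<in> chart_dom c" using I(2) inv_dom by blast
        ultimately show "p \<in> (\<Union>i\<in>I. chart_dom (fst i) \<inter> T)" using p by force
      qed
      show "(\<Union>i\<in>I. chart_dom (fst i) \<inter> T) \<subseteq> M \<inter> T" using I(2) dom_subset by fastforce
    qed
    moreover have "(\<Union>i\<in>I. chart_dom (fst i) \<inter> T) \<in> sigma_sets M positivity_sets"
      using I(1,2) by (intro S.finite_UN dom T) auto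
    ultimately show ?thesis by simp
  qed
  then have "sigma_sets M {M \<inter> T | T. open T} \<subseteq> sigma_sets M positivity_sets"
    by (intro sigma_sets_mono) auto
  moreover have "sets vol = sigma_sets M {M \<inter> T | T. open T}"
  proof -
    have "sets (restrict_space borel M) = sigma_sets M ((\<inter>) M ` {S. open S})"
      using sigma_sets_Int[of M UNIV "{S. open S}"] M_borel
      unfolding sets_restrict_space sets_borel by simp
    moreover have "(\<inter>) M ` {S. open S} = {M \<inter> T | T. open T}" by auto
    ultimately show ?thesis by (simp add: sets_vol)
  qed
  ultimately show ?thesis by simp
qed

text \<open>
  If \<open>f\<close> is orthogonal to the smooth functions, its integral over each positivity set is zero by dominated
  convergence, and Dynkin's theorem extends this to all measurable sets.
\<close>

theorem smooth_dense:
  assumes f: "f \<in> L2 nu" and perp: "\<And>\<psi>. \<psi> \<in> smooth_functions A \<Longrightarrow> l2_inner nu f \<psi> = 0"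
  shows "l2_inner nu f f = 0"
proof -
  have one: "(\<lambda>p. 1) \<in> smooth_functions A" by (rule smooth_const)
  have fi: "integrable nu f"
    using L2_product_integrable[OF f continuous_L2[OF smooth_continuous[OF one]]] by simp
  have fm[measurable]: "f \<in> borel_measurable nu" using f by (simp add: L2_def)
  have sig: "sigma_sets M positivity_sets \<subseteq> sets nu"
  proof -
    have "positivity_sets \<subseteq> sets nu"
    proof
      fix U assume "U \<in> positivity_sets"
      then obtain b where b: "b \<in> smooth_functions A" "U = {p\<in>M. b p > 0}" by (auto simp: positivity_sets_def)
      have "b \<in> borel_measurable vol" by (intro continuous_measurable smooth_continuous b)
      then have "{p \<in> space vol. b p > 0} \<in> sets vol" by measurable
      then show "U \<in> sets nu" using b by simp
    qed
    then show ?thesis using sets.sigma_sets_subset[of positivity_sets nu] by simp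
  qed
  have zero: "set_lebesgue_integral nu B f = 0" if "B \<in> sets nu" for B
  proof -
    have B: "B \<in> sigma_sets M positivity_sets" using that sets_vol_positivity by auto
    have pow: "positivity_sets \<subseteq> Pow M" by (auto simp: positivity_sets_def)
    from B show ?thesis
    proof (induction rule: sigma_sets_induct_disjoint[OF positivity_sets_Int pow, consumes 1, case_names basic empty compl union])
      case (basic U)
      then obtain b where b: "b \<in> smooth_functions A" "\<forall>p\<in>M. 0 \<le> b p \<and> b p \<le> 1" "U = {p\<in>M. b p > 0}"
        by (auto simp: positivity_sets_def)
      define \<psi> where "\<psi> k p = 1 + (- 1) * (1 + (- 1) * b p) ^ k" for k p
      have \<psi>: "\<psi> k \<in> smooth_functions A" for k
        unfolding \<psi>_def by (intro smooth_add smooth_scale smooth_power smooth_const b)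
      have \<psi>m: "\<psi> k \<in> borel_measurable nu" for k
        using continuous_measurable[OF smooth_continuous[OF \<psi>]] by simp
      have Us: "U \<in> sets nu" using basic sig by (auto intro: sigma_sets.Basic)
      have "(\<lambda>k. LINT p|nu. f p * \<psi> k p) \<longlonglongrightarrow> (LINT p|nu. f p * indicator U p)"
      proof (rule integral_dominated_convergence[where w = "\<lambda>p. \<bar>f p\<bar>"])
        show "AE p in nu. (\<lambda>k. f p * \<psi> k p) \<longlonglongrightarrow> f p * indicator U p"
        proof (rule AE_I2)
          fix p assume "p \<in> space nu"
          then have p: "p \<in> M" by simp
          have "(\<lambda>k. \<psi> k p) \<longlonglongrightarrow> indicator U p"
          proof (cases "b p > 0")
            case True
            have "b p \<le> 1" using b(2) p by blast
            then have "norm (1 - b p) < 1" using True by simp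
            then have "(\<lambda>k. (1 - b p) ^ k) \<longlonglongrightarrow> 0" by (rule LIMSEQ_power_zero)
            then have "(\<lambda>k. 1 - (1 - b p) ^ k) \<longlonglongrightarrow> 1 - 0" by (rule tendsto_diff[OF tendsto_const])
            then show ?thesis using True p b(3) by (simp add: \<psi>_def)
          next
            case False
            then have "b p = 0" using b(2) p by force
            then show ?thesis using b(3) by (simp add: \<psi>_def)
          qed
          then show "(\<lambda>k. f p * \<psi> k p) \<longlonglongrightarrow> f p * indicator U p" by (intro tendsto_intros)
        qed
        show "AE p in nu. norm (f p * \<psi> k p) \<le> \<bar>f p\<bar>" for k
        proof (rule AE_I2)
          fix p assume "p \<in> space nu"
          then have "0 \<le> 1 - b p" "1 - b p \<le> 1" using b(2) by auto
          then have "0 \<le> (1 - b p) ^ k" "(1 - b p) ^ k \<le> 1" by (auto intro: power_le_one)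
          then have "\<bar>\<psi> k p\<bar> \<le> 1" by (simp add: \<psi>_def)
          then have "\<bar>f p\<bar> * \<bar>\<psi> k p\<bar> \<le> \<bar>f p\<bar> * 1" by (intro mult_left_mono) auto
          then show "norm (f p * \<psi> k p) \<le> \<bar>f p\<bar>" by (simp add: abs_mult)
        qed
        show "(\<lambda>p. f p * indicator U p) \<in> borel_measurable nu" using Us fm by (intro borel_measurable_times) auto
        show "(\<lambda>p. f p * \<psi> k p) \<in> borel_measurable nu" for k by (intro borel_measurable_times fm \<psi>m)
        show "integrable nu (\<lambda>p. \<bar>f p\<bar>)" using fi by simp
      qed
      moreover have "(LINT p|nu. f p * \<psi> k p) = 0" for k using perp[OF \<psi>] by (simp add: l2_inner_def)
      ultimately have "(LINT p|nu. f p * indicator U p) = 0" by (simp add: LIMSEQ_const_iff)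
      then show ?case by (simp add: set_lebesgue_integral_def mult.commute)
    next
      case empty
      show ?case by (simp add: set_lebesgue_integral_def)
    next
      case (compl B)
      then have Bs: "B \<in> sets nu" using sig by blast
      have "(LINT p|nu. f p) = 0" using perp[OF one] by (simp add: l2_inner_def)
      moreover have "(LINT p|nu. f p) = set_lebesgue_integral nu B f + set_lebesgue_integral nu (M - B) f"
      proof -
        have i: "set_integrable nu B f" "set_integrable nu (M - B) f"
          unfolding set_integrable_def using Bs sets.compl_sets[OF Bs]
          by (intro integrable_mult_indicator fi; simp)+
        have "set_lebesgue_integral nu (B \<union> (M - B)) f = set_lebesgue_integral nu B f + set_lebesgue_integral nu (M - B) f"
          by (intro set_integral_Un i) auto
        moreover have "B \<union> (M - B) = space nu" using sets.sets_into_space[OF Bs] by auto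
        ultimately show ?thesis using set_integral_space[OF fi] by simp
      qed
      ultimately show ?case using compl by simp
    next
      case (union B)
      then have Bs: "B i \<in> sets nu" for i using sig by blast
      have "set_integrable nu (\<Union>i. B i) f"
        unfolding set_integrable_def using Bs by (intro integrable_mult_indicator fi) auto
      then have "set_lebesgue_integral nu (\<Union>i. B i) f = (\<Sum>i. set_lebesgue_integral nu (B i) f)"
        using union(1) Bs by (intro lebesgue_integral_countable_add) (auto simp: disjoint_family_on_def)
      then show ?case using union(3) by simp
    qed
  qed
  have ae: "AE p in nu. f p = 0"
    by (rule density_unique_real[OF fi, of "\<lambda>p. 0"]) (use zero in \<open>auto simp: set_lebesgue_integral_def\<close>)
  have "(LINT p|nu. f p * f p) = (LINT p|nu. 0)"
  proof (rule Bochner_Integration.integral_cong_AE)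
    show "AE p in nu. f p * f p = 0" using ae by eventually_elim simp
  qed (use fm in auto)
  then show ?thesis by (simp add: l2_inner_def)
qed

end

section \<open>The Laplace--Beltrami operator as the operator of the Dirichlet form\<close>

lemma l2_norm_sq: "(l2_norm \<nu> f)\<^sup>2 = l2_inner \<nu> f f"
  by (simp add: l2_norm_def l2_inner_def)

lemma l2_norm_nonneg: "l2_norm \<nu> f \<ge> 0"
  by (simp add: l2_norm_def l2_inner_def)

lemma l2_norm_tendsto_0: "(\<lambda>k. l2_norm \<nu> (f k)) \<longlonglongrightarrow> 0 \<longleftrightarrow> (\<lambda>k. l2_inner \<nu> (f k) (f k)) \<longlonglongrightarrow> 0"
proof
  assume "(\<lambda>k. l2_norm \<nu> (f k)) \<longlonglongrightarrow> 0"
  then have "(\<lambda>k. (l2_norm \<nu> (f k))\<^sup>2) \<longlonglongrightarrow> 0\<^sup>2" by (rule tendsto_power)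
  then show "(\<lambda>k. l2_inner \<nu> (f k) (f k)) \<longlonglongrightarrow> 0" by (simp add: l2_norm_sq)
next
  assume "(\<lambda>k. l2_inner \<nu> (f k) (f k)) \<longlonglongrightarrow> 0"
  then have "(\<lambda>k. sqrt (l2_inner \<nu> (f k) (f k))) \<longlonglongrightarrow> sqrt 0" by (rule tendsto_real_sqrt)
  then show "(\<lambda>k. l2_norm \<nu> (f k)) \<longlonglongrightarrow> 0" by (simp add: l2_norm_def)
qed

sublocale riemannian_measure \<subseteq> laplace: form_operator "L2 nu" "l2_inner nu" "smooth_functions A" "dirichlet_form A g nu"
proof (intro form_operator.intro form_operator_axioms.intro L2_semi_inner dirichlet_semi_inner)
  show "smooth_functions A \<subseteq> L2 nu" using continuous_L2 smooth_continuous by blast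
  show "\<exists>u\<in>L2 nu. semi_inner.converges (l2_inner nu) x u"
    if "\<And>k. x k \<in> L2 nu" "semi_inner.cauchy (l2_inner nu) x" for x
    using that by (intro L2_complete finite_measure_nu) auto
  show "l2_inner nu f f = 0" if "f \<in> L2 nu" "\<And>\<psi>. \<psi> \<in> smooth_functions A \<Longrightarrow> l2_inner nu f \<psi> = 0" for f
    using that by (rule smooth_dense)
  show "\<exists>ws. set ws \<subseteq> L2 nu \<and> (\<forall>\<phi>\<in>smooth_functions A.
      l2_inner nu \<phi> \<phi> \<le> e * dirichlet_form A g nu \<phi> \<phi> + (\<Sum>w\<leftarrow>ws. (l2_inner nu w \<phi>)\<^sup>2))" if "e > 0" for e
    using that by (rule form_domain_precompact)
qed

context riemannian_measure begin

lemma laplace_beltrami_graph: "laplace_beltrami A g nu u h \<longleftrightarrow> laplace.graph u h"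
  unfolding laplace_beltrami_def laplace.graph_def laplace.approximates_def
    laplace.converges_def laplace.energy.cauchy_def l2_norm_tendsto_0 fun_minus_apply
  by blast

lemma eigenspace_eigen: "eigenspace A g nu \<kappa> = laplace.eigen \<kappa>"
  by (simp add: eigenspace_def laplace.eigen_def laplace_beltrami_graph fun_scaleR_real)

lemma eigenvalues_eigen: "eigenvalues A g nu = {\<kappa>. \<exists>u\<in>laplace.eigen \<kappa>. l2_inner nu u u \<noteq> 0}"
  by (simp add: eigenvalues_def eigenspace_eigen l2_norm_def)

lemma l2_proj_eigen:
  assumes "\<kappa> > -1" "f \<in> L2 nu"
  shows "l2_proj nu (eigenspace A g nu \<kappa>) f \<in> laplace.eigen \<kappa>"
    and "h \<in> laplace.eigen \<kappa> \<Longrightarrow> l2_inner nu (f - l2_proj nu (eigenspace A g nu \<kappa>) f) h = 0"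
proof -
  have eq: "(\<lambda>x. f x - u x) = f - u" for u by (simp add: fun_minus_apply)
  have ex: "\<exists>u. u \<in> laplace.eigen \<kappa> \<and> (\<forall>h\<in>laplace.eigen \<kappa>. l2_inner nu (f - u) h = 0)"
    using laplace.eigen_projection[OF assms] by blast
  have "l2_proj nu (eigenspace A g nu \<kappa>) f \<in> laplace.eigen \<kappa> \<and>
      (\<forall>h\<in>laplace.eigen \<kappa>. l2_inner nu (f - l2_proj nu (eigenspace A g nu \<kappa>) f) h = 0)"
    unfolding l2_proj_def eigenspace_eigen eq
    by (rule someI_ex[OF ex])
  then show "l2_proj nu (eigenspace A g nu \<kappa>) f \<in> laplace.eigen \<kappa>"
    and "h \<in> laplace.eigen \<kappa> \<Longrightarrow> l2_inner nu (f - l2_proj nu (eigenspace A g nu \<kappa>) f) h = 0" by auto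
qed

end

theorem proposition2p3:
  fixes M :: "'m::t2_space set"
    and A :: "('m, 'n::finite) chart set"
    and g :: "('m, 'n) chart \<Rightarrow> 'm \<Rightarrow> real ^ 'n ^ 'n"
    and vol \<nu> :: "'m measure"
    and \<mu> :: "nat \<Rightarrow> real"
    and P :: "nat \<Rightarrow> ('m \<Rightarrow> real) \<Rightarrow> 'm \<Rightarrow> real"
    and s :: real
    and f :: "'m \<Rightarrow> real"
    and K :: nat
  assumes manifold: "compact_connected_riemannian_manifold M A g"
    and volume: "riemannian_volume M A g vol"
    and normalized: "\<nu> = uniform_measure vol M"
    and eigenvalues: "strict_mono \<mu>" "\<mu> 0 = 0" "range \<mu> = eigenvalues A g \<nu>"
    and projectors: "P = (\<lambda>j. l2_proj \<nu> (eigenspace A g \<nu> (\<mu> j)))"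
    and s: "s \<ge> 0"
    and f: "f \<in> spec_variation_space \<nu> \<mu> P s"
    and K: "K \<ge> 1"
  shows "sigma_block P K f (spec_sobolev_norm \<nu> \<mu> P s)
           \<le> spec_variation_norm \<nu> \<mu> P s f / ereal (sqrt (real K + 1)) \<and>
         sigma_block P K f (\<lambda>h. ereal (l2_norm \<nu> h))
           \<le> spec_variation_norm \<nu> \<mu> P s f / ereal (sqrt (real K + 1))"
proof -
  interpret riemannian_measure M A g vol
    by unfold_locales (rule manifold, rule volume)
  have \<nu>: "\<nu> = nu" by (simp add: normalized nu_def)
  have \<mu>0: "\<mu> j \<ge> 0" for j using strict_mono_less_eq[OF eigenvalues(1), of 0 j] eigenvalues(2) by simp
  have \<mu>1: "\<mu> j > -1" for j using \<mu>0[of j] by linarith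
  have fL: "f \<in> L2 nu" using f by (simp add: spec_variation_space_def \<nu>)
  have P: "P j h \<in> laplace.eigen (\<mu> j)"
    "k \<in> laplace.eigen (\<mu> j) \<Longrightarrow> l2_inner nu (h - P j h) k = 0" if "h \<in> L2 nu" for j h k
    using l2_proj_eigen[OF \<mu>1 that] by (auto simp: projectors \<nu>)
  define p where "p j = P j f" for j
  interpret E: eigen_expansion "L2 nu" "l2_inner nu" "smooth_functions A" "dirichlet_form A g nu" \<mu> f p
  proof (intro eigen_expansion.intro eigen_expansion_axioms.intro)
    show "form_operator (L2 nu) (l2_inner nu) (smooth_functions A) (dirichlet_form A g nu)"
      by (rule laplace.form_operator_axioms)
    show "inj \<mu>" using eigenvalues(1) by (rule strict_mono_imp_inj_on)
    show "range \<mu> = {\<kappa>. \<exists>u\<in>laplace.eigen \<kappa>. l2_inner nu u u \<noteq> 0}"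
      using eigenvalues(3) by (simp add: \<nu> eigenvalues_eigen)
  qed (use fL P in \<open>auto simp: p_def\<close>)
  define a where "a j = (1 + \<mu> j) powr (s / 2) * l2_norm nu (p j)" for j
  have a_nonneg: "a j \<ge> 0" for j by (simp add: a_def l2_norm_nonneg)
  have a_sq: "(a j)\<^sup>2 = (1 + \<mu> j) powr s * l2_inner nu (p j) (p j)" for j
    using \<mu>0[of j] by (simp add: a_def power_mult_distrib l2_norm_sq powr_power)
  have summable: "summable a"
    using f unfolding spec_variation_space_def spec_variation_norm_def \<nu> a_def p_def
    by (auto simp: Let_def split: if_splits)
  have norm: "spec_variation_norm \<nu> \<mu> P s f / ereal (sqrt (real K + 1)) = ereal (suminf a / sqrt (real K + 1))"
    using summable unfolding spec_variation_norm_def \<nu> a_def p_def by (simp add: Let_def)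
  obtain S where S: "finite S" "card S \<le> K" and tail: "summable (\<lambda>j. if j \<in> S then 0 else (a j)\<^sup>2)"
    and tail_le: "(\<Sum>j. if j \<in> S then 0 else (a j)\<^sup>2) \<le> (suminf a)\<^sup>2 / (real K + 1)"
    using l2_tail_of_summable[OF summable a_nonneg K] by blast
  define r where "r = f - sum p S"
  have r: "block_residual P f S = r"
    by (simp add: fun_eq_iff block_residual_def r_def p_def fun_sum_apply)
  have rL: "r \<in> L2 nu" unfolding r_def using fL by (simp add: laplace.sum_mem)
  have A0: "suminf a \<ge> 0" by (intro suminf_nonneg summable a_nonneg)
  have sqrt_le: "sqrt t \<le> suminf a / sqrt (real K + 1)" if "t \<le> (\<Sum>j. if j \<in> S then 0 else (a j)\<^sup>2)" for t
  proof -
    have "sqrt t \<le> sqrt ((suminf a)\<^sup>2 / (real K + 1))" using that tail_le by (intro real_sqrt_le_mono) linarith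
    then show ?thesis using A0 by (simp add: real_sqrt_divide)
  qed
  have block: "sigma_block P K f nrm \<le> nrm r" for nrm :: "('m \<Rightarrow> real) \<Rightarrow> ereal"
    unfolding sigma_block_def r[symmetric] by (rule INF_lower) (use S in auto)
  have "spec_sobolev_norm \<nu> \<mu> P s r \<le> ereal (suminf a / sqrt (real K + 1))"
  proof -
    have "(l2_norm nu (P j r))\<^sup>2 = (if j \<in> S then 0 else l2_inner nu (p j) (p j))" for j
      unfolding l2_norm_sq
      by (rule E.residual_projection_norm[OF S(1)]) (use P[OF rL] in \<open>auto simp: r_def\<close>)
    then have "(1 + \<mu> j) powr s * (l2_norm nu (P j r))\<^sup>2 = (if j \<in> S then 0 else (a j)\<^sup>2)" for j
      by (simp add: a_sq)
    then show ?thesis using tail sqrt_le[OF order_refl] by (simp add: spec_sobolev_norm_def \<nu>)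
  qed
  moreover have "ereal (l2_norm \<nu> r) \<le> ereal (suminf a / sqrt (real K + 1))"
  proof -
    have "l2_inner nu (p j) (p j) \<le> (a j)\<^sup>2" for j
    proof -
      have "1 \<le> (1 + \<mu> j) powr s" using \<mu>0[of j] s by (intro ge_one_powr_ge_zero) auto
      then have "1 * l2_inner nu (p j) (p j) \<le> (1 + \<mu> j) powr s * l2_inner nu (p j) (p j)"
        by (intro mult_right_mono) (auto simp: l2_norm_sq[symmetric])
      then show ?thesis by (simp add: a_sq)
    qed
    then have "(\<Sum>j. if j \<in> S then 0 else l2_inner nu (p j) (p j)) \<le> (\<Sum>j. if j \<in> S then 0 else (a j)\<^sup>2)"
      by (intro suminf_le tail sums_summable[OF E.residual_sums[OF S(1)]]) auto
    then have "l2_inner nu r r \<le> (\<Sum>j. if j \<in> S then 0 else (a j)\<^sup>2)"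
      using E.residual_sums[OF S(1)] by (simp add: sums_iff r_def)
    then show ?thesis using sqrt_le by (simp add: l2_norm_def \<nu>)
  qed
  ultimately show ?thesis unfolding norm
    using block[of "spec_sobolev_norm \<nu> \<mu> P s"] block[of "\<lambda>h. ereal (l2_norm \<nu> h)"]
    by (auto intro: order_trans)
qed

end
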